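(* Let $\boldsymbol{\mu}=(\mu_1,\dots,\mu_N)\in(\mathbb{T}\setminus\{1\})^N$ and $Q,P_1,\dots,P_T\in\mathbb{R}[X_1,\dots,X_N]$. Assume that $P_1,\dots,P_T$ satisfy the HDF hypothesis and that $\prod_{t=1}^T P_t(\mathbf{x})\to+\infty$ as $|\mathbf{x}|\to+\infty$ with $\mathbf{x}\in J^N$. Let $\mathbf{a}\in\mathbb{N}^N$, and set $$E(\mathbf{a})=\{\mathbf{m}\in(\mathbb{N}^* )^N:\ \mathbf{m}\ngeq\mathbf{a}+\mathbf{1}\}=\{\mathbf{m}\in(\mathbb{N}^* )^N:\ \exists n\in\{1,\dots,N\},\ m_n\le a_n\}.$$ Then for all $\mathbf{k}=(k_1,\dots,k_T)\in\mathbb{N}^T$ the following relation holds: $$\begin{aligned}(1-\boldsymbol{\mu}^{\mathbf{a}})\,Z(Q;P_1,\dots,P_T;\boldsymbol{\mu};-\mathbf{k})={}&\boldsymbol{\mu}^{\mathbf{a}}\sum_{\mathbf{0}\le\mathbf{u}<\mathbf{k}}\binom{\mathbf{k}}{\mathbf{u}}\,Z\Big(Q(\mathbf{X}+\mathbf{a})\prod_{t=1}^T(\Delta_{\mathbf{a}}P_t)^{k_t-u_t};P_1,\dots,P_T;\boldsymbol{\mu};-\mathbf{u}\Big)\\&+\boldsymbol{\mu}^{\mathbf{a}}\,Z(\Delta_{\mathbf{a}}Q;P_1,\dots,P_T;\boldsymbol{\mu};-\mathbf{k})+Z_{N-1}^{\mathbf{a}}(-\mathbf{k}),\end{aligned}$$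 where $$Z_{N-1}^{\mathbf{a}}(\mathbf{s})=\sum_{\mathbf{m}\in E(\mathbf{a})}\boldsymbol{\mu}^{\mathbf{m}}\,Q(\mathbf{m})\prod_{t=1}^T P_t(\mathbf{m})^{-s_t}$$ and $$Z_{N-1}^{\mathbf{a}}(\mathbf{s})=\sum_{q=1}^{N-1}\ \sum_{\substack{I\subset\{1,\dots,N\}\\ \#I=q}}\ \sum_{\mathbf{b}=(b_i)\in\prod_{i\in I^c}\{0,\dots,a_i\}}\Big(\prod_{i\in I^c}\mu_i^{b_i}\Big)\,Z\big(Q^{\mathbf{a},I,\mathbf{b}};P_1^{\mathbf{a},I,\mathbf{b}},\dots,P_T^{\mathbf{a},I,\mathbf{b}};(\mu_i)_{i\in I};\mathbf{s}\big).$$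
   Context: Here $N,T\ge1$ are integers. Notation: $\mathbb{N}=\{0,1,2,\dots\}$, $\mathbb{N}^*=\mathbb{N}\setminus\{0\}$, $J=[1,+\infty[$, $\mathbb{T}=\{z\in\mathbb{C}:|z|=1\}$ (not to be confused with the integer $T$), $\mathbf{0}=(0,\dots,0)$, $\mathbf{1}=(1,\dots,1)$, $|\mathbf{x}|=|x_1|+\dots+|x_N|$, $\mathbf{z}^{\mathbf{m}}=\prod_n z_n^{m_n}$. HDF (weak decreasing hypothesis): $P\in\mathbb{R}[X_1,\dots,X_N]$ satisfies HDF if $P(\mathbf{x})>0$ for all $\mathbf{x}\in J^N$ and there exists $\epsilon_0>0$ such that for all $\boldsymbol{\alpha}\in\mathbb{N}^N$ and $n\in\{1,\dots,N\}$ with $\alpha_n\ge1$ there is a constant $C>0$ with $\left|\frac{\partial^{\boldsymbol{\alpha}}P}{P}(\mathbf{x})\right|\le C\,x_n^{-\epsilon_0}$ for all $\mathbf{x}\in J^N$. Zeta series: for $\mathbf{s}=(s_1,\dots,s_T)\in\mathbb{C}^T$, $$Z(Q;P_1,\dots,P_T;\boldsymbol{\mu};\mathbf{s})=\sum_{\mathbf{m}\in(\mathbb{N}^* )^N}\boldsymbol{\mu}^{\mathbf{m}}\,Q(\mathbf{m})\prod_{t=1}^T P_t(\mathbf{m})^{-s_t},$$ absolutely convergent when $\Re(s_1),\dots,\Re(s_T)$ are sufficiently large. Under the hypotheses of the claim it is known (de Crisenoy) that it extends holomorphically to $\mathbb{C}^T$. The same notation is used for holomorphic continuations, and likewise for $Z_{N-1}^{\mathbf{a}}$;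 values at negative integers are those of the continuations. Differences: $\Delta_{\mathbf{a}}P(\mathbf{X})=P(\mathbf{X}+\mathbf{a})-P(\mathbf{X})$. Multi-indices: $\mathbf{0}\le\mathbf{u}<\mathbf{k}$ means $\mathbf{u}\in\mathbb{N}^T$, $u_t\le k_t$ for all $t$ and $\mathbf{u}\ne\mathbf{k}$; $\binom{\mathbf{k}}{\mathbf{u}}=\prod_{t=1}^T\binom{k_t}{u_t}$. Restricted functions: let $I=\{i_1,\dots,i_q\}\subset\{1,\dots,N\}$ with $q=\#I$, $I^c=\{1,\dots,N\}\setminus I=\{j_1,\dots,j_{N-q}\}$ and $\mathbf{b}=(b_i)_{i\in I^c}\in\prod_{i\in I^c}\{0,\dots,a_i\}$. For $f:\mathbb{N}^N\to\mathbb{C}$, the function $f^{\mathbf{a},I,\mathbf{b}}:\mathbb{N}^q\to\mathbb{C}$ is $f^{\mathbf{a},I,\mathbf{b}}(d_1,\dots,d_q)=f(m_1,\dots,m_N)$ with $m_{i_k}=a_{i_k}+d_k$ for $k=1,\dots,q$ and $m_{j_k}=b_{j_k}$ for $k=1,\dots,N-q$.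
   Formalization: In the second formula for Z_{N-1}^a, q runs from 0 (not 1), each b_i over {1,…,a_i} (not {0,…,a_i}), and each term has the extra factor ∏_{i∈I} μ_i^{a_i}; as printed it contradicts the series over E(a), e.g. N=T=1, Q=1, P=X, a=1, μ=−1. *)

theory Defs
  imports "HOL-Analysis.Analysis"
begin

text \<open>
  The index sets {1..N} and {1..T} are the finite types 'n and 't, so N and T are
  arbitrary positive integers. Real polynomials in N variables are identified with the
  library's \<^const>\<open>real_polynomial_function\<close> on \<^typ>\<open>real^'n\<close>.
\<close>

definition Jset :: "(real^'n) set" where
  "Jset = {x. \<forall>i. 1 \<le> x $ i}"

definition nvec :: "('n \<Rightarrow> nat) \<Rightarrow> real^'n" where
  "nvec m = (\<chi> i. real (m i))"

definition partial_deriv :: "'n \<Rightarrow> (real^'n \<Rightarrow> real) \<Rightarrow> real^'n \<Rightarrow> real" where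
  "partial_deriv i f x = deriv (\<lambda>h. f (x + h *\<^sub>R axis i 1)) 0"

text \<open>
  The linear order on 'n only serves to write down the iterated derivative as a composition
  in a definite order.
\<close>

definition multi_deriv ::
  "('n::{finite,linorder} \<Rightarrow> nat) \<Rightarrow> ((real, 'n) vec \<Rightarrow> real) \<Rightarrow> (real, 'n) vec \<Rightarrow> real" where
  "multi_deriv \<alpha> f = foldr (\<lambda>i. partial_deriv i ^^ \<alpha> i) (sorted_list_of_set UNIV) f"

definition HDF :: "((real, 'n::{finite,linorder}) vec \<Rightarrow> real) \<Rightarrow> bool" where
  "HDF P \<longleftrightarrow> (\<forall>x\<in>Jset. P x > 0) \<and>
     (\<exists>\<epsilon>>0. \<forall>\<alpha> n. \<alpha> n \<ge> 1 \<longrightarrow>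
        (\<exists>C>0. \<forall>x\<in>Jset. \<bar>multi_deriv \<alpha> P x / P x\<bar> \<le> C * (x $ n) powr (- \<epsilon>)))"

definition Delta :: "('n \<Rightarrow> nat) \<Rightarrow> (real^'n \<Rightarrow> real) \<Rightarrow> real^'n \<Rightarrow> real" where
  "Delta a f x = f (x + nvec a) - f x"

definition on_nat :: "(real^'n \<Rightarrow> real) \<Rightarrow> ('n \<Rightarrow> nat) \<Rightarrow> complex" where
  "on_nat f m = complex_of_real (f (nvec m))"

text \<open>
  Holomorphy in several variables: complex (Frechet) differentiability at every point.
\<close>

definition entire :: "(complex^'t \<Rightarrow> complex) \<Rightarrow> bool" where
  "entire F \<longleftrightarrow>
     (\<forall>s. \<exists>D. (F has_derivative D) (at s) \<and> (\<forall>c v. D (c *s v) = c * D v))"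

text \<open>
  Series in a subset I of the variables are indexed by functions on I, represented as
  elements of \<^term>\<open>I \<rightarrow>\<^sub>E {1..}\<close>; the case \<^term>\<open>I = UNIV\<close> gives the series in all
  N variables. Here Q and P are arbitrary functions of the multi-index.
\<close>

definition zeta_term ::
  "'n set \<Rightarrow> (('n \<Rightarrow> nat) \<Rightarrow> complex) \<Rightarrow> ('t \<Rightarrow> ('n \<Rightarrow> nat) \<Rightarrow> complex) \<Rightarrow>
   ('n \<Rightarrow> complex) \<Rightarrow> complex^'t \<Rightarrow> ('n \<Rightarrow> nat) \<Rightarrow> complex" where
  "zeta_term I Q P \<mu> s m = (\<Prod>i\<in>I. \<mu> i ^ m i) * Q m * (\<Prod>t\<in>UNIV. P t m powr (- (s $ t)))"

text \<open>
  The holomorphic continuation to the whole space of the series over the multi-indices in A.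
  For complex-valued series, \<^const>\<open>has_sum\<close> is absolute convergence.
\<close>

definition zeta_continuation ::
  "('n \<Rightarrow> nat) set \<Rightarrow> 'n set \<Rightarrow> (('n \<Rightarrow> nat) \<Rightarrow> complex) \<Rightarrow> ('t \<Rightarrow> ('n \<Rightarrow> nat) \<Rightarrow> complex) \<Rightarrow>
   ('n \<Rightarrow> complex) \<Rightarrow> complex^'t \<Rightarrow> complex" where
  "zeta_continuation A I Q P \<mu> =
     (THE F. entire F \<and>
        (\<exists>\<sigma>::real. \<forall>s. (\<forall>t. \<sigma> < Re (s $ t)) \<longrightarrow> (zeta_term I Q P \<mu> s has_sum F s) A))"

definition Zeta ::
  "'n set \<Rightarrow> (('n \<Rightarrow> nat) \<Rightarrow> complex) \<Rightarrow> ('t \<Rightarrow> ('n \<Rightarrow> nat) \<Rightarrow> complex) \<Rightarrow>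
   ('n \<Rightarrow> complex) \<Rightarrow> complex^'t \<Rightarrow> complex" where
  "Zeta I = zeta_continuation (I \<rightarrow>\<^sub>E {1..}) I"

definition Eset :: "('n \<Rightarrow> nat) \<Rightarrow> ('n \<Rightarrow> nat) set" where
  "Eset a = {m. (\<forall>n. 1 \<le> m n) \<and> (\<exists>n. m n \<le> a n)}"

definition Zeta_boundary ::
  "('n \<Rightarrow> nat) \<Rightarrow> (('n \<Rightarrow> nat) \<Rightarrow> complex) \<Rightarrow> ('t \<Rightarrow> ('n \<Rightarrow> nat) \<Rightarrow> complex) \<Rightarrow>
   ('n \<Rightarrow> complex) \<Rightarrow> complex^'t \<Rightarrow> complex" where
  "Zeta_boundary a = zeta_continuation (Eset a) UNIV"

text \<open>
  A point m of Eset a is determined by the proper (possibly empty) set I of the indices i with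
  m i > a i, by the values b i in {1..a i} of m off I, and by d i = m i - a i on I. Its
  weight is the product of the \<mu> i ^ (a i + d i) over I and the \<mu> i ^ b i off I.
\<close>

definition restr ::
  "('n \<Rightarrow> nat) \<Rightarrow> 'n set \<Rightarrow> ('n \<Rightarrow> nat) \<Rightarrow> (('n \<Rightarrow> nat) \<Rightarrow> complex) \<Rightarrow> ('n \<Rightarrow> nat) \<Rightarrow> complex" where
  "restr a I b f d = f (\<lambda>i. if i \<in> I then a i + d i else b i)"

definition neg_point :: "('t \<Rightarrow> nat) \<Rightarrow> complex^'t" where
  "neg_point k = (\<chi> t. - of_nat (k t))"

end

theory Submission
  imports Defs "HOL-Complex_Analysis.Conformal_Mappings"
begin

text \<open>
  For \<mu> \<noteq> 1 on the unit circle, K summations by parts rewrite the sum of \<mu>^d h(d) as boundary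
  terms plus a multiple of the sum of \<mu>^d (\<Delta>^K h)(d). If h extends to a holomorphic function of
  polynomial growth on a thickening of the half-line x \<ge> 1 whose width at x is of order
  x^\<epsilon>, Cauchy's inequality turns K differences into a gain x^(-\<epsilon>K), so the right-hand
  side converges for large K; its value does not depend on K and equals the sum when that sum
  converges. Iterated over the variables, this is a linear regularised summation. HDF and Taylor's
  formula show that P stays within P/2 of its real values on such a thickening, so the summand
  Q P^(-s) is holomorphic there; summing it gives an entire function of s, which is the
  continuation. At s = -k the summand is a polynomial, its regularised sum depends only on its
  values at lattice points, and the relation becomes the binomial expansion of
  P(m + a) = P(m) + \<Delta>P(m), after the lattice has been split into the part m > a and E(a).
\<close>

section \<open>Finite differences on a thickened half-line\<close>

text \<open>\<open>zeta_continuation\<close> is a definite description, so its value is accessible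
  only by exhibiting the continuation; the extension is therefore constructed. Two obstacles shape
  the construction. The exponent M bounding the summand grows with |s|, so no number K of summations
  by parts serves all s; stability in K makes a limit over K meaningful. And the sums are iterated,
  so the class of summands must survive summing out one variable: hence bounds that are products
  over the variables, and holomorphy required in each variable separately. The final relation joins
  two identities of different nature. The split of the lattice holds for all s: it is an identity of
  sums where the series converge and extends by uniqueness. The binomial expansion is special to s =
  -k, where the series need not converge; there it is an identity between polynomials at lattice
  points, to which a linear functional is applied. The expansion of the translated series contains
  the original value again, with the factor \<mu>^a in front; this produces 1 - \<mu>^a.\<close>

definition fwd_diff :: "(nat \<Rightarrow> complex) \<Rightarrow> nat \<Rightarrow> complex" where
  "fwd_diff h m = h (Suc m) - h m"

definition shift_diff :: "(complex \<Rightarrow> complex) \<Rightarrow> complex \<Rightarrow> complex" where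
  "shift_diff g w = g (w + 1) - g w"

lemma fwd_diff_funpow_Suc:
  "(fwd_diff ^^ Suc K) h m = (fwd_diff ^^ K) h (Suc m) - (fwd_diff ^^ K) h m"
  by (simp add: fwd_diff_def)

lemma shift_diff_funpow_Suc:
  "(shift_diff ^^ Suc K) g w = (shift_diff ^^ K) g (w + 1) - (shift_diff ^^ K) g w"
  by (simp add: shift_diff_def)

text \<open>Index d stands for the lattice point d + 1, since the series run over positive integers;
  there the differences of the sequence are those of the holomorphic function, to which Cauchy's
  inequality applies.\<close>

lemma fwd_diff_funpow_shift_diff:
  "(fwd_diff ^^ K) (\<lambda>d. g (of_nat (Suc d))) m = (shift_diff ^^ K) g (of_nat (Suc m))"
proof (induction K arbitrary: m)
  case (Suc K)
  show ?case unfolding fwd_diff_funpow_Suc shift_diff_funpow_Suc Suc.IH by (simp add: add_ac)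
qed auto

lemma fwd_diff_funpow_add:
  "(fwd_diff ^^ K) (\<lambda>d. f d + g d) m = (fwd_diff ^^ K) f m + (fwd_diff ^^ K) g m"
  by (induction K arbitrary: m) (simp_all add: fwd_diff_def)

lemma fwd_diff_funpow_scale: "(fwd_diff ^^ K) (\<lambda>d. c * f d) m = c * (fwd_diff ^^ K) f m"
  by (induction K arbitrary: m) (simp_all add: fwd_diff_def algebra_simps)

text \<open>Each difference at most doubles a supremum. This crude bound serves the boundary terms
  of \<open>reg_sum\<close> and the points near the origin, where the disc of holomorphy is too
  small for Cauchy's inequality to help.\<close>

lemma norm_fwd_diff_funpow_le:
  assumes "\<And>j. j \<le> K \<Longrightarrow> norm (h (m + j)) \<le> B"
  shows "norm ((fwd_diff ^^ K) h m) \<le> 2 ^ K * B"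
  using assms
proof (induction K arbitrary: m)
  case (Suc K)
  have "norm ((fwd_diff ^^ K) h (Suc m)) \<le> 2 ^ K * B"
    using Suc.prems by (intro Suc.IH) (metis add_Suc_shift Suc_le_mono)
  moreover have "norm ((fwd_diff ^^ K) h m) \<le> 2 ^ K * B"
    using Suc.prems by (intro Suc.IH) auto
  ultimately show ?case
    using norm_triangle_ineq4[of "(fwd_diff ^^ K) h (Suc m)" "(fwd_diff ^^ K) h m"]
    unfolding fwd_diff_funpow_Suc by simp
qed auto

lemma holomorphic_on_fwd_diff_funpow:
  assumes "\<And>d. (\<lambda>z. h z d) holomorphic_on S"
  shows "(\<lambda>z. (fwd_diff ^^ K) (h z) m) holomorphic_on S"
  using assms
  by (induction K arbitrary: m) (auto simp: fwd_diff_def intro!: holomorphic_intros)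

text \<open>
  By Cauchy's inequality each difference gains a factor 1/\<rho> and costs 2\<rho> of the radius.
\<close>

lemma shift_diff_funpow_bound:
  assumes g: "g holomorphic_on ball z R" and B: "\<And>w. w \<in> ball z R \<Longrightarrow> norm (g w) \<le> B"
    and \<rho>: "(\<rho>::real) \<ge> 1"
  shows "(shift_diff ^^ K) g holomorphic_on ball z (R - 2 * \<rho> * K) \<and>
    (\<forall>w \<in> ball z (R - 2 * \<rho> * K). norm ((shift_diff ^^ K) g w) \<le> B / \<rho> ^ K)"
proof (induction K)
  case (Suc K)
  define G where "G = (shift_diff ^^ K) g"
  define R' where "R' = R - 2 * \<rho> * K"
  have G: "G holomorphic_on ball z R'" "\<And>w. w \<in> ball z R' \<Longrightarrow> norm (G w) \<le> B / \<rho> ^ K"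
    using Suc unfolding G_def R'_def by auto
  have D: "norm (deriv G w) \<le> B / \<rho> ^ K / \<rho>" if "w \<in> ball z (R' - \<rho>)" for w
  proof -
    have sub: "cball w \<rho> \<subseteq> ball z R'"
    proof
      fix u assume "u \<in> cball w \<rho>"
      then show "u \<in> ball z R'" using that dist_triangle[of z u w] by (auto simp: dist_commute)
    qed
    have "norm ((deriv ^^ 1) G w) \<le> fact 1 * (B / \<rho> ^ K) / \<rho> ^ 1"
    proof (rule Cauchy_inequality)
      show "G holomorphic_on ball w \<rho>" using G(1) sub ball_subset_cball holomorphic_on_subset by blast
      show "continuous_on (cball w \<rho>) G"
        using G(1) sub holomorphic_on_imp_continuous_on holomorphic_on_subset by blast
      fix x assume "norm (w - x) = \<rho>"
      then show "norm (G x) \<le> B / \<rho> ^ K" using sub by (intro G(2)) (auto simp: dist_norm)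
    qed (use \<rho> in auto)
    then show ?thesis by simp
  qed
  have R'': "R - 2 * \<rho> * Suc K = R' - 2 * \<rho>" by (simp add: R'_def algebra_simps)
  \<comment> \<open>One \<rho> of the lost radius pays for Cauchy's bound of the derivative, the
    other, being at least 1, for the segment from w to w + 1.\<close>
  have in1: "w + 1 \<in> ball z (R' - \<rho>)" "w \<in> ball z (R' - \<rho>)" if "w \<in> ball z (R' - 2 * \<rho>)" for w
    using that \<rho> dist_triangle[of z "w + 1" w] by (auto simp: dist_norm)
  have sub': "ball z (R' - \<rho>) \<subseteq> ball z R'" using \<rho> by auto
  have "norm (shift_diff G w) \<le> B / \<rho> ^ Suc K" if w: "w \<in> ball z (R' - 2 * \<rho>)" for w
  proof -
    have "norm (G (w + 1) - G w) \<le> B / \<rho> ^ K / \<rho> * norm ((w + 1) - w)"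
    proof (rule field_differentiable_bound[of "ball z (R' - \<rho>)" G "deriv G"])
      fix u assume u: "u \<in> ball z (R' - \<rho>)"
      then have "u \<in> ball z R'" using sub' by blast
      then have "(G has_field_derivative deriv G u) (at u)"
        using G(1) holomorphic_derivI open_ball by blast
      then show "(G has_field_derivative deriv G u) (at u within ball z (R' - \<rho>))"
        by (rule has_field_derivative_at_within)
    qed (use D in1[OF w] in auto)
    then show ?thesis by (simp add: shift_diff_def field_simps)
  qed
  moreover have "shift_diff G holomorphic_on ball z (R' - 2 * \<rho>)"
  proof -
    have "G \<circ> (\<lambda>w. w + 1) holomorphic_on ball z (R' - 2 * \<rho>)"
    proof (rule holomorphic_on_compose_gen[OF _ G(1)])
      show "(\<lambda>w. w + 1) ` ball z (R' - 2 * \<rho>) \<subseteq> ball z R'" using in1 sub' by blast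
    qed (intro holomorphic_intros)
    moreover have "G holomorphic_on ball z (R' - 2 * \<rho>)"
      using G(1) by (rule holomorphic_on_subset) (use \<rho> in auto)
    ultimately show ?thesis unfolding shift_diff_def o_def by (rule holomorphic_on_diff)
  qed
  ultimately show ?case unfolding R'' funpow.simps comp_def G_def[symmetric] by blast
qed (use g B in auto)

text \<open>
  The width of the neighbourhood at x is the scale on which, by HDF, a polynomial stays close to
  its value at x.
\<close>

definition reg_domain :: "real \<Rightarrow> real \<Rightarrow> complex set" where
  "reg_domain \<eta> \<epsilon> = (\<Union>x\<in>{1..}. ball (of_real x) (\<eta> * x powr \<epsilon>))"

lemma open_reg_domain: "open (reg_domain \<eta> \<epsilon>)"
  by (auto simp: reg_domain_def)

lemma of_nat_in_reg_domain: "\<eta> > 0 \<Longrightarrow> of_nat (Suc d) \<in> reg_domain \<eta> \<epsilon>"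
  unfolding reg_domain_def by (rule UN_I[of "real (Suc d)"]) (auto simp: powr_gt_zero)

lemma powr_le_of_comparable:
  fixes M :: real
  assumes "0 < x" "x / 3 \<le> y" "y \<le> 3 * x"
  shows "y powr M \<le> 3 powr \<bar>M\<bar> * x powr M"
proof (cases "M \<ge> 0")
  case True
  then have "y powr M \<le> (3 * x) powr M" using assms by (intro powr_mono2) auto
  then show ?thesis using assms True by (simp add: powr_mult)
next
  case False
  then have "y powr M \<le> (x / 3) powr M" using assms by (intro powr_mono2') auto
  then show ?thesis using assms False by (simp add: powr_divide powr_minus_divide field_simps powr_minus)
qed

text \<open>The disc of radius \<eta> n^\<epsilon> about n lies in the domain and g is of size n^M
  on it; K differences gain n^(-\<epsilon> K), and the hypothesis on K leaves n^(-2). C is chosen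
  before g and B, which makes the estimate uniform in any parameters of g.\<close>

lemma reg_domain_diff_bound:
  assumes \<eta>: "0 < \<eta>" "\<eta> \<le> 1/2" and \<epsilon>: "0 < \<epsilon>" "\<epsilon> \<le> 1"
    and K: "M - \<epsilon> * K \<le> -2"
  shows "\<exists>C. \<forall>g B m. g holomorphic_on reg_domain \<eta> \<epsilon> \<longrightarrow>
      (\<forall>w\<in>reg_domain \<eta> \<epsilon>. norm (g w) \<le> B * (1 + norm w) powr M) \<longrightarrow>
      norm ((fwd_diff ^^ K) (\<lambda>d. g (of_nat (Suc d))) m) \<le> C * B / (real (Suc m))\<^sup>2"
proof -
  \<comment> \<open>Beyond m0 one has \<eta> n^\<epsilon> \<ge> 2K + 1, so the Cauchy radius \<rho>
    chosen below is at least 1.\<close>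
  define m0 where "m0 = ((2 * real K + 1) / \<eta>) powr (1 / \<epsilon>) + 2"
  define C1 where "C1 = 2 ^ K * (2 + m0 + K) powr \<bar>M\<bar> * m0\<^sup>2"
  define C2 where "C2 = 3 powr \<bar>M\<bar> * ((2 * real K + 1) / \<eta>) ^ K"
  have C: "C1 \<ge> 0" "C2 \<ge> 0" using \<eta> by (auto simp: C1_def C2_def)
  show ?thesis
  proof (intro exI[of _ "C1 + C2"] allI impI)
    fix g B and m :: nat
    assume g: "g holomorphic_on reg_domain \<eta> \<epsilon>"
      and B: "\<forall>w\<in>reg_domain \<eta> \<epsilon>. norm (g w) \<le> B * (1 + norm w) powr M"
    define n where "n = real (Suc m)"
    have n: "n \<ge> 1" by (simp add: n_def)
    \<comment> \<open>The bound at the point 1 of the domain yields the sign of B.\<close>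
    have "0 \<le> B * (1 + norm (of_nat (Suc 0) :: complex)) powr M"
      using B of_nat_in_reg_domain[OF \<eta>(1)] norm_ge_zero order_trans by blast
    then have B0: "B \<ge> 0" by (simp add: zero_le_mult_iff)
    have "norm ((fwd_diff ^^ K) (\<lambda>d. g (of_nat (Suc d))) m) * n\<^sup>2 \<le> (C1 + C2) * B"
    proof (cases "n \<le> m0")
      case True
      have "norm ((fwd_diff ^^ K) (\<lambda>d. g (of_nat (Suc d))) m) \<le> 2 ^ K * (B * (2 + m0 + K) powr \<bar>M\<bar>)"
      proof (rule norm_fwd_diff_funpow_le)
        fix j assume j: "j \<le> K"
        have "norm (g (of_nat (Suc (m + j)))) \<le> B * (1 + norm (of_nat (Suc (m + j)) :: complex)) powr M"
          using B of_nat_in_reg_domain[OF \<eta>(1)] by blast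
        also have "\<dots> = B * (2 + real (m + j)) powr M" by (simp only: norm_of_nat) simp
        also have "\<dots> \<le> B * (2 + m0 + K) powr \<bar>M\<bar>"
        proof (intro mult_left_mono B0)
          have "(2 + real (m + j)) powr M \<le> (2 + real (m + j)) powr \<bar>M\<bar>"
            by (intro powr_mono) auto
          also have "\<dots> \<le> (2 + m0 + K) powr \<bar>M\<bar>"
            using True j by (intro powr_mono2) (auto simp: n_def)
          finally show "(2 + real (m + j)) powr M \<le> (2 + m0 + K) powr \<bar>M\<bar>" .
        qed
        finally show "norm (g (of_nat (Suc (m + j)))) \<le> B * (2 + m0 + K) powr \<bar>M\<bar>" .
      qed
      then have "norm ((fwd_diff ^^ K) (\<lambda>d. g (of_nat (Suc d))) m) * n\<^sup>2 \<le>
          2 ^ K * (B * (2 + m0 + K) powr \<bar>M\<bar>) * m0\<^sup>2"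
        using True n B0 by (intro mult_mono power_mono) auto
      also have "\<dots> = C1 * B" by (simp add: C1_def)
      also have "\<dots> \<le> (C1 + C2) * B" using C B0 by (intro mult_right_mono) auto
      finally show ?thesis .
    next
      case False
      \<comment> \<open>After K differences a radius R - 2 \<rho> K = \<rho> remains, so the centre
        is still in the disc where the bound holds.\<close>
      define \<rho> where "\<rho> = \<eta> * n powr \<epsilon> / (2 * K + 1)"
      have "(2 * real K + 1) / \<eta> = (((2 * real K + 1) / \<eta>) powr (1 / \<epsilon>)) powr \<epsilon>"
        using \<eta> \<epsilon> by (simp add: powr_powr)
      also have "\<dots> \<le> n powr \<epsilon>" using False \<epsilon> by (intro powr_mono2) (auto simp: m0_def)
      finally have \<rho>1: "\<rho> \<ge> 1" using \<eta> by (simp add: \<rho>_def field_simps)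
      define R where "R = \<eta> * n powr \<epsilon>"
      have R: "R = \<rho> * (2 * K + 1)" by (simp add: R_def \<rho>_def)
      have n\<epsilon>: "n powr \<epsilon> \<le> n" using n \<epsilon> powr_mono[of \<epsilon> 1 n] by simp
      have "\<eta> * n powr \<epsilon> \<le> 1/2 * n" using \<eta> n\<epsilon> n by (intro mult_mono) auto
      then have Rn: "R \<le> n / 2" by (simp add: R_def)
      have sub: "ball (of_nat (Suc m)) R \<subseteq> reg_domain \<eta> \<epsilon>"
        using UN_upper[of "real (Suc m)" "{1..}" "\<lambda>x. ball (complex_of_real x) (\<eta> * x powr \<epsilon>)"]
        unfolding reg_domain_def R_def n_def of_real_of_nat_eq by simp
      have bd: "norm (g w) \<le> B * (3 powr \<bar>M\<bar> * n powr M)" if "w \<in> ball (of_nat (Suc m)) R" for w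
      proof -
        have "norm (g w) \<le> B * (1 + norm w) powr M" using B sub that by blast
        also have "\<dots> \<le> B * (3 powr \<bar>M\<bar> * n powr M)"
        proof (intro mult_left_mono B0 powr_le_of_comparable)
          have nn: "norm (of_nat (Suc m) :: complex) = n" unfolding norm_of_nat n_def ..
          have d: "norm (of_nat (Suc m) - w) < R" using that by (simp only: mem_ball dist_norm)
          have "n \<le> norm w + R" using d nn norm_triangle_ineq2[of "of_nat (Suc m)" w] by linarith
          then show "n / 3 \<le> 1 + norm w" using Rn n by linarith
          have "norm w \<le> n + R"
            using d nn norm_triangle_ineq2[of w "of_nat (Suc m)"] by (simp only: norm_minus_commute)
          then show "1 + norm w \<le> 3 * n" using Rn n by linarith
        qed (use n in auto)
        finally show ?thesis .
      qed
      have "norm ((fwd_diff ^^ K) (\<lambda>d. g (of_nat (Suc d))) m) \<le> B * (3 powr \<bar>M\<bar> * n powr M) / \<rho> ^ K"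
        unfolding fwd_diff_funpow_shift_diff
        using shift_diff_funpow_bound[OF holomorphic_on_subset[OF g sub] bd \<rho>1, of K] \<rho>1
        by (auto simp: R algebra_simps)
      then have "norm ((fwd_diff ^^ K) (\<lambda>d. g (of_nat (Suc d))) m) * n\<^sup>2 \<le>
          B * (3 powr \<bar>M\<bar> * n powr M) / \<rho> ^ K * n\<^sup>2" by (intro mult_right_mono) auto
      also have "\<dots> = B * C2 * (n powr M * n\<^sup>2 / (n powr \<epsilon>) ^ K)"
      proof -
        have "inverse (\<rho> ^ K) = ((2 * real K + 1) / \<eta>) ^ K / (n powr \<epsilon>) ^ K"
          by (simp add: \<rho>_def power_divide power_mult_distrib add.commute)
        then show ?thesis by (simp only: C2_def divide_inverse mult_ac)
      qed
      also have "n powr M * n\<^sup>2 / (n powr \<epsilon>) ^ K = n powr (M + 2 - \<epsilon> * K)"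
      proof -
        have "(n powr \<epsilon>) ^ K = n powr (\<epsilon> * K)"
          using powr_realpow[of "n powr \<epsilon>" K] n by (simp add: powr_powr)
        moreover have "n\<^sup>2 = n powr 2" using n by simp
        ultimately show ?thesis using n by (simp only: powr_add powr_diff)
      qed
      also have "\<dots> \<le> n powr 0" using K n by (intro powr_mono) auto
      also have "n powr 0 = 1" using n by simp
      finally have "norm ((fwd_diff ^^ K) (\<lambda>d. g (of_nat (Suc d))) m) * n\<^sup>2 \<le> B * C2"
        using B0 C by (simp add: mult_left_mono)
      also have "\<dots> \<le> (C1 + C2) * B" using C B0 by (simp add: algebra_simps)
      finally show ?thesis .
    qed
    then show "norm ((fwd_diff ^^ K) (\<lambda>d. g (of_nat (Suc d))) m) \<le> (C1 + C2) * B / (real (Suc m))\<^sup>2"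
      using n by (simp add: n_def field_simps)
  qed
qed

text \<open>
  The outcome of K summations by parts applied to the series of the terms \<mu>^d h(d).
\<close>

definition reg_sum :: "complex \<Rightarrow> nat \<Rightarrow> (nat \<Rightarrow> complex) \<Rightarrow> complex" where
  "reg_sum \<mu> K h = (\<Sum>j<K. \<mu> ^ j / (1 - \<mu>) ^ Suc j * (fwd_diff ^^ j) h 0) +
     (\<mu> / (1 - \<mu>)) ^ K * (\<Sum>d. \<mu> ^ d * (fwd_diff ^^ K) h d)"

lemma summable_twist:
  assumes "norm \<mu> = 1" "summable (\<lambda>d. norm (h d))"
  shows "summable (\<lambda>d. \<mu> ^ d * h d :: complex)"
  using assms by (intro summable_norm_cancel[of "\<lambda>d. \<mu> ^ d * h d"]) (simp add: norm_mult norm_power)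

lemma summation_by_parts:
  assumes \<mu>: "norm \<mu> = 1" and h: "summable (\<lambda>d. norm (h d))"
  shows "(1 - \<mu>) * (\<Sum>d. \<mu> ^ d * h d) = h 0 + \<mu> * (\<Sum>d. \<mu> ^ d * fwd_diff h d)"
proof -
  have s: "summable (\<lambda>d. \<mu> ^ d * h d)" using \<mu> h by (rule summable_twist)
  have s': "summable (\<lambda>d. \<mu> ^ d * h (Suc d))"
    using \<mu> h by (intro summable_twist) (auto simp: summable_Suc_iff[of "\<lambda>d. norm (h d)"])
  have "(\<Sum>d. \<mu> ^ d * fwd_diff h d) = (\<Sum>d. \<mu> ^ d * h (Suc d)) - (\<Sum>d. \<mu> ^ d * h d)"
    unfolding fwd_diff_def right_diff_distrib using s s' by (rule suminf_diff[symmetric, rotated])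
  moreover have "(\<Sum>d. \<mu> ^ d * h d) = h 0 + \<mu> * (\<Sum>d. \<mu> ^ d * h (Suc d))"
    using suminf_split_head[OF s] suminf_mult[OF s', of \<mu>] by (simp add: mult_ac)
  ultimately show ?thesis by (simp only: left_diff_distrib right_diff_distrib) simp
qed

lemma reg_sum_Suc:
  assumes \<mu>: "norm \<mu> = 1" "\<mu> \<noteq> 1" and h: "summable (\<lambda>d. norm ((fwd_diff ^^ K) h d))"
  shows "reg_sum \<mu> (Suc K) h = reg_sum \<mu> K h"
proof -
  have "(\<Sum>d. \<mu> ^ d * (fwd_diff ^^ K) h d) =
      ((fwd_diff ^^ K) h 0 + \<mu> * (\<Sum>d. \<mu> ^ d * (fwd_diff ^^ Suc K) h d)) / (1 - \<mu>)"
    using summation_by_parts[OF \<mu>(1) h] \<mu>(2) by (simp add: field_simps)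
  then show ?thesis unfolding reg_sum_def
    by (simp add: power_divide add_divide_distrib distrib_left mult_ac)
qed

section \<open>Iterated regularised summation\<close>

lemma summable_inverse_squares_Suc: "summable (\<lambda>d. C / (real (Suc d))\<^sup>2)"
proof -
  have "summable (\<lambda>d. 1 / (real (Suc d))\<^sup>2)"
    using inverse_power_summable[of 2, where 'a = real]
    by (subst summable_Suc_iff) (simp add: field_simps)
  from summable_mult[OF this, of C] show ?thesis by simp
qed

lemma fwd_diff_funpow_sum:
  "(fwd_diff ^^ K) (\<lambda>d. \<Sum>j\<in>J. c j * h j d) m = (\<Sum>j\<in>J. c j * (fwd_diff ^^ K) (h j) m)"
proof (induction J rule: infinite_finite_induct)
  case (insert x F)
  then show ?case by (simp add: fwd_diff_funpow_add fwd_diff_funpow_scale)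
qed (use fwd_diff_funpow_scale[of K 0 "\<lambda>_. 0" m] in simp_all)

lemma reg_sum_lincomb:
  assumes \<mu>: "norm \<mu> = 1"
    and h: "\<And>j. j \<in> J \<Longrightarrow> summable (\<lambda>d. norm ((fwd_diff ^^ K) (h j) d))"
  shows "reg_sum \<mu> K (\<lambda>d. \<Sum>j\<in>J. c j * h j d) = (\<Sum>j\<in>J. c j * reg_sum \<mu> K (h j))"
proof -
  have s: "summable (\<lambda>d. \<mu> ^ d * (fwd_diff ^^ K) (h j) d)" if "j \<in> J" for j
    using summable_twist[OF \<mu> h[OF that]] .
  have "(\<Sum>d. \<mu> ^ d * (\<Sum>j\<in>J. c j * (fwd_diff ^^ K) (h j) d)) =
      (\<Sum>d. \<Sum>j\<in>J. c j * (\<mu> ^ d * (fwd_diff ^^ K) (h j) d))"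
    by (simp add: sum_distrib_left mult_ac)
  also have "\<dots> = (\<Sum>j\<in>J. \<Sum>d. c j * (\<mu> ^ d * (fwd_diff ^^ K) (h j) d))"
    using s by (intro suminf_sum summable_mult)
  also have "\<dots> = (\<Sum>j\<in>J. c j * (\<Sum>d. \<mu> ^ d * (fwd_diff ^^ K) (h j) d))"
    using s by (intro sum.cong suminf_mult) auto
  finally have 1: "(\<Sum>d. \<mu> ^ d * (\<Sum>j\<in>J. c j * (fwd_diff ^^ K) (h j) d)) =
      (\<Sum>j\<in>J. c j * (\<Sum>d. \<mu> ^ d * (fwd_diff ^^ K) (h j) d))" .
  have 2: "(\<Sum>k<K. \<mu> ^ k / (1 - \<mu>) ^ Suc k * (\<Sum>j\<in>J. c j * (fwd_diff ^^ k) (h j) 0)) =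
      (\<Sum>j\<in>J. c j * (\<Sum>k<K. \<mu> ^ k / (1 - \<mu>) ^ Suc k * (fwd_diff ^^ k) (h j) 0))"
    unfolding sum_distrib_left by (subst sum.swap) (simp add: mult_ac)
  show ?thesis
    unfolding reg_sum_def fwd_diff_funpow_sum 1 2
    by (simp add: distrib_left sum.distrib sum_distrib_left mult_ac)
qed

lemma norm_reg_sum_le:
  assumes \<mu>: "norm \<mu> = 1"
    and c: "\<And>j. j < K \<Longrightarrow> norm (h j) \<le> c"
    and b: "\<And>d. norm ((fwd_diff ^^ K) h d) \<le> b / (real (Suc d))\<^sup>2"
  shows "norm (reg_sum \<mu> K h) \<le>
    (\<Sum>j<K. 2 ^ j * c / norm (1 - \<mu>) ^ Suc j) + (\<Sum>d. b / (real (Suc d))\<^sup>2) / norm (1 - \<mu>) ^ K"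
proof -
  have "norm (\<Sum>j<K. \<mu> ^ j / (1 - \<mu>) ^ Suc j * (fwd_diff ^^ j) h 0) \<le>
      (\<Sum>j<K. 2 ^ j * c / norm (1 - \<mu>) ^ Suc j)"
  proof (rule sum_norm_le)
    fix j assume j: "j \<in> {..<K}"
    have "norm ((fwd_diff ^^ j) h 0) \<le> 2 ^ j * c"
      using j by (intro norm_fwd_diff_funpow_le) (auto intro: c)
    then show "norm (\<mu> ^ j / (1 - \<mu>) ^ Suc j * (fwd_diff ^^ j) h 0) \<le> 2 ^ j * c / norm (1 - \<mu>) ^ Suc j"
      unfolding norm_mult norm_divide norm_power \<mu> by (simp add: divide_right_mono)
  qed
  moreover have "norm (\<Sum>d. \<mu> ^ d * (fwd_diff ^^ K) h d) \<le> (\<Sum>d. b / (real (Suc d))\<^sup>2)"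
    using \<mu> b by (intro norm_suminf_le summable_inverse_squares_Suc) (simp add: norm_mult norm_power)
  then have "norm ((\<mu> / (1 - \<mu>)) ^ K * (\<Sum>d. \<mu> ^ d * (fwd_diff ^^ K) h d)) \<le>
      (\<Sum>d. b / (real (Suc d))\<^sup>2) / norm (1 - \<mu>) ^ K"
    unfolding norm_mult norm_divide norm_power \<mu> by (simp add: power_divide divide_right_mono)
  ultimately show ?thesis unfolding reg_sum_def by (intro norm_triangle_mono)
qed

text \<open>Locally uniform convergence by the Weierstrass test. The bound may vary with z; by
  continuity it attains its maximum on each closed disc, which supplies the majorant.\<close>

lemma holomorphic_on_reg_sum:
  assumes S: "open S" and \<mu>: "norm \<mu> = 1"
    and h: "\<And>d. (\<lambda>z. h z d) holomorphic_on S"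
    and b: "\<And>z d. z \<in> S \<Longrightarrow> norm ((fwd_diff ^^ K) (h z) d) \<le> b z / (real (Suc d))\<^sup>2"
    and b_cont: "continuous_on S b"
  shows "(\<lambda>z. reg_sum \<mu> K (h z)) holomorphic_on S"
proof -
  have "(\<lambda>z. \<Sum>d. \<mu> ^ d * (fwd_diff ^^ K) (h z) d) holomorphic_on S"
  proof (rule holomorphic_uniform_sequence[OF S])
    show "(\<lambda>z. \<Sum>d<n. \<mu> ^ d * (fwd_diff ^^ K) (h z) d) holomorphic_on S" for n
      using h by (intro holomorphic_intros holomorphic_on_fwd_diff_funpow)
    fix x assume "x \<in> S"
    then obtain r where r: "r > 0" "cball x r \<subseteq> S" using S open_contains_cball by blast
    have "continuous_on (cball x r) b" using b_cont r(2) by (rule continuous_on_subset)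
    moreover have "compact (cball x r)" "cball x r \<noteq> {}" using r by auto
    ultimately obtain z0 where "\<forall>z\<in>cball x r. b z \<le> b z0"
      using continuous_attains_sup[of "cball x r" b] by auto
    then have C: "b z \<le> b z0" if "z \<in> cball x r" for z using that by blast
    have "uniform_limit (cball x r) (\<lambda>n z. \<Sum>d<n. \<mu> ^ d * (fwd_diff ^^ K) (h z) d)
        (\<lambda>z. \<Sum>d. \<mu> ^ d * (fwd_diff ^^ K) (h z) d) sequentially"
    proof (rule Weierstrass_m_test[OF _ summable_inverse_squares_Suc[of "b z0"]])
      fix n z assume z: "z \<in> cball x r"
      have "norm ((fwd_diff ^^ K) (h z) n) \<le> b z / (real (Suc n))\<^sup>2" using b z r by blast
      also have "\<dots> \<le> b z0 / (real (Suc n))\<^sup>2" using C[OF z] by (intro divide_right_mono) auto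
      finally show "norm (\<mu> ^ n * (fwd_diff ^^ K) (h z) n) \<le> b z0 / (real (Suc n))\<^sup>2"
        using \<mu> by (simp add: norm_mult norm_power)
    qed
    then show "\<exists>d>0. cball x d \<subseteq> S \<and> uniform_limit (cball x d)
        (\<lambda>n z. \<Sum>d<n. \<mu> ^ d * (fwd_diff ^^ K) (h z) d)
        (\<lambda>z. \<Sum>d. \<mu> ^ d * (fwd_diff ^^ K) (h z) d) sequentially" using r by blast
  qed
  then show ?thesis
    unfolding reg_sum_def using h by (intro holomorphic_intros holomorphic_on_fwd_diff_funpow)
qed

text \<open>One admissible constant is fixed for each \<eta>, \<epsilon>, M, K, depending on neither
  the function nor its bound, so that the constants of iterated sums can be written
  explicitly.\<close>

definition diff_const :: "real \<Rightarrow> real \<Rightarrow> real \<Rightarrow> nat \<Rightarrow> real" where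
  "diff_const \<eta> \<epsilon> M K = (SOME C. \<forall>g B m. g holomorphic_on reg_domain \<eta> \<epsilon> \<longrightarrow>
      (\<forall>w\<in>reg_domain \<eta> \<epsilon>. norm (g w) \<le> B * (1 + norm w) powr M) \<longrightarrow>
      norm ((fwd_diff ^^ K) (\<lambda>d. g (of_nat (Suc d))) m) \<le> C * B / (real (Suc m))\<^sup>2)"

text \<open>The factor by which regularised summation in one variable may increase the constant of a
  symbol: the boundary terms, estimated on the points 1, ..., K, plus the remaining series.\<close>

definition reg_const :: "real \<Rightarrow> real \<Rightarrow> real \<Rightarrow> nat \<Rightarrow> complex \<Rightarrow> real" where
  "reg_const \<eta> \<epsilon> M K \<mu> = (\<Sum>j<K. 2 ^ j * (2 + real K) powr \<bar>M\<bar> / norm (1 - \<mu>) ^ Suc j) +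
      diff_const \<eta> \<epsilon> M K * (\<Sum>d. 1 / (real (Suc d))\<^sup>2) / norm (1 - \<mu>) ^ K"

text \<open>
  The variables are indexed by one type, so that the summation variables and the parameters s
  are treated alike; only the variables in A carry a weight.
\<close>

definition symbol_class ::
  "('i \<Rightarrow> complex set) \<Rightarrow> 'i set \<Rightarrow> real \<Rightarrow> real \<Rightarrow> (('i \<Rightarrow> complex) \<Rightarrow> complex) \<Rightarrow> bool" where
  "symbol_class D A M B f \<longleftrightarrow> (\<forall>p. (\<forall>k. p k \<in> D k) \<longrightarrow>
     norm (f p) \<le> B * (\<Prod>i\<in>A. (1 + norm (p i)) powr M) \<and>
     (\<forall>k. (\<lambda>z. f (p(k := z))) holomorphic_on D k))"

lemma symbol_classD:
  assumes "symbol_class D A M B f" "\<And>k. p k \<in> D k"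
  shows "norm (f p) \<le> B * (\<Prod>i\<in>A. (1 + norm (p i)) powr M)"
    and "(\<lambda>z. f (p(k := z))) holomorphic_on D k"
  using assms by (auto simp: symbol_class_def)

lemma symbol_class_coordinate_bound:
  assumes f: "symbol_class D A M B f" and A: "finite A" "i \<in> A" and p: "\<And>k. p k \<in> D k"
    and z: "z \<in> D i"
  shows "norm (f (p(i := z))) \<le> B * (\<Prod>j\<in>A - {i}. (1 + norm (p j)) powr M) * (1 + norm z) powr M"
proof -
  have "norm (f (p(i := z))) \<le> B * (\<Prod>j\<in>A. (1 + norm ((p(i := z)) j)) powr M)"
    using p z by (intro symbol_classD(1)[OF f]) auto
  also have "(\<Prod>j\<in>A. (1 + norm ((p(i := z)) j)) powr M) =
      (1 + norm z) powr M * (\<Prod>j\<in>A - {i}. (1 + norm ((p(i := z)) j)) powr M)"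
    by (simp only: prod.remove[OF A] fun_upd_same)
  also have "(\<Prod>j\<in>A - {i}. (1 + norm ((p(i := z)) j)) powr M) =
      (\<Prod>j\<in>A - {i}. (1 + norm (p j)) powr M)"
    by (intro prod.cong) auto
  finally show ?thesis by (simp only: mult_ac)
qed

section \<open>Regularised summation in one variable acting on symbol classes\<close>

context
  fixes \<eta> \<epsilon> M :: real and K :: nat
  assumes \<eta>: "0 < \<eta>" "\<eta> \<le> 1/2" and \<epsilon>: "0 < \<epsilon>" "\<epsilon> \<le> 1" and K: "M - \<epsilon> * K \<le> -2"
begin

lemma diff_const_bound:
  assumes g: "g holomorphic_on reg_domain \<eta> \<epsilon>"
    and b: "\<And>w. w \<in> reg_domain \<eta> \<epsilon> \<Longrightarrow> norm (g w) \<le> B * (1 + norm w) powr M"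
  shows "norm ((fwd_diff ^^ K) (\<lambda>d. g (of_nat (Suc d))) m) \<le> diff_const \<eta> \<epsilon> M K * B / (real (Suc m))\<^sup>2"
proof -
  note * = someI_ex[OF reg_domain_diff_bound[OF \<eta> \<epsilon> K], folded diff_const_def]
  have "\<forall>w\<in>reg_domain \<eta> \<epsilon>. norm (g w) \<le> B * (1 + norm w) powr M"
    by (rule ballI) (rule b)
  then show ?thesis
    by (rule *[THEN spec[of _ g], THEN spec[of _ B], THEN spec[of _ m], THEN mp, OF g, THEN mp])
qed

lemma symbol_class_diff_bound:
  assumes f: "symbol_class D A M B f" and A: "finite A" "i \<in> A" and D: "D i = reg_domain \<eta> \<epsilon>"
    and p: "\<And>k. p k \<in> D k"
  shows "norm ((fwd_diff ^^ K) (\<lambda>d. f (p(i := of_nat (Suc d)))) d) \<le>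
    diff_const \<eta> \<epsilon> M K * (B * (\<Prod>j\<in>A - {i}. (1 + norm (p j)) powr M)) / (real (Suc d))\<^sup>2"
proof (rule diff_const_bound[where g = "\<lambda>z. f (p(i := z))"])
  show "(\<lambda>z. f (p(i := z))) holomorphic_on reg_domain \<eta> \<epsilon>"
    using symbol_classD(2)[OF f p, of i] unfolding D .
  show "norm (f (p(i := z))) \<le> B * (\<Prod>j\<in>A - {i}. (1 + norm (p j)) powr M) * (1 + norm z) powr M"
    if "z \<in> reg_domain \<eta> \<epsilon>" for z
    using symbol_class_coordinate_bound[OF f A p, of z] that unfolding D .
qed

lemma symbol_class_summable:
  assumes "symbol_class D A M B f" "finite A" "i \<in> A" "D i = reg_domain \<eta> \<epsilon>" "\<And>k. p k \<in> D k"
  shows "summable (\<lambda>d. norm ((fwd_diff ^^ K) (\<lambda>d. f (p(i := of_nat (Suc d)))) d))"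
proof -
  define c where "c = diff_const \<eta> \<epsilon> M K * (B * (\<Prod>j\<in>A - {i}. (1 + norm (p j)) powr M))"
  have "norm (norm ((fwd_diff ^^ K) (\<lambda>d. f (p(i := of_nat (Suc d)))) d)) \<le> c / (real (Suc d))\<^sup>2" for d
    unfolding real_norm_def abs_norm_cancel c_def by (rule symbol_class_diff_bound[OF assms])
  then show ?thesis
    by (rule summable_comparison_test'[OF summable_inverse_squares_Suc[of c], of 0])
qed

text \<open>Because the bound is a product over the variables, the one-variable estimates apply with
  B times the other factors as constant, and exactly the factor of the summed variable disappears.
  The \<mu> in front is there because the point d + 1 carries the weight \<mu>^(d + 1).\<close>

lemma symbol_class_reg_sum:
  assumes \<mu>: "norm \<mu> = 1"
    and f: "symbol_class D A M B f" and A: "finite A" "i \<in> A" and D: "D i = reg_domain \<eta> \<epsilon>"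
    and opn: "\<And>k. open (D k)"
  shows "symbol_class D (A - {i}) M (reg_const \<eta> \<epsilon> M K \<mu> * B)
    (\<lambda>p. \<mu> * reg_sum \<mu> K (\<lambda>d. f (p(i := of_nat (Suc d)))))"
proof -
    have nat_D: "of_nat (Suc d) \<in> D i" for d using of_nat_in_reg_domain[OF \<eta>(1)] D by blast
    show "symbol_class D (A - {i}) M (reg_const \<eta> \<epsilon> M K \<mu> * B) (\<lambda>p. \<mu> * reg_sum \<mu> K (\<lambda>d. f (p(i := of_nat (Suc d)))))"
      unfolding symbol_class_def
    proof (intro allI impI conjI)
      fix p assume p: "\<forall>k. p k \<in> D k"
      define W where "W = (\<Prod>j\<in>A - {i}. (1 + norm (p j)) powr M)"
      have W: "W \<ge> 0" unfolding W_def by (intro prod_nonneg) auto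
      have B0: "B * W \<ge> 0"
      proof -
        have "0 \<le> B * W * (1 + norm (p i)) powr M"
          using order_trans[OF norm_ge_zero symbol_class_coordinate_bound[OF f A, of p "p i"]] p
          by (simp add: W_def)
        moreover have "(1 + norm (p i)) powr M > 0"
          using norm_ge_zero[of "p i"] unfolding powr_gt_zero by linarith
        ultimately show ?thesis using zero_le_mult_iff[of "B * W"] by fastforce
      qed
      have "norm (reg_sum \<mu> K (\<lambda>d. f (p(i := of_nat (Suc d))))) \<le>
         (\<Sum>j<K. 2 ^ j * (B * W * (2 + real K) powr \<bar>M\<bar>) / norm (1 - \<mu>) ^ Suc j) +
         (\<Sum>d. diff_const \<eta> \<epsilon> M K * (B * W) / (real (Suc d))\<^sup>2) / norm (1 - \<mu>) ^ K"
      proof (rule norm_reg_sum_le[OF \<mu>])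
        fix j assume j: "j < K"
        have "norm (f (p(i := of_nat (Suc j)))) \<le> B * W * (1 + norm (of_nat (Suc j) :: complex)) powr M"
          unfolding W_def using p nat_D by (intro symbol_class_coordinate_bound[OF f A]) auto
        also have "1 + norm (of_nat (Suc j) :: complex) = 2 + real j" unfolding norm_of_nat by simp
        also have "B * W * (2 + real j) powr M \<le> B * W * (2 + real K) powr \<bar>M\<bar>"
          using j B0
          by (intro mult_left_mono order_trans[OF powr_mono[of M "\<bar>M\<bar>" "2 + real j"]] powr_mono2) auto
        finally show "norm (f (p(i := of_nat (Suc j)))) \<le> B * W * (2 + real K) powr \<bar>M\<bar>" .
      qed (use symbol_class_diff_bound[OF f A D] p in \<open>auto simp: W_def\<close>)
      also have "(\<Sum>d. diff_const \<eta> \<epsilon> M K * (B * W) / (real (Suc d))\<^sup>2) = diff_const \<eta> \<epsilon> M K * (B * W) * (\<Sum>d. 1 / (real (Suc d))\<^sup>2)"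
        using suminf_mult[OF summable_inverse_squares_Suc[of 1], of "diff_const \<eta> \<epsilon> M K * (B * W)"] by simp
      also have "(\<Sum>j<K. 2 ^ j * (B * W * (2 + real K) powr \<bar>M\<bar>) / norm (1 - \<mu>) ^ Suc j) +
          diff_const \<eta> \<epsilon> M K * (B * W) * (\<Sum>d. 1 / (real (Suc d))\<^sup>2) / norm (1 - \<mu>) ^ K =
          reg_const \<eta> \<epsilon> M K \<mu> * B * W"
        by (simp add: reg_const_def algebra_simps sum_distrib_left)
      finally have "norm (reg_sum \<mu> K (\<lambda>d. f (p(i := of_nat (Suc d))))) \<le> reg_const \<eta> \<epsilon> M K \<mu> * B * W" .
      then show "norm (\<mu> * reg_sum \<mu> K (\<lambda>d. f (p(i := of_nat (Suc d))))) \<le> reg_const \<eta> \<epsilon> M K \<mu> * B * (\<Prod>i\<in>A - {i}. (1 + norm (p i)) powr M)"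
        using \<mu> by (simp add: norm_mult W_def)
      show "(\<lambda>z. \<mu> * reg_sum \<mu> K (\<lambda>d. f ((p(k := z))(i := of_nat (Suc d))))) holomorphic_on D k" for k
      \<comment> \<open>In the summed variable the function is constant, since the summation
        overwrites it.\<close>
      proof (cases "k = i")
        case False
        have "(\<lambda>z. reg_sum \<mu> K (\<lambda>d. f ((p(k := z))(i := of_nat (Suc d))))) holomorphic_on D k"
        proof (rule holomorphic_on_reg_sum[OF _ \<mu>])
          show "(\<lambda>z. f (p(k := z, i := of_nat (Suc d)))) holomorphic_on D k" for d
            using symbol_classD(2)[OF f, of "p(i := of_nat (Suc d))" k] p nat_D[of d] False
            by (auto simp: fun_upd_twist)
          show "norm ((fwd_diff ^^ K) (\<lambda>d. f (p(k := z, i := of_nat (Suc d)))) d) \<le>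
              diff_const \<eta> \<epsilon> M K * (B * (\<Prod>j\<in>A - {i}. (1 + norm ((p(k := z)) j)) powr M)) / (real (Suc d))\<^sup>2"
            if "z \<in> D k" for z d
            using p that by (intro symbol_class_diff_bound[OF f A D]) auto
          have "1 + norm ((p(k := z)) j) \<noteq> 0" for z j by (smt (verit) norm_ge_zero)
          moreover have "continuous_on (D k) (\<lambda>z. (p(k := z)) j)" for j
            by (cases "j = k") auto
          ultimately show "continuous_on (D k)
              (\<lambda>z. diff_const \<eta> \<epsilon> M K * (B * (\<Prod>j\<in>A - {i}. (1 + norm ((p(k := z)) j)) powr M)))"
            by (intro continuous_intros) auto
        qed (use opn in auto)
        then show ?thesis by (intro holomorphic_intros)
      qed auto
    qed
qed

end

text \<open>The head of the list is the outermost sum, and p supplies the variables outside the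
  list. All variables share one order K, so that stability can be proved by raising K by one
  everywhere.\<close>

primrec reg_iter ::
  "('i \<Rightarrow> complex) \<Rightarrow> nat \<Rightarrow> 'i list \<Rightarrow> (('i \<Rightarrow> complex) \<Rightarrow> complex) \<Rightarrow> ('i \<Rightarrow> complex) \<Rightarrow> complex" where
  "reg_iter \<mu> K [] f p = f p"
| "reg_iter \<mu> K (i # is) f p =
     \<mu> i * reg_sum (\<mu> i) K (\<lambda>d. reg_iter \<mu> K is f (p(i := of_nat (Suc d))))"

text \<open>Only points with positive integers in the summed coordinates are ever reached. Two
  points q, q' are compared because the two sides may carry different parameters: the power at s =
  -k is later matched with a polynomial based at the parameter 0.\<close>

lemma reg_iter_cong:
  assumes "\<And>q q'. (\<And>i. i \<in> set is \<Longrightarrow> \<exists>d. q i = of_nat (Suc d) \<and> q' i = of_nat (Suc d)) \<Longrightarrow>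
    (\<And>i. i \<notin> set is \<Longrightarrow> q i = p i \<and> q' i = p' i) \<Longrightarrow> f q = g q'"
  shows "reg_iter \<mu> K is f p = reg_iter \<mu> K is g p'"
  using assms
proof (induction "is" arbitrary: p p')
  case (Cons i "is")
  have "reg_iter \<mu> K is f (p(i := of_nat (Suc d))) = reg_iter \<mu> K is g (p'(i := of_nat (Suc d)))" for d
  proof (rule Cons.IH)
    fix q q' assume q: "\<And>j. j \<in> set is \<Longrightarrow> \<exists>d. q j = of_nat (Suc d) \<and> q' j = of_nat (Suc d)"
      "\<And>j. j \<notin> set is \<Longrightarrow> q j = (p(i := of_nat (Suc d))) j \<and> q' j = (p'(i := of_nat (Suc d))) j"
    show "f q = g q'"
    proof (rule Cons.prems)
      show "\<exists>d. q j = of_nat (Suc d) \<and> q' j = of_nat (Suc d)" if "j \<in> set (i # is)" for j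
        using q that by (cases "j \<in> set is") auto
      show "q j = p j \<and> q' j = p' j" if "j \<notin> set (i # is)" for j using q(2) that by auto
    qed
  qed
  then show ?case by simp
qed auto

text \<open>On each symbol class the sequence is eventually constant, so the limit gives the common
  value without a choice of K, which would have to depend on the parameters.\<close>

definition reg_lim ::
  "('i \<Rightarrow> complex) \<Rightarrow> 'i list \<Rightarrow> (('i \<Rightarrow> complex) \<Rightarrow> complex) \<Rightarrow> ('i \<Rightarrow> complex) \<Rightarrow> complex" where
  "reg_lim \<mu> is f p = lim (\<lambda>K. reg_iter \<mu> K is f p)"

locale reg_setup =
  fixes \<eta> \<epsilon> :: real and D :: "'i \<Rightarrow> complex set" and A :: "'i set" and \<mu> :: "'i \<Rightarrow> complex"
  assumes \<eta>: "0 < \<eta>" "\<eta> \<le> 1/2" and \<epsilon>: "0 < \<epsilon>" "\<epsilon> \<le> 1"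
    and opn: "\<And>k. open (D k)" and D: "\<And>i. i \<in> A \<Longrightarrow> D i = reg_domain \<eta> \<epsilon>"
    and A: "finite A" and \<mu>: "\<And>i. i \<in> A \<Longrightarrow> norm (\<mu> i) = 1" "\<And>i. i \<in> A \<Longrightarrow> \<mu> i \<noteq> 1"
begin

lemma of_nat_in_domain: "i \<in> A \<Longrightarrow> of_nat (Suc d) \<in> D i"
  using of_nat_in_reg_domain[OF \<eta>(1)] D by blast

lemma symbol_class_reg_iter:
  assumes K: "M - \<epsilon> * K \<le> -2" and "distinct is" "set is \<subseteq> A" and f: "symbol_class D A M B f"
  shows "symbol_class D (A - set is) M ((\<Prod>i\<leftarrow>is. reg_const \<eta> \<epsilon> M K (\<mu> i)) * B) (reg_iter \<mu> K is f)"
  using assms(2,3)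
proof (induction "is")
  case Nil
  have "reg_iter \<mu> K [] f = f" by (rule ext) simp
  then show ?case using f by simp
next
  case (Cons i "is")
  have i: "i \<in> A" "i \<in> A - set is" using Cons.prems by auto
  have IH: "symbol_class D (A - set is) M ((\<Prod>i\<leftarrow>is. reg_const \<eta> \<epsilon> M K (\<mu> i)) * B) (reg_iter \<mu> K is f)"
    using Cons by auto
  have eq: "reg_iter \<mu> K (i # is) f =
      (\<lambda>p. \<mu> i * reg_sum (\<mu> i) K (\<lambda>d. reg_iter \<mu> K is f (p(i := of_nat (Suc d)))))"
    by (rule ext) simp
  have "A - set is - {i} = A - set (i # is)" by auto
  then show ?case
    using symbol_class_reg_sum[OF \<eta> \<epsilon> K \<mu>(1)[OF i(1)] IH _ i(2) D[OF i(1)] opn] A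
    unfolding eq by (simp add: mult.assoc)
qed

lemma reg_iter_summable:
  assumes K: "M - \<epsilon> * K \<le> -2" and "distinct (i # is)" "set (i # is) \<subseteq> A"
    and f: "symbol_class D A M B f" and p: "\<And>k. p k \<in> D k"
  shows "summable (\<lambda>d. norm ((fwd_diff ^^ K) (\<lambda>d. reg_iter \<mu> K is f (p(i := of_nat (Suc d)))) d))"
proof -
  have "distinct is" "set is \<subseteq> A" using assms by auto
  from symbol_class_reg_iter[OF K this f] have C: "symbol_class D (A - set is) M
    ((\<Prod>i\<leftarrow>is. reg_const \<eta> \<epsilon> M K (\<mu> i)) * B) (reg_iter \<mu> K is f)" .
  show ?thesis
    using assms A D by (intro symbol_class_summable[OF \<eta> \<epsilon> K C]) auto
qed

text \<open>The inner iterated sums agree for K and K + 1 at every lattice value of the outer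
  variable; then one more summation by parts applies to the outer sum, whose K-th differences are
  already absolutely summable.\<close>

lemma reg_iter_Suc:
  assumes K: "M - \<epsilon> * K \<le> -2" and "distinct is" "set is \<subseteq> A"
    and f: "symbol_class D A M B f" and p: "\<And>k. p k \<in> D k"
  shows "reg_iter \<mu> (Suc K) is f p = reg_iter \<mu> K is f p"
  using assms(2,3) p
proof (induction "is" arbitrary: p)
  case (Cons i "is")
  have i: "i \<in> A" using Cons.prems by auto
  have "reg_iter \<mu> (Suc K) is f (p(i := of_nat (Suc d))) = reg_iter \<mu> K is f (p(i := of_nat (Suc d)))" for d
    using Cons.prems of_nat_in_domain[OF i] by (intro Cons.IH) auto
  then show ?case
    using reg_sum_Suc[OF \<mu>(1)[OF i] \<mu>(2)[OF i] reg_iter_summable[OF K Cons.prems(1,2) f Cons.prems(3)]]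
    by simp
qed auto

lemma reg_iter_le:
  assumes K: "M - \<epsilon> * K \<le> -2" and "K \<le> L" and "distinct is" "set is \<subseteq> A"
    and f: "symbol_class D A M B f" and p: "\<And>k. p k \<in> D k"
  shows "reg_iter \<mu> L is f p = reg_iter \<mu> K is f p"
  using \<open>K \<le> L\<close>
proof (induction L rule: dec_induct)
  case (step L)
  have "\<epsilon> * K \<le> \<epsilon> * L" using \<epsilon> step by (intro mult_left_mono) auto
  then show ?case using reg_iter_Suc[of M L "is" B f p] assms step by auto
qed auto

text \<open>At a fixed order K the functions must share the exponent M, which guarantees
  convergence; their constants B j may differ.\<close>

lemma reg_iter_lincomb:
  assumes K: "M - \<epsilon> * K \<le> -2" and "distinct is" "set is \<subseteq> A"
    and f: "\<And>j. j \<in> J \<Longrightarrow> symbol_class D A M (B j) (f j)" and p: "\<And>k. p k \<in> D k"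
  shows "reg_iter \<mu> K is (\<lambda>q. \<Sum>j\<in>J. c j * f j q) p = (\<Sum>j\<in>J. c j * reg_iter \<mu> K is (f j) p)"
  using assms(2,3) p
proof (induction "is" arbitrary: p)
  case (Cons i "is")
  have i: "i \<in> A" using Cons.prems by auto
  have eq: "reg_iter \<mu> K is (\<lambda>q. \<Sum>j\<in>J. c j * f j q) (p(i := of_nat (Suc d))) =
      (\<Sum>j\<in>J. c j * reg_iter \<mu> K is (f j) (p(i := of_nat (Suc d))))" for d
    using Cons.prems of_nat_in_domain[OF i] by (intro Cons.IH) auto
  have "reg_sum (\<mu> i) K (\<lambda>d. \<Sum>j\<in>J. c j * reg_iter \<mu> K is (f j) (p(i := of_nat (Suc d)))) =
      (\<Sum>j\<in>J. c j * reg_sum (\<mu> i) K (\<lambda>d. reg_iter \<mu> K is (f j) (p(i := of_nat (Suc d)))))"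
    using reg_iter_summable[OF K Cons.prems(1,2) f Cons.prems(3)] \<mu>(1)[OF i]
    by (intro reg_sum_lincomb) auto
  then show ?case by (simp only: reg_iter.simps eq sum_distrib_left mult_ac)
qed auto

lemma reg_lim_eq:
  assumes K: "M - \<epsilon> * K \<le> -2" and "distinct is" "set is \<subseteq> A"
    and f: "symbol_class D A M B f" and p: "\<And>k. p k \<in> D k"
  shows "reg_lim \<mu> is f p = reg_iter \<mu> K is f p"
  unfolding reg_lim_def
proof (rule limI, rule tendsto_eventually)
  show "\<forall>\<^sub>F L in sequentially. reg_iter \<mu> L is f p = reg_iter \<mu> K is f p"
    unfolding eventually_sequentially using reg_iter_le[OF K _ assms(2,3) f p] by blast
qed

lemma order_exists: "\<exists>K::nat. M - \<epsilon> * K \<le> -2"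
proof -
  have "(M + 2) / \<epsilon> \<le> real (nat \<lceil>(M + 2) / \<epsilon>\<rceil>)" by (rule real_nat_ceiling_ge)
  then have "M + 2 \<le> \<epsilon> * real (nat \<lceil>(M + 2) / \<epsilon>\<rceil>)" using \<epsilon> by (simp add: field_simps)
  then show ?thesis by (intro exI[of _ "nat \<lceil>(M + 2) / \<epsilon>\<rceil>"]) simp
qed

end

section \<open>Agreement with the ordinary sum in the range of absolute convergence\<close>

lemma bij_betw_PiE_insert:
  assumes "i \<notin> S"
  shows "bij_betw (\<lambda>(n, g). g(i := n)) (B i \<times> PiE S B) (PiE (insert i S) B)"
  using inj_combinator[OF assms, of B] by (auto simp: bij_betw_def PiE_insert_eq)

lemma abs_summable_on_prod_weights:
  fixes M :: real
  assumes "finite S" "M \<le> -2"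
  shows "(\<lambda>m. norm (\<Prod>i\<in>S. (1 + real (m i)) powr M)) summable_on (S \<rightarrow>\<^sub>E {1..})"
proof -
  have "summable (\<lambda>n. norm (norm ((1 + real n) powr M)))"
  proof (rule summable_comparison_test'[OF summable_inverse_squares_Suc[of 1], of 0])
    fix n :: nat
    have "(1 + real n) powr M \<le> (1 + real n) powr (-2)" using assms by (intro powr_mono) auto
    also have "\<dots> = 1 / (real (Suc n))\<^sup>2" by (simp add: powr_minus_divide)
    finally show "norm (norm (norm ((1 + real n) powr M))) \<le> 1 / (real (Suc n))\<^sup>2" by simp
  qed
  then have "(\<lambda>n. norm ((1 + real n) powr M)) summable_on UNIV" by (rule norm_summable_imp_summable_on)
  then have "(\<lambda>n. norm ((1 + real n) powr M)) summable_on {1..}" by (rule summable_on_subset_banach) auto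
  from abs_summable_equivalent[THEN iffD1, OF this] show ?thesis
    using assms by (intro abs_summable_equivalent[THEN iffD2] abs_summable_on_prod_PiE) auto
qed

context reg_setup
begin

lemma reg_term_abs_summable:
  assumes M: "M \<le> -2" and S: "S \<subseteq> A"
    and f: "symbol_class D A M B f" and p: "\<And>k. p k \<in> D k"
  shows "(\<lambda>m. norm ((\<Prod>i\<in>S. \<mu> i ^ m i) * f (\<lambda>i. if i \<in> S then of_nat (m i) else p i)))
    summable_on (S \<rightarrow>\<^sub>E {1..})"
proof -
  define c where "c = B * (\<Prod>i\<in>A - S. (1 + norm (p i)) powr M)"
  have fin: "finite S" using S A finite_subset by blast
  have "(\<lambda>m. c * norm (\<Prod>i\<in>S. (1 + real (m i)) powr M)) summable_on (S \<rightarrow>\<^sub>E {1..})"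
    using abs_summable_on_prod_weights[OF fin M] by (rule summable_on_cmult_right)
  then have "(\<lambda>m. norm (c * norm (\<Prod>i\<in>S. (1 + real (m i)) powr M))) summable_on (S \<rightarrow>\<^sub>E {1..})"
    by (rule summable_on_iff_abs_summable_on_real[THEN iffD1])
  then show ?thesis
  proof (rule Infinite_Sum.abs_summable_on_comparison_test)
    fix m :: "'i \<Rightarrow> nat" assume m: "m \<in> S \<rightarrow>\<^sub>E {1..}"
    define q where "q = (\<lambda>i. if i \<in> S then of_nat (m i) else p i)"
    have q: "q k \<in> D k" for k
    proof (cases "k \<in> S")
      case True
      then have "m k = Suc (m k - 1)" using m by (auto simp: PiE_iff)
      then show ?thesis using of_nat_in_domain[of k "m k - 1"] True S by (auto simp: q_def)
    qed (use p in \<open>auto simp: q_def\<close>)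
    have "norm (f q) \<le> B * (\<Prod>i\<in>A. (1 + norm (q i)) powr M)" using q by (rule symbol_classD(1)[OF f])
    also have "(\<Prod>i\<in>A. (1 + norm (q i)) powr M) =
        (\<Prod>i\<in>A - S. (1 + norm (q i)) powr M) * (\<Prod>i\<in>S. (1 + norm (q i)) powr M)"
      using A S by (intro prod.subset_diff)
    also have "(\<Prod>i\<in>A - S. (1 + norm (q i)) powr M) = (\<Prod>i\<in>A - S. (1 + norm (p i)) powr M)"
      by (intro prod.cong) (auto simp: q_def)
    also have "(\<Prod>i\<in>S. (1 + norm (q i)) powr M) = (\<Prod>i\<in>S. (1 + real (m i)) powr M)"
      by (intro prod.cong) (auto simp: q_def)
    finally have "norm (f q) \<le> c * (\<Prod>i\<in>S. (1 + real (m i)) powr M)"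
      by (simp add: c_def)
    also have "\<dots> \<le> norm (c * norm (\<Prod>i\<in>S. (1 + real (m i)) powr M))"
      by (simp add: abs_mult prod_nonneg mult_right_mono)
    finally have "norm (f q) \<le> norm (c * norm (\<Prod>i\<in>S. (1 + real (m i)) powr M))" .
    moreover have "norm (\<Prod>i\<in>S. \<mu> i ^ m i) = 1"
      unfolding prod_norm[symmetric] norm_power using S \<mu>(1) by (intro prod.neutral) auto
    ultimately show "norm ((\<Prod>i\<in>S. \<mu> i ^ m i) * f (\<lambda>i. if i \<in> S then of_nat (m i) else p i)) \<le>
        norm (c * norm (\<Prod>i\<in>S. (1 + real (m i)) powr M))"
      unfolding q_def norm_mult by simp
  qed
qed

text \<open>For K = 0 \<open>reg_sum\<close> has no boundary terms and is the plain series; M \<le>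
  -2 is the admissibility condition for that order. Absolute summability over the product lets the
  iterated series be collected into one sum, by Fubini.\<close>

lemma has_sum_reg_iter_0:
  assumes M: "M \<le> -2" and "distinct is" "set is \<subseteq> A"
    and f: "symbol_class D A M B f" and p: "\<And>k. p k \<in> D k"
  shows "((\<lambda>m. (\<Prod>i\<in>set is. \<mu> i ^ m i) * f (\<lambda>i. if i \<in> set is then of_nat (m i) else p i))
    has_sum reg_iter \<mu> 0 is f p) (set is \<rightarrow>\<^sub>E {1..})"
  using assms(2,3) p
proof (induction "is" arbitrary: p)
  case Nil
  show ?case by (simp add: has_sum_finite_iff)
next
  case (Cons i "is")
  define S where "S = set is"
  have i: "i \<in> A" "i \<notin> S" using Cons.prems by (auto simp: S_def)
  have S: "finite S" by (simp add: S_def)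
  define T where "T = (\<lambda>m. (\<Prod>j\<in>insert i S. \<mu> j ^ m j) *
    f (\<lambda>j. if j \<in> insert i S then of_nat (m j) else p j))"
  define v where "v = (\<lambda>n. \<mu> i ^ n * reg_iter \<mu> 0 is f (p(i := of_nat n)))"
  have M0: "M - \<epsilon> * real 0 \<le> -2" using M by simp
  have sv: "summable (\<lambda>d. norm (v (Suc d)))"
    using reg_iter_summable[OF M0 Cons.prems(1,2) f Cons.prems(3)] \<mu>(1)[OF i(1)]
    unfolding v_def norm_mult norm_power by simp
  have "(\<lambda>d. v (Suc d)) sums (\<Sum>d. v (Suc d))"
    using summable_norm_cancel[OF sv] by (rule summable_sums)
  moreover have "(\<Sum>d. v (Suc d)) = reg_iter \<mu> 0 (i # is) f p"
  proof -
    have "summable (\<lambda>d. \<mu> i ^ d * reg_iter \<mu> 0 is f (p(i := of_nat (Suc d))))"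
      using reg_iter_summable[OF M0 Cons.prems(1,2) f Cons.prems(3)] \<mu>(1)[OF i(1)]
      by (intro summable_twist) simp_all
    from suminf_mult[OF this, of "\<mu> i"] show ?thesis
      by (simp add: v_def reg_sum_def mult.assoc)
  qed
  ultimately have "((\<lambda>d. v (Suc d)) has_sum reg_iter \<mu> 0 (i # is) f p) UNIV"
    using norm_summable_imp_has_sum[OF sv] by simp
  moreover have "bij_betw Suc UNIV {1..}"
    by (rule bij_betwI[where g = "\<lambda>n. n - 1"]) auto
  ultimately have v: "(v has_sum reg_iter \<mu> 0 (i # is) f p) {1..}"
    using has_sum_reindex_bij_betw by blast
  have inner: "((\<lambda>g. T (g(i := n))) has_sum v n) (S \<rightarrow>\<^sub>E {1..})" if n: "n \<in> {1..}" for n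
  proof -
    have "of_nat n \<in> D i" using of_nat_in_domain[OF i(1), of "n - 1"] n by simp
    then have "((\<lambda>m. (\<Prod>j\<in>S. \<mu> j ^ m j) * f (\<lambda>j. if j \<in> S then of_nat (m j) else (p(i := of_nat n)) j))
        has_sum reg_iter \<mu> 0 is f (p(i := of_nat n))) (S \<rightarrow>\<^sub>E {1..})"
      unfolding S_def using Cons.prems by (intro Cons.IH) auto
    then have *: "((\<lambda>m. \<mu> i ^ n * ((\<Prod>j\<in>S. \<mu> j ^ m j) *
        f (\<lambda>j. if j \<in> S then of_nat (m j) else (p(i := of_nat n)) j))) has_sum v n) (S \<rightarrow>\<^sub>E {1..})"
      unfolding v_def by (rule has_sum_cmult_right)
    have "\<mu> i ^ n * ((\<Prod>j\<in>S. \<mu> j ^ g j) * f (\<lambda>j. if j \<in> S then of_nat (g j) else (p(i := of_nat n)) j)) =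
        T (g(i := n))" for g
    proof -
      have "(\<Prod>j\<in>insert i S. \<mu> j ^ (g(i := n)) j) = \<mu> i ^ n * (\<Prod>j\<in>S. \<mu> j ^ (g(i := n)) j)"
        using i(2) S by simp
      also have "(\<Prod>j\<in>S. \<mu> j ^ (g(i := n)) j) = (\<Prod>j\<in>S. \<mu> j ^ g j)"
        using i(2) by (intro prod.cong) auto
      finally have 1: "(\<Prod>j\<in>insert i S. \<mu> j ^ (g(i := n)) j) = \<mu> i ^ n * (\<Prod>j\<in>S. \<mu> j ^ g j)" .
      have 2: "(\<lambda>j. if j \<in> insert i S then of_nat ((g(i := n)) j) else p j) =
          (\<lambda>j. if j \<in> S then of_nat (g j) else (p(i := of_nat n)) j)"
        using i(2) by (auto simp: fun_eq_iff)
      show ?thesis unfolding T_def 1 2 by (simp only: mult.assoc)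
    qed
    then show ?thesis using * by simp
  qed
  have summ: "T summable_on (insert i S \<rightarrow>\<^sub>E {1..})"
    unfolding T_def
    by (rule abs_summable_summable, rule reg_term_abs_summable[OF M _ f Cons.prems(3)])
      (use Cons.prems S_def in auto)
  note bij = bij_betw_PiE_insert[OF i(2), of "\<lambda>_. {1..}"]
  have "((\<lambda>(n, g). T (g(i := n))) has_sum reg_iter \<mu> 0 (i # is) f p) ({1..} \<times> (S \<rightarrow>\<^sub>E {1..}))"
  proof (rule has_sum_SigmaI[OF _ v])
    show "(\<lambda>(n, g). T (g(i := n))) summable_on {1..} \<times> (S \<rightarrow>\<^sub>E {1..})"
      using summable_on_reindex_bij_betw[OF bij, of T] summ by (simp add: case_prod_unfold)
  qed (use inner in auto)
  then have "(T has_sum reg_iter \<mu> 0 (i # is) f p) (insert i S \<rightarrow>\<^sub>E {1..})"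
    using has_sum_reindex_bij_betw[OF bij, of T] by (simp add: case_prod_unfold)
  then show ?case unfolding T_def S_def by simp
qed

end

section \<open>Entire functions of several variables\<close>

text \<open>Along the complex line through s in the direction (1, ..., 1) all real parts increase
  together, so the line meets the region of agreement in a half-plane. The one-variable identity
  theorem then reaches s itself.\<close>

lemma continuation_unique:
  fixes F G :: "complex^'t \<Rightarrow> complex"
  assumes F: "entire F" and G: "entire G"
    and eq: "\<And>s. (\<And>t. \<sigma> < Re (s $ t)) \<Longrightarrow> F s = G s"
  shows "F = G"
proof
  fix s :: "complex^'t"
  define e :: "complex^'t" where "e = (\<chi> t. 1)"
  have hol: "(\<lambda>z. H (s + z *s e)) holomorphic_on UNIV" if H: "entire H" for H
    unfolding holomorphic_on_def
  proof
    fix z :: complex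
    obtain D where D: "(H has_derivative D) (at (s + z *s e))" "\<And>c v. D (c *s v) = c * D v"
      using H unfolding entire_def by blast
    have "((\<lambda>z. s + z *s e) has_derivative (\<lambda>h. h *s e)) (at z)"
    proof -
      have "bounded_linear (\<lambda>h. h *s e :: complex^'t)"
        by (rule bounded_linear_intro[of _ "norm e"])
          (auto simp: vec_eq_iff algebra_simps norm_vec_def L2_set_def norm_mult power_mult_distrib
            sum_distrib_left[symmetric] real_sqrt_mult e_def)
      then show ?thesis
        by (auto intro!: derivative_eq_intros bounded_linear_imp_has_derivative)
    qed
    from has_derivative_compose[OF this D(1)]
    have "((\<lambda>z. H (s + z *s e)) has_field_derivative (D e)) (at z)"
      unfolding has_field_derivative_def D(2) by (simp add: mult.commute[of _ "D e"])
    then show "(\<lambda>z. H (s + z *s e)) field_differentiable at z within UNIV"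
      unfolding field_differentiable_def by blast
  qed
  define m where "m = (\<Sum>t\<in>UNIV. \<bar>Re (s $ t)\<bar>)"
  have m: "- m \<le> Re (s $ t)" for t
    using member_le_sum[of t UNIV "\<lambda>t. \<bar>Re (s $ t)\<bar>"] by (simp add: m_def)
  have "F (s + 0 *s e) = G (s + 0 *s e)"
  proof (rule analytic_continuation_open[OF _ open_UNIV _ connected_UNIV subset_UNIV hol[OF F] hol[OF G]])
    show "open {z. \<sigma> + m < Re z}" by (rule open_halfspace_Re_gt)
    have "complex_of_real (\<sigma> + m + 1) \<in> {z. \<sigma> + m < Re z}" by simp
    then show "{z. \<sigma> + m < Re z} \<noteq> {}" by blast
    fix z assume z: "z \<in> {z. \<sigma> + m < Re z}"
    have "\<sigma> < Re ((s + z *s e) $ t)" for t using z m[of t] by (simp add: e_def)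
    then show "F (s + z *s e) = G (s + z *s e)" by (rule eq)
  qed simp
  then show "F s = G s" by simp
qed

lemma entire_add: "entire F \<Longrightarrow> entire G \<Longrightarrow> entire (\<lambda>s. F s + G s)"
  unfolding entire_def
proof
  fix s
  assume "\<forall>s. \<exists>D. (F has_derivative D) (at s) \<and> (\<forall>c v. D (c *s v) = c * D v)"
    "\<forall>s. \<exists>D. (G has_derivative D) (at s) \<and> (\<forall>c v. D (c *s v) = c * D v)"
  then obtain D E where "(F has_derivative D) (at s)" "\<forall>c v. D (c *s v) = c * D v"
    "(G has_derivative E) (at s)" "\<forall>c v. E (c *s v) = c * E v" by blast
  then show "\<exists>D. ((\<lambda>s. F s + G s) has_derivative D) (at s) \<and> (\<forall>c v. D (c *s v) = c * D v)"
    by (intro exI[of _ "\<lambda>v. D v + E v"]) (auto intro: has_derivative_add simp: distrib_left)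
qed

lemma entire_cmult: "entire F \<Longrightarrow> entire (\<lambda>s. c * F s)"
  unfolding entire_def
proof
  fix s
  assume "\<forall>s. \<exists>D. (F has_derivative D) (at s) \<and> (\<forall>c v. D (c *s v) = c * D v)"
  then obtain D where "(F has_derivative D) (at s)" "\<forall>c v. D (c *s v) = c * D v" by blast
  then show "\<exists>D. ((\<lambda>s. c * F s) has_derivative D) (at s) \<and> (\<forall>c v. D (c *s v) = c * D v)"
    by (intro exI[of _ "\<lambda>v. c * D v"]) (auto intro: has_derivative_mult_right)
qed

lemma entire_const: "entire (\<lambda>s. c)"
  unfolding entire_def by (intro allI exI[of _ "\<lambda>_. 0"]) auto

lemma entire_sum: "(\<And>x. x \<in> X \<Longrightarrow> entire (F x)) \<Longrightarrow> entire (\<lambda>s. \<Sum>x\<in>X. F x s)"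
  by (induction X rule: infinite_finite_induct) (auto intro: entire_const entire_add)

section \<open>Joint holomorphy from separate holomorphy and local bounds\<close>

lemma norm_axis_complex: "norm (axis t z :: complex^'t) = norm z"
proof -
  have "(\<Sum>i\<in>UNIV. (norm ((axis t z :: complex^'t) $ i))\<^sup>2) = (\<Sum>i\<in>UNIV. if i = t then (norm z)\<^sup>2 else 0)"
    by (intro sum.cong) (auto simp: axis_def)
  then show ?thesis by (simp add: norm_vec_def L2_set_def)
qed

text \<open>Osgood's lemma. Boundedness and Cauchy's inequality control all derivatives along the
  axes, and switching on the coordinates of the increment one at a time assembles one-variable
  Taylor expansions into a joint one with quadratic error.\<close>

lemma entire_if_separately_holomorphic:
  fixes F :: "complex^'t \<Rightarrow> complex"
  assumes sep: "\<And>s t. (\<lambda>z. F (s + axis t z)) holomorphic_on UNIV"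
    and bd: "\<And>R. \<exists>B. \<forall>s. norm s \<le> R \<longrightarrow> norm (F s) \<le> B"
  shows "entire F"
  unfolding entire_def
proof
  fix s :: "complex^'t"
  \<comment> \<open>The margin 5 leaves room for the unit discs consumed successively by the
    estimates below.\<close>
  define R where "R = norm s + 5"
  obtain B where B: "\<And>s. norm s \<le> R \<Longrightarrow> norm (F s) \<le> B" using bd by blast
  have B0: "B \<ge> 0" using order_trans[OF norm_ge_zero B[of 0]] by (simp add: R_def)
  define dF where "dF = (\<lambda>t s. deriv (\<lambda>z. F (s + axis t z)) 0)"
  define part where "part = (\<lambda>X (v :: complex^'t). \<chi> j. if j \<in> X then v $ j else 0)"
  have part: "norm (part X v) \<le> norm v" for X v
    unfolding part_def norm_vec_def by (intro L2_set_mono) auto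
  have part_insert: "part (insert t X) v = part X v + axis t (v $ t)" if "t \<notin> X" for t X v
    using that by (auto simp: part_def vec_eq_iff axis_def)
  have axis_add: "s + axis t (z + w) = (s + axis t z) + axis t w" for s t and z w :: complex
    by (auto simp: vec_eq_iff axis_def)
  have axis0: "s' + axis t 0 = s'" for s' :: "complex^'t" and t
    by (auto simp: vec_eq_iff axis_def)
  have nle: "norm (s' + axis t z) \<le> norm s' + norm z" for s' t and z :: complex
    using norm_triangle_ineq[of s' "axis t z"] by (simp add: norm_axis_complex)
  have cauchy: "norm ((deriv ^^ n) (\<lambda>z. F (s' + axis t z)) z) \<le> fact n * B"
    if "norm s' + norm z \<le> R - 1" for s' t z n
  proof -
    have "norm ((deriv ^^ n) (\<lambda>z. F (s' + axis t z)) z) \<le> fact n * B / 1 ^ n"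
    proof (rule Cauchy_inequality)
      show "(\<lambda>z. F (s' + axis t z)) holomorphic_on ball z 1"
        using sep by (rule holomorphic_on_subset) auto
      show "continuous_on (cball z 1) (\<lambda>z. F (s' + axis t z))"
        using holomorphic_on_imp_continuous_on[OF sep] by (rule continuous_on_subset) auto
      fix w assume "norm (z - w) = 1"
      then have "norm w \<le> norm z + 1" using norm_triangle_ineq2[of w z] by (simp add: norm_minus_commute)
      then show "norm (F (s' + axis t w)) \<le> B" using that by (intro B order_trans[OF nle]) auto
    qed auto
    then show ?thesis by simp
  qed
  have der: "((deriv ^^ n) (\<lambda>z. F (s' + axis t z)) has_field_derivative
      (deriv ^^ Suc n) (\<lambda>z. F (s' + axis t z)) z) (at z within S)" for s' t n z S
  proof -
    have "(deriv ^^ n) (\<lambda>z. F (s' + axis t z)) holomorphic_on UNIV"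
      using sep by (intro holomorphic_higher_deriv) auto
    from holomorphic_derivI[OF this open_UNIV UNIV_I, of z] show ?thesis
      unfolding funpow.simps comp_def by (rule has_field_derivative_at_within)
  qed
  have lip1: "norm (F (s' + axis t z) - F s') \<le> B * norm z"
    if "norm s' \<le> R - 2" "norm z \<le> 1" for s' t z
  proof -
    have "norm (F (s' + axis t z) - F (s' + axis t 0)) \<le> B * norm (z - 0)"
    proof (rule field_differentiable_bound[OF convex_cball[of 0 1], of "\<lambda>z. F (s' + axis t z)"])
      show "((\<lambda>z. F (s' + axis t z)) has_field_derivative deriv (\<lambda>z. F (s' + axis t z)) u) (at u within cball 0 1)" for u
        using der[of 0] by simp
      show "norm (deriv (\<lambda>z. F (s' + axis t z)) u) \<le> B" if "u \<in> cball 0 1" for u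
        using cauchy[of s' u 1 t] that \<open>norm s' \<le> R - 2\<close> by simp
    qed (use that in auto)
    then show ?thesis by (simp add: axis0)
  qed
  have lip: "norm (F (s' + part X v) - F s') \<le> card X * B * norm v"
    if "finite X" "norm s' \<le> R - 3" "norm v \<le> 1" for X s' v
    using that(1)
  proof (induction X)
    case (insert t X)
    have vt: "norm (v $ t) \<le> norm v" by (rule Finite_Cartesian_Product.norm_nth_le)
    have "norm (s' + part X v) \<le> R - 2"
      using that part[of X v] norm_triangle_ineq[of s' "part X v"] by linarith
    then have "norm (F (s' + part X v + axis t (v $ t)) - F (s' + part X v)) \<le> B * norm (v $ t)"
      using vt that by (intro lip1) auto
    also have "\<dots> \<le> B * norm v" using vt B0 by (rule mult_left_mono)
    finally have "norm (F (s' + part X v + axis t (v $ t)) - F (s' + part X v)) \<le> B * norm v" .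
    then have "norm (F (s' + part X v + axis t (v $ t)) - F s') \<le> B * norm v + card X * B * norm v"
      using insert.IH norm_diff_triangle_le by blast
    then show ?case using insert by (simp add: part_insert add.assoc algebra_simps)
  qed (simp add: part_def zero_vec_def[symmetric])
  \<comment> \<open>Cauchy's inequality for the difference of two parallel slices turns the
    Lipschitz bound of F into one for its partial derivatives.\<close>
  have dlip: "norm (dF t (s + part X v) - dF t s) \<le> card X * B * norm v"
    if "finite X" "norm v \<le> 1" for t X v
  proof -
    define h where "h = (\<lambda>z. F (s + part X v + axis t z) - F (s + axis t z))"
    have h: "h holomorphic_on UNIV" unfolding h_def using sep by (intro holomorphic_intros)
    have "norm ((deriv ^^ 1) h 0) \<le> fact 1 * (card X * B * norm v) / 1 ^ 1"
    proof (rule Cauchy_inequality)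
      show "h holomorphic_on ball 0 1" using h by (rule holomorphic_on_subset) auto
      show "continuous_on (cball 0 1) h"
        using holomorphic_on_imp_continuous_on[OF h] by (rule continuous_on_subset) auto
      fix w :: complex assume "norm (0 - w) = 1"
      then have "norm (s + axis t w) \<le> R - 3" using nle[of s t w] by (simp add: R_def)
      from lip[OF that(1) this that(2)] show "norm (h w) \<le> card X * B * norm v"
        by (simp add: h_def add_ac)
    qed auto
    moreover have "deriv h 0 = dF t (s + part X v) - dF t s"
      unfolding h_def dF_def
      using sep by (intro deriv_diff) (auto simp: holomorphic_on_def)
    ultimately show ?thesis by simp
  qed
  have taylor: "norm (F (s' + axis t z) - F s' - dF t s' * z) \<le> 2 * B * norm z ^ 2"
    if "norm s' \<le> R - 2" "norm z \<le> 1" for s' t z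
  proof -
    define g where "g = (\<lambda>z. F (s' + axis t z))"
    have "norm (g z - (\<Sum>i\<le>1. (deriv ^^ i) g 0 * (z - 0) ^ i / fact i)) \<le> 2 * B * norm (z - 0) ^ Suc 1 / fact 1"
    proof (rule complex_Taylor[of "cball 0 1" 1 "\<lambda>i. (deriv ^^ i) g", simplified funpow_0])
      show "((deriv ^^ i) g has_field_derivative (deriv ^^ Suc i) g x) (at x within cball 0 1)" for i x
        unfolding g_def by (rule der)
      show "norm ((deriv ^^ Suc 1) g x) \<le> 2 * B" if "x \<in> cball 0 1" for x
        using cauchy[of s' x 2 t] that \<open>norm s' \<le> R - 2\<close> by (simp add: g_def numeral_2_eq_2)
    qed (use that in auto)
    then show ?thesis by (simp add: g_def dF_def axis0 power2_eq_square algebra_simps)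
  qed
  have main: "\<exists>C. \<forall>v. norm v \<le> 1 \<longrightarrow>
      norm (F (s + part X v) - F s - (\<Sum>t\<in>X. dF t s * v $ t)) \<le> C * norm v ^ 2" if "finite X" for X
    using that
  proof (induction X)
    case empty
    show ?case by (intro exI[of _ 0]) (simp add: part_def zero_vec_def[symmetric])
  next
    case (insert t X)
    then obtain C where C: "\<And>v. norm v \<le> 1 \<Longrightarrow>
      norm (F (s + part X v) - F s - (\<Sum>t\<in>X. dF t s * v $ t)) \<le> C * norm v ^ 2" by blast
    show ?case
    proof (intro exI[of _ "C + 2 * B + card X * B"] allI impI)
      fix v :: "complex^'t" assume v: "norm v \<le> 1"
      have vt: "norm (v $ t) \<le> norm v" by (rule Finite_Cartesian_Product.norm_nth_le)
      have "norm (s + part X v) \<le> R - 2"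
        using v part[of X v] norm_triangle_ineq[of s "part X v"] by (simp add: R_def)
      then have "norm (F (s + part X v + axis t (v $ t)) - F (s + part X v) - dF t (s + part X v) * v $ t)
          \<le> 2 * B * norm (v $ t) ^ 2"
        using vt v by (intro taylor) auto
      also have "\<dots> \<le> 2 * B * norm v ^ 2" using vt B0 by (intro mult_left_mono power_mono) auto
      finally have 1: "norm (F (s + part X v + axis t (v $ t)) - F (s + part X v) - dF t (s + part X v) * v $ t)
          \<le> 2 * B * norm v ^ 2" .
      have 2: "norm ((dF t (s + part X v) - dF t s) * v $ t) \<le> (card X * B * norm v) * norm v"
        unfolding norm_mult using vt B0 insert v by (intro mult_mono dlip) auto
      \<comment> \<open>The error splits into the Taylor remainder in the new coordinate, the effect
        of having differentiated at s + part X v instead of s, and the error for the previous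
        coordinates.\<close>
      define a b c where "a = F (s + part X v + axis t (v $ t)) - F (s + part X v) - dF t (s + part X v) * v $ t"
        and "b = (dF t (s + part X v) - dF t s) * v $ t"
        and "c = F (s + part X v) - F s - (\<Sum>t\<in>X. dF t s * v $ t)"
      have "F (s + part (insert t X) v) - F s - (\<Sum>t\<in>insert t X. dF t s * v $ t) = a + b + c"
        using insert by (simp add: part_insert add.assoc a_def b_def c_def algebra_simps)
      moreover have "norm (a + b + c) \<le> norm a + norm b + norm c"
        using norm_triangle_ineq[of "a + b" c] norm_triangle_ineq[of a b] by linarith
      ultimately show "norm (F (s + part (insert t X) v) - F s - (\<Sum>t\<in>insert t X. dF t s * v $ t))
          \<le> (C + 2 * B + card X * B) * norm v ^ 2"
        using 1[folded a_def] 2[folded b_def] C[OF v, folded c_def]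
        by (simp add: distrib_right power2_eq_square mult.assoc)
    qed
  qed
  obtain C where C: "\<And>v. norm v \<le> 1 \<Longrightarrow>
      norm (F (s + v) - F s - (\<Sum>t\<in>UNIV. dF t s * v $ t)) \<le> C * norm v ^ 2"
    using main[OF finite, of UNIV] by (auto simp: part_def)
  define D where "D = (\<lambda>v :: complex^'t. \<Sum>t\<in>UNIV. dF t s * v $ t)"
  have "(F has_derivative D) (at s)"
    unfolding has_derivative_at
  proof
    show "bounded_linear D"
      unfolding D_def
      by (intro bounded_linear_sum bounded_linear_const_mult bounded_linear_vec_nth)
    show "(\<lambda>h. norm (F (s + h) - F s - D h) / norm h) \<midarrow>0\<rightarrow> 0"
    proof (rule Lim_null_comparison)
      show "\<forall>\<^sub>F h in at 0. norm (norm (F (s + h) - F s - D h) / norm h) \<le> \<bar>C\<bar> * norm h"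
        unfolding eventually_at
      proof (intro exI[of _ 1] conjI ballI impI)
        fix h :: "complex^'t" assume h: "h \<noteq> 0 \<and> dist h 0 < 1"
        then have "norm (F (s + h) - F s - D h) \<le> C * norm h ^ 2"
          unfolding D_def by (intro C) (auto simp: dist_norm)
        also have "\<dots> \<le> \<bar>C\<bar> * norm h ^ 2" by (intro mult_right_mono) auto
        finally show "norm (norm (F (s + h) - F s - D h) / norm h) \<le> \<bar>C\<bar> * norm h"
          using h by (simp add: field_simps power2_eq_square)
      qed auto
      have "((\<lambda>h::complex^'t. \<bar>C\<bar> * norm h) \<longlongrightarrow> \<bar>C\<bar> * norm (0::complex^'t)) (at 0)"
        by (intro tendsto_intros)
      then show "((\<lambda>h::complex^'t. \<bar>C\<bar> * norm h) \<longlongrightarrow> 0) (at 0)" by simp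
    qed
  qed
  moreover have "\<forall>c v. D (c *s v) = c * D v"
    by (simp add: D_def sum_distrib_left mult_ac)
  ultimately show "\<exists>D. (F has_derivative D) (at s) \<and> (\<forall>c v. D (c *s v) = c * D v)" by blast
qed

section \<open>Polynomials satisfying HDF\<close>

text \<open>Generic in the ring of values, so that a real polynomial and its complexification share
  one list of coefficients.\<close>

definition mpoly_eval ::
  "('n::finite \<Rightarrow> nat) set \<Rightarrow> (('n \<Rightarrow> nat) \<Rightarrow> real) \<Rightarrow> ('n \<Rightarrow> 'a) \<Rightarrow> 'a::{real_algebra_1,comm_ring_1}" where
  "mpoly_eval S c w = (\<Sum>\<beta>\<in>S. of_real (c \<beta>) * (\<Prod>i\<in>UNIV. w i ^ \<beta> i))"

text \<open>The \<alpha>-th Taylor coefficient at x, that is, the \<alpha>-th derivative divided by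
  the factorials. Truncated subtraction in the exponent is harmless, because the binomial
  coefficient vanishes when \<alpha> i exceeds \<beta> i.\<close>

definition mpoly_taylor ::
  "('n::finite \<Rightarrow> nat) set \<Rightarrow> (('n \<Rightarrow> nat) \<Rightarrow> real) \<Rightarrow> ('n \<Rightarrow> nat) \<Rightarrow> ('n \<Rightarrow> real) \<Rightarrow> real" where
  "mpoly_taylor S c \<alpha> x = (\<Sum>\<beta>\<in>S. c \<beta> * (\<Prod>i\<in>UNIV. real (\<beta> i choose \<alpha> i) * x i ^ (\<beta> i - \<alpha> i)))"

text \<open>Zero coefficients are excluded so that S is the true support: a maximal exponent in S
  must have a non-zero coefficient, and S decides on which variables p depends.\<close>

definition mpoly_repr :: "(real^'n \<Rightarrow> real) \<Rightarrow> ('n \<Rightarrow> nat) set \<Rightarrow> (('n \<Rightarrow> nat) \<Rightarrow> real) \<Rightarrow> bool" where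
  "mpoly_repr p S c \<longleftrightarrow> finite S \<and> (\<forall>\<beta>\<in>S. c \<beta> \<noteq> 0) \<and> (\<forall>x. p x = mpoly_eval S c (\<lambda>i. x $ i))"

text \<open>Sums and products first yield a list of monomials with repetitions; equal exponents are
  merged here and those that cancel are dropped.\<close>

lemma mpoly_repr_collect:
  fixes p :: "real^'n \<Rightarrow> real"
  assumes J: "finite J" and p: "\<And>x. p x = (\<Sum>j\<in>J. a j * (\<Prod>i\<in>UNIV. (x $ i) ^ e j i))"
  shows "\<exists>S c. mpoly_repr p S c"
proof -
  define c where "c \<beta> = (\<Sum>j | j \<in> J \<and> e j = \<beta>. a j)" for \<beta>
  define S where "S = {\<beta> \<in> e ` J. c \<beta> \<noteq> 0}"
  have "p x = mpoly_eval S c (\<lambda>i. x $ i)" for x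
  proof -
    have "p x = (\<Sum>\<beta>\<in>e ` J. \<Sum>j | j \<in> J \<and> e j = \<beta>. a j * (\<Prod>i\<in>UNIV. (x $ i) ^ e j i))"
      unfolding p using J by (rule sum.image_gen)
    also have "\<dots> = (\<Sum>\<beta>\<in>e ` J. c \<beta> * (\<Prod>i\<in>UNIV. (x $ i) ^ \<beta> i))"
      unfolding c_def sum_distrib_right by (intro sum.cong) auto
    also have "\<dots> = (\<Sum>\<beta>\<in>S. c \<beta> * (\<Prod>i\<in>UNIV. (x $ i) ^ \<beta> i))"
      unfolding S_def using J by (intro sum.mono_neutral_right) auto
    finally show ?thesis by (simp add: mpoly_eval_def)
  qed
  then have "mpoly_repr p S c" using J by (auto simp: mpoly_repr_def S_def)
  then show ?thesis by blast
qed

lemma real_polynomial_function_repr: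
  fixes p :: "real^'n \<Rightarrow> real"
  assumes "real_polynomial_function p"
  shows "\<exists>S c. mpoly_repr p S c"
  using assms
proof (induction rule: real_polynomial_function.induct)
  case (linear f)
  have "f x = (\<Sum>j\<in>UNIV. f (axis j 1) * (\<Prod>i\<in>UNIV. (x $ i) ^ (if i = j then 1 else 0)))" for x
  proof -
    have "f x = f (\<Sum>j\<in>UNIV. (x $ j) *s axis j 1)" by (simp add: basis_expansion)
    also have "\<dots> = (\<Sum>j\<in>UNIV. f ((x $ j) *\<^sub>R axis j 1))"
      using linear by (simp add: linear_sum bounded_linear.linear scalar_mult_eq_scaleR)
    also have "\<dots> = (\<Sum>j\<in>UNIV. f (axis j 1) * x $ j)"
      using linear by (simp add: linear_cmul bounded_linear.linear mult.commute)
    also have "\<dots> = (\<Sum>j\<in>UNIV. f (axis j 1) * (\<Prod>i\<in>UNIV. (x $ i) ^ (if i = j then 1 else 0)))"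
      by (simp add: if_distrib[of "\<lambda>n. _ ^ n"] cong: if_cong)
    finally show ?thesis .
  qed
  then show ?case by (rule mpoly_repr_collect[OF finite])
next
  case (const k)
  show ?case by (rule mpoly_repr_collect[of "{()}" _ "\<lambda>_. k" "\<lambda>_ _. 0"]) auto
next
  case (add f g)
  then obtain S c T d where "mpoly_repr f S c" "mpoly_repr g T d" by blast
  then show ?case
    by (intro mpoly_repr_collect[of "S <+> T" _ "case_sum c d" "case_sum (\<lambda>\<beta>. \<beta>) (\<lambda>\<beta>. \<beta>)"])
      (auto simp: mpoly_repr_def mpoly_eval_def sum.Plus)
next
  case (mult f g)
  then obtain S c T d where "mpoly_repr f S c" "mpoly_repr g T d" by blast
  then show ?case
    by (intro mpoly_repr_collect[of "S \<times> T" _ "\<lambda>(\<beta>, \<gamma>). c \<beta> * d \<gamma>" "\<lambda>(\<beta>, \<gamma>) i. \<beta> i + \<gamma> i"])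
      (auto simp: mpoly_repr_def mpoly_eval_def sum_product sum.cartesian_product case_prod_unfold
        power_add prod.distrib mult_ac intro!: sum.cong)
qed

text \<open>The closed form of the derivative of order \<alpha>: the factorial times the binomial
  coefficient is the falling factorial produced by differentiating a power.\<close>

definition mpoly_deriv ::
  "('n::finite \<Rightarrow> nat) set \<Rightarrow> (('n \<Rightarrow> nat) \<Rightarrow> real) \<Rightarrow> ('n \<Rightarrow> nat) \<Rightarrow> real^'n \<Rightarrow> real" where
  "mpoly_deriv S c \<alpha> x = (\<Sum>\<beta>\<in>S. c \<beta> *
     (\<Prod>i\<in>UNIV. real (fact (\<alpha> i) * (\<beta> i choose \<alpha> i)) * (x $ i) ^ (\<beta> i - \<alpha> i)))"

lemma fact_binomial_Suc: "real (fact (Suc a) * (b choose Suc a)) = real (fact a * (b choose a)) * real (b - a)"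
proof -
  have "Suc a * (b choose Suc a) = (b - a) * (b choose a)"
    by (simp only: binomial_absorption binomial_absorb_comp)
  then have "fact (Suc a) * (b choose Suc a) = fact a * (b choose a) * (b - a)"
    by (simp only: fact_Suc of_nat_id mult_ac)
  then show ?thesis by (metis of_nat_mult)
qed

lemma partial_deriv_mpoly_deriv:
  "partial_deriv k (mpoly_deriv S c \<alpha>) = mpoly_deriv S c (\<alpha>(k := Suc (\<alpha> k)))"
proof
  fix x :: "real^'a"
  define r where "r \<beta> i = real (fact (\<alpha> i) * (\<beta> i choose \<alpha> i)) * (x $ i) ^ (\<beta> i - \<alpha> i)" for \<beta> i
  define R where "R \<beta> = prod (r \<beta>) (UNIV - {k})" for \<beta>
  define q where "q \<beta> = real (fact (\<alpha> k) * (\<beta> k choose \<alpha> k))" for \<beta>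
  have "mpoly_deriv S c \<alpha> (x + h *\<^sub>R axis k 1) = (\<Sum>\<beta>\<in>S. c \<beta> * (q \<beta> * (x $ k + h) ^ (\<beta> k - \<alpha> k) * R \<beta>))" for h
    unfolding mpoly_deriv_def
  proof (intro sum.cong refl arg_cong2[of _ _ _ _ "(*)"])
    fix \<beta>
    have "(\<Prod>i\<in>UNIV - {k}. real (fact (\<alpha> i) * (\<beta> i choose \<alpha> i)) * ((x + h *\<^sub>R axis k 1) $ i) ^ (\<beta> i - \<alpha> i)) = R \<beta>"
      unfolding R_def r_def by (intro prod.cong) (auto simp: axis_def)
    then show "(\<Prod>i\<in>UNIV. real (fact (\<alpha> i) * (\<beta> i choose \<alpha> i)) * ((x + h *\<^sub>R axis k 1) $ i) ^ (\<beta> i - \<alpha> i)) =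
        q \<beta> * (x $ k + h) ^ (\<beta> k - \<alpha> k) * R \<beta>"
      by (subst prod.remove[of UNIV k]) (auto simp: q_def axis_def)
  qed
  moreover have "((\<lambda>h. \<Sum>\<beta>\<in>S. c \<beta> * (q \<beta> * (x $ k + h) ^ (\<beta> k - \<alpha> k) * R \<beta>)) has_field_derivative
      (\<Sum>\<beta>\<in>S. c \<beta> * (q \<beta> * (real (\<beta> k - \<alpha> k) * (x $ k) ^ (\<beta> k - \<alpha> k - 1)) * R \<beta>))) (at 0)"
    by (intro derivative_eq_intros) (auto intro!: derivative_eq_intros)
  ultimately have "partial_deriv k (mpoly_deriv S c \<alpha>) x =
      (\<Sum>\<beta>\<in>S. c \<beta> * (q \<beta> * (real (\<beta> k - \<alpha> k) * (x $ k) ^ (\<beta> k - \<alpha> k - 1)) * R \<beta>))"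
    unfolding partial_deriv_def by (simp add: DERIV_imp_deriv)
  also have "\<dots> = mpoly_deriv S c (\<alpha>(k := Suc (\<alpha> k))) x"
    unfolding mpoly_deriv_def
  proof (intro sum.cong refl arg_cong2[of _ _ _ _ "(*)"])
    fix \<beta>
    have pred: "\<beta> k - \<alpha> k - 1 = \<beta> k - Suc (\<alpha> k)" by simp
    have "(\<Prod>i\<in>UNIV - {k}. real (fact ((\<alpha>(k := Suc (\<alpha> k))) i) * (\<beta> i choose (\<alpha>(k := Suc (\<alpha> k))) i)) *
        (x $ i) ^ (\<beta> i - (\<alpha>(k := Suc (\<alpha> k))) i)) = R \<beta>"
      unfolding R_def r_def by (intro prod.cong) auto
    then show "q \<beta> * (real (\<beta> k - \<alpha> k) * (x $ k) ^ (\<beta> k - \<alpha> k - 1)) * R \<beta> =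
      (\<Prod>i\<in>UNIV. real (fact ((\<alpha>(k := Suc (\<alpha> k))) i) * (\<beta> i choose (\<alpha>(k := Suc (\<alpha> k))) i)) *
        (x $ i) ^ (\<beta> i - (\<alpha>(k := Suc (\<alpha> k))) i))"
      by (subst prod.remove[of UNIV k])
        (simp_all only: finite UNIV_I fun_upd_same fact_binomial_Suc q_def pred mult.assoc)
  qed
  finally show "partial_deriv k (mpoly_deriv S c \<alpha>) x = mpoly_deriv S c (\<alpha>(k := Suc (\<alpha> k))) x" .
qed

lemma partial_deriv_funpow_mpoly_deriv:
  "(partial_deriv k ^^ m) (mpoly_deriv S c \<alpha>) = mpoly_deriv S c (\<alpha>(k := \<alpha> k + m))"
proof (induction m)
  case (Suc m)
  show ?case
    by (simp only: funpow.simps comp_apply Suc.IH partial_deriv_mpoly_deriv fun_upd_same fun_upd_upd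
        add_Suc_right)
qed simp

lemma multi_deriv_mpoly:
  fixes P :: "(real, 'n::{finite,linorder}) vec \<Rightarrow> real"
  assumes "mpoly_repr P S c"
  shows "multi_deriv \<alpha> P x = (\<Prod>i\<in>UNIV. fact (\<alpha> i)) * mpoly_taylor S c \<alpha> (\<lambda>i. x $ i)"
proof -
  have P: "P = mpoly_deriv S c (\<lambda>_. 0)"
    using assms by (auto simp: mpoly_repr_def mpoly_eval_def mpoly_deriv_def)
  have "foldr (\<lambda>i. partial_deriv i ^^ \<alpha> i) L P = mpoly_deriv S c (\<lambda>i. if i \<in> set L then \<alpha> i else 0)"
    if "distinct L" for L
    using that
  proof (induction L)
    case (Cons k L)
    have "(\<lambda>i. if i \<in> set L then \<alpha> i else 0)(k := 0 + \<alpha> k) = (\<lambda>i. if i \<in> set (k # L) then \<alpha> i else 0)"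
      by auto
    then show ?case using Cons by (simp add: partial_deriv_funpow_mpoly_deriv)
  qed (simp add: P)
  then have "multi_deriv \<alpha> P x = mpoly_deriv S c \<alpha> x" by (simp add: multi_deriv_def)
  also have "\<dots> = (\<Prod>i\<in>UNIV. fact (\<alpha> i)) * mpoly_taylor S c \<alpha> (\<lambda>i. x $ i)"
    by (simp add: mpoly_deriv_def mpoly_taylor_def sum_distrib_left prod.distrib mult_ac)
  finally show ?thesis .
qed

section \<open>Taylor expansion at real points and the consequences of HDF\<close>

lemma mpoly_eval_taylor:
  fixes z :: "'n::finite \<Rightarrow> complex"
  assumes "finite S"
  shows "mpoly_eval S c (\<lambda>i. of_real (x i) + z i) =
    (\<Sum>\<alpha> | \<exists>\<beta>\<in>S. \<alpha> \<le> \<beta>. of_real (mpoly_taylor S c \<alpha> x) * (\<Prod>i\<in>UNIV. z i ^ \<alpha> i))"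
proof -
  define A where "A = {\<alpha>. \<exists>\<beta>\<in>S. \<alpha> \<le> \<beta>}"
  have le: "{\<alpha>. \<alpha> \<le> \<beta>} = PiE UNIV (\<lambda>i. {..\<beta> i})" for \<beta> :: "'n \<Rightarrow> nat"
    by (auto simp: le_fun_def PiE_UNIV_domain)
  have "A = (\<Union>\<beta>\<in>S. {\<alpha>. \<alpha> \<le> \<beta>})" by (auto simp: A_def)
  then have finA: "finite A" using assms by (auto simp: le intro!: finite_PiE)
  have "(\<Prod>i\<in>UNIV. (of_real (x i) + z i) ^ \<beta> i) =
      (\<Sum>\<alpha>\<in>A. of_real (\<Prod>i\<in>UNIV. real (\<beta> i choose \<alpha> i) * x i ^ (\<beta> i - \<alpha> i)) * (\<Prod>i\<in>UNIV. z i ^ \<alpha> i))"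
    if "\<beta> \<in> S" for \<beta>
  proof -
    have "(\<Prod>i\<in>UNIV. (of_real (x i) + z i) ^ \<beta> i) =
        (\<Prod>i\<in>UNIV. \<Sum>k\<le>\<beta> i. of_nat (\<beta> i choose k) * z i ^ k * of_real (x i) ^ (\<beta> i - k))"
      by (subst add.commute) (simp add: binomial_ring)
    also have "\<dots> = (\<Sum>\<alpha>\<in>{\<alpha>. \<alpha> \<le> \<beta>}. \<Prod>i\<in>UNIV. of_nat (\<beta> i choose \<alpha> i) * z i ^ \<alpha> i * of_real (x i) ^ (\<beta> i - \<alpha> i))"
      unfolding le by (rule prod_sum_PiE) auto
    also have "\<dots> = (\<Sum>\<alpha>\<in>A. \<Prod>i\<in>UNIV. of_nat (\<beta> i choose \<alpha> i) * z i ^ \<alpha> i * of_real (x i) ^ (\<beta> i - \<alpha> i))"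
    proof (rule sum.mono_neutral_left[OF finA])
      show "{\<alpha>. \<alpha> \<le> \<beta>} \<subseteq> A" using that by (auto simp: A_def)
      show "\<forall>\<alpha>\<in>A - {\<alpha>. \<alpha> \<le> \<beta>}.
          (\<Prod>i\<in>UNIV. of_nat (\<beta> i choose \<alpha> i) * z i ^ \<alpha> i * of_real (x i) ^ (\<beta> i - \<alpha> i)) = 0"
        by (auto simp: le_fun_def not_le intro!: prod_zero)
    qed
    finally show ?thesis by (simp add: prod.distrib mult_ac)
  qed
  then have "mpoly_eval S c (\<lambda>i. of_real (x i) + z i) = (\<Sum>\<beta>\<in>S. \<Sum>\<alpha>\<in>A. of_real (c \<beta>) *
      (of_real (\<Prod>i\<in>UNIV. real (\<beta> i choose \<alpha> i) * x i ^ (\<beta> i - \<alpha> i)) * (\<Prod>i\<in>UNIV. z i ^ \<alpha> i)))"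
    unfolding mpoly_eval_def by (simp add: sum_distrib_left)
  also have "\<dots> = (\<Sum>\<alpha>\<in>A. of_real (mpoly_taylor S c \<alpha> x) * (\<Prod>i\<in>UNIV. z i ^ \<alpha> i))"
    unfolding mpoly_taylor_def by (subst sum.swap) (simp add: sum_distrib_left mult_ac)
  finally show ?thesis by (simp add: A_def)
qed

text \<open>HDF allows a different constant for each \<alpha> and n. Only the finitely many \<alpha>
  below some exponent of P matter in the expansion, so one constant serves all; passing from
  derivatives to Taylor coefficients only divides by factorials.\<close>

lemma HDF_taylor_bound:
  fixes P :: "(real, 'n::{finite,linorder}) vec \<Rightarrow> real"
  assumes P: "mpoly_repr P S c" and HDF: "HDF P"
  shows "\<exists>\<epsilon>>0. \<exists>C>0. \<forall>\<alpha> n x. (\<exists>\<beta>\<in>S. \<alpha> \<le> \<beta>) \<longrightarrow> \<alpha> n \<ge> 1 \<longrightarrow> x \<in> Jset \<longrightarrow>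
    \<bar>mpoly_taylor S c \<alpha> (\<lambda>i. x $ i)\<bar> \<le> C * (x $ n) powr (- \<epsilon>) * P x"
proof -
  obtain \<epsilon> where \<epsilon>: "\<epsilon> > 0" and "\<And>\<alpha> n. \<alpha> n \<ge> 1 \<Longrightarrow>
        \<exists>C>0. \<forall>x\<in>Jset. \<bar>multi_deriv \<alpha> P x / P x\<bar> \<le> C * (x $ n) powr (- \<epsilon>)"
    using HDF unfolding HDF_def by blast
  then have "\<forall>\<alpha> n. \<exists>C. \<alpha> n \<ge> 1 \<longrightarrow> C > 0 \<and>
      (\<forall>x\<in>Jset. \<bar>multi_deriv \<alpha> P x / P x\<bar> \<le> C * (x $ n) powr (- \<epsilon>))" by blast
  then obtain C where C: "\<And>\<alpha> n. \<alpha> n \<ge> 1 \<Longrightarrow> C \<alpha> n > 0 \<and>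
      (\<forall>x\<in>Jset. \<bar>multi_deriv \<alpha> P x / P x\<bar> \<le> C \<alpha> n * (x $ n) powr (- \<epsilon>))" by metis
  define A where "A = {(\<alpha>, n). (\<exists>\<beta>\<in>S. \<alpha> \<le> \<beta>) \<and> \<alpha> n \<ge> 1}"
  have "finite A"
  proof (rule finite_subset)
    show "A \<subseteq> (\<Union>\<beta>\<in>S. PiE UNIV (\<lambda>i. {..\<beta> i})) \<times> UNIV"
      by (auto simp: A_def le_fun_def PiE_UNIV_domain)
    show "finite ((\<Union>\<beta>\<in>S. PiE UNIV (\<lambda>i. {..\<beta> i})) \<times> (UNIV :: 'n set))"
      using P by (intro finite_cartesian_product finite_UN_I finite_PiE) (auto simp: mpoly_repr_def)
  qed
  define B where "B = (\<Sum>(\<alpha>, n)\<in>A. C \<alpha> n) + 1"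
  have pos: "C \<alpha> n > 0" if "(\<alpha>, n) \<in> A" for \<alpha> n using C[of \<alpha> n] that by (auto simp: A_def)
  have le: "C \<alpha> n \<le> B" if "(\<alpha>, n) \<in> A" for \<alpha> n
    using member_le_sum[OF that, of "\<lambda>(\<alpha>, n). C \<alpha> n"] \<open>finite A\<close> pos unfolding B_def
    by (force intro: less_imp_le)
  have "B > 0" unfolding B_def using pos
    by (intro add_nonneg_pos sum_nonneg) (auto intro: less_imp_le)
  moreover have "\<bar>mpoly_taylor S c \<alpha> (\<lambda>i. x $ i)\<bar> \<le> B * (x $ n) powr (- \<epsilon>) * P x"
    if \<alpha>: "\<exists>\<beta>\<in>S. \<alpha> \<le> \<beta>" "\<alpha> n \<ge> 1" and x: "x \<in> Jset" for \<alpha> n x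
  proof -
    have Px: "P x > 0" using HDF x by (auto simp: HDF_def)
    have "\<bar>multi_deriv \<alpha> P x / P x\<bar> \<le> C \<alpha> n * (x $ n) powr (- \<epsilon>)" using C[of \<alpha> n] \<alpha> x by auto
    also have "\<dots> \<le> B * (x $ n) powr (- \<epsilon>)" using le[of \<alpha> n] \<alpha> by (intro mult_right_mono) (auto simp: A_def)
    finally have "\<bar>multi_deriv \<alpha> P x\<bar> \<le> B * (x $ n) powr (- \<epsilon>) * P x"
      using Px by (simp add: abs_divide field_simps)
    moreover have "\<bar>mpoly_taylor S c \<alpha> (\<lambda>i. x $ i)\<bar> \<le> \<bar>multi_deriv \<alpha> P x\<bar>"
    proof -
      have "(\<Prod>i\<in>UNIV. fact (\<alpha> i) :: real) \<ge> 1" by (intro prod_ge_1) auto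
      then have "1 * \<bar>mpoly_taylor S c \<alpha> (\<lambda>i. x $ i)\<bar> \<le>
          \<bar>\<Prod>i\<in>UNIV. fact (\<alpha> i) :: real\<bar> * \<bar>mpoly_taylor S c \<alpha> (\<lambda>i. x $ i)\<bar>"
        by (intro mult_right_mono) auto
      then show ?thesis unfolding multi_deriv_mpoly[OF P] abs_mult by simp
    qed
    ultimately show ?thesis by linarith
  qed
  ultimately show ?thesis using \<epsilon> by blast
qed

text \<open>A derivative of maximal order is a non-zero constant, so the decay of its quotient by P
  forces P to grow.\<close>

lemma HDF_growth:
  fixes P :: "(real, 'n::{finite,linorder}) vec \<Rightarrow> real"
  assumes P: "mpoly_repr P S c" and HDF: "HDF P"
  shows "\<exists>\<epsilon>>0. \<exists>\<kappa>>0. (\<forall>x\<in>Jset. \<kappa> \<le> P x) \<and>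
    (\<forall>n x. (\<exists>\<beta>\<in>S. \<beta> n \<ge> 1) \<longrightarrow> x \<in> Jset \<longrightarrow> \<kappa> * (x $ n) powr \<epsilon> \<le> P x)"
proof -
  obtain \<epsilon> C where \<epsilon>: "\<epsilon> > 0" and C: "C > 0" and bd: "\<And>\<alpha> n x. (\<exists>\<beta>\<in>S. \<alpha> \<le> \<beta>) \<Longrightarrow> \<alpha> n \<ge> 1 \<Longrightarrow> x \<in> Jset \<Longrightarrow>
    \<bar>mpoly_taylor S c \<alpha> (\<lambda>i. x $ i)\<bar> \<le> C * (x $ n) powr (- \<epsilon>) * P x"
    using HDF_taylor_bound[OF P HDF] by metis
  have fin: "finite S" and c0: "\<And>\<beta>. \<beta> \<in> S \<Longrightarrow> c \<beta> \<noteq> 0" and Peq: "\<And>x. P x = mpoly_eval S c (\<lambda>i. x $ i)"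
    using P by (auto simp: mpoly_repr_def)
  have dep: "\<exists>\<kappa>>0. \<forall>x\<in>Jset. \<kappa> * (x $ n) powr \<epsilon> \<le> P x" if n: "\<exists>\<beta>\<in>S. \<beta> n \<ge> 1" for n
  proof -
    obtain \<beta>0 where \<beta>0: "\<beta>0 \<in> S" "\<beta>0 n \<ge> 1" using n by blast
    \<comment> \<open>Maximality makes the contributions of all other exponents vanish, so the
      Taylor coefficient at \<alpha> is the constant c \<alpha>. Choosing \<alpha> above
      \<open>\<beta>0\<close> keeps \<alpha> n \<ge> 1, as the decay in the variable n
      requires.\<close>
    obtain \<alpha> where \<alpha>: "\<alpha> \<in> S" "\<beta>0 \<le> \<alpha>" "\<And>\<beta>. \<beta> \<in> S \<Longrightarrow> \<alpha> \<le> \<beta> \<Longrightarrow> \<beta> = \<alpha>"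
      using finite_has_maximal2[OF fin \<beta>0(1)] by metis
    have \<alpha>n: "\<alpha> n \<ge> 1" using \<beta>0(2) \<alpha>(2) by (auto simp: le_fun_def intro: order_trans)
    have t: "mpoly_taylor S c \<alpha> x = c \<alpha>" for x
    proof -
      have "mpoly_taylor S c \<alpha> x = (\<Sum>\<beta>\<in>S. if \<beta> = \<alpha> then c \<alpha> else 0)"
        unfolding mpoly_taylor_def
      proof (intro sum.cong refl)
        fix \<beta> assume \<beta>: "\<beta> \<in> S"
        show "c \<beta> * (\<Prod>i\<in>UNIV. real (\<beta> i choose \<alpha> i) * x i ^ (\<beta> i - \<alpha> i)) = (if \<beta> = \<alpha> then c \<alpha> else 0)"
        proof (cases "\<beta> = \<alpha>")
          case False
          then obtain i where "\<beta> i < \<alpha> i" using \<alpha>(3)[OF \<beta>] by (metis le_fun_def not_le)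
          then have "(\<Prod>i\<in>UNIV. real (\<beta> i choose \<alpha> i) * x i ^ (\<beta> i - \<alpha> i)) = 0"
            by (intro prod_zero) (auto intro!: exI[of _ i])
          then show ?thesis using False by simp
        qed auto
      qed
      then show ?thesis using fin \<alpha>(1) by simp
    qed
    have "\<bar>c \<alpha>\<bar> / C * (x $ n) powr \<epsilon> \<le> P x" if x: "x \<in> Jset" for x
    proof -
      have xn: "x $ n > 0" using x by (auto simp: Jset_def intro: less_le_trans[of 0 1])
      have "\<bar>c \<alpha>\<bar> \<le> C * (x $ n) powr (- \<epsilon>) * P x"
        using bd[of \<alpha> n x] \<alpha>(1) \<alpha>n x unfolding t by blast
      then show ?thesis using C xn by (simp add: powr_minus field_simps)
    qed
    then show ?thesis using C c0[OF \<alpha>(1)] by (intro exI[of _ "\<bar>c \<alpha>\<bar> / C"]) auto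
  qed
  have "\<exists>\<kappa>>0. \<forall>x\<in>Jset. \<kappa> \<le> P x"
  \<comment> \<open>If P depends on some variable, its growth in that variable gives the lower
    bound; otherwise P is a constant, equal to its positive value at (1, ..., 1).\<close>
  proof (cases "\<exists>n. \<exists>\<beta>\<in>S. \<beta> n \<ge> 1")
    case True
    then obtain n \<kappa> where \<kappa>: "\<kappa> > 0" "\<And>x. x \<in> Jset \<Longrightarrow> \<kappa> * (x $ n) powr \<epsilon> \<le> P x" using dep by blast
    have "\<kappa> \<le> P x" if x: "x \<in> Jset" for x
    proof -
      have "1 \<le> (x $ n) powr \<epsilon>" using x \<epsilon> by (auto simp: Jset_def intro: ge_one_powr_ge_zero)
      then have "\<kappa> * 1 \<le> \<kappa> * (x $ n) powr \<epsilon>" using \<kappa>(1) by (intro mult_left_mono) auto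
      then show ?thesis using \<kappa>(2)[OF x] by linarith
    qed
    then show ?thesis using \<kappa>(1) by blast
  next
    case False
    then have z: "\<beta> i = 0" if "\<beta> \<in> S" for \<beta> i using that by (metis not_less_eq_eq One_nat_def le_zero_eq)
    have "(x $ i) ^ \<beta> i = ((\<chi> i. 1) $ i) ^ \<beta> i" if "\<beta> \<in> S" for \<beta> i and x :: "(real, 'n) vec"
      using z[OF that, of i] by simp
    then have "P x = P (\<chi> i. 1)" for x
      unfolding Peq mpoly_eval_def by (intro sum.cong refl arg_cong2[of _ _ _ _ "(*)"] prod.cong) blast
    moreover have "P (\<chi> i. 1) > 0" using HDF by (auto simp: HDF_def Jset_def)
    ultimately show ?thesis by (metis order_refl)
  qed
  then obtain \<kappa>0 where \<kappa>0: "\<kappa>0 > 0" "\<And>x. x \<in> Jset \<Longrightarrow> \<kappa>0 \<le> P x" by blast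
  have "\<forall>n. \<exists>\<kappa>>0. (\<exists>\<beta>\<in>S. \<beta> n \<ge> 1) \<longrightarrow> (\<forall>x\<in>Jset. \<kappa> * (x $ n) powr \<epsilon> \<le> P x)"
    using dep zero_less_one by blast
  then obtain \<kappa> where \<kappa>: "\<And>n. \<kappa> n > 0" "\<And>n x. \<exists>\<beta>\<in>S. \<beta> n \<ge> 1 \<Longrightarrow> x \<in> Jset \<Longrightarrow> \<kappa> n * (x $ n) powr \<epsilon> \<le> P x"
    by metis
  define k where "k = min \<kappa>0 (Min (range \<kappa>))"
  have k: "k > 0" "k \<le> \<kappa>0" "k \<le> \<kappa> n" for n using \<kappa>(1) \<kappa>0(1) by (auto simp: k_def min_le_iff_disj)
  have "k \<le> P x" if "x \<in> Jset" for x using k(2) \<kappa>0(2)[OF that] by linarith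
  moreover have "k * (x $ n) powr \<epsilon> \<le> P x" if "\<exists>\<beta>\<in>S. \<beta> n \<ge> 1" "x \<in> Jset" for n x
    using mult_right_mono[OF k(3)[of n], of "(x $ n) powr \<epsilon>"] \<kappa>(2)[OF that] by simp
  ultimately show ?thesis using \<epsilon> k(1) by blast
qed

text \<open>In the term of exponent \<alpha>, HDF is used for the largest coordinate y of x among
  those with \<alpha> i \<ge> 1. The increments contribute at most \<eta> y^\<epsilon>, which the
  decay y^(-\<epsilon>) of the coefficient relative to P cancels, leaving a small multiple of P
  x.\<close>

lemma HDF_complex_nbhd:
  fixes P :: "(real, 'n::{finite,linorder}) vec \<Rightarrow> real"
  assumes P: "mpoly_repr P S c" and HDF: "HDF P"
  shows "\<exists>\<eta>>0. \<exists>\<epsilon>>0. \<forall>x (z :: 'n \<Rightarrow> complex). x \<in> Jset \<longrightarrow> (\<forall>i. norm (z i) \<le> \<eta> * (x $ i) powr \<epsilon>) \<longrightarrow>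
    norm (mpoly_eval S c (\<lambda>i. of_real (x $ i) + z i) - of_real (P x)) \<le> P x / 2"
proof -
  obtain \<epsilon> C where \<epsilon>: "\<epsilon> > 0" and C: "C > 0" and bd: "\<And>\<alpha> n x. (\<exists>\<beta>\<in>S. \<alpha> \<le> \<beta>) \<Longrightarrow> \<alpha> n \<ge> 1 \<Longrightarrow> x \<in> Jset \<Longrightarrow>
    \<bar>mpoly_taylor S c \<alpha> (\<lambda>i. x $ i)\<bar> \<le> C * (x $ n) powr (- \<epsilon>) * P x"
    using HDF_taylor_bound[OF P HDF] by metis
  have fin: "finite S" and Peq: "\<And>x. P x = mpoly_eval S c (\<lambda>i. x $ i)"
    using P by (auto simp: mpoly_repr_def)
  define A where "A = {\<alpha>. \<exists>\<beta>\<in>S. \<alpha> \<le> \<beta>}"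
  have finA: "finite A"
  proof (rule finite_subset)
    show "A \<subseteq> (\<Union>\<beta>\<in>S. PiE UNIV (\<lambda>i. {..\<beta> i}))" by (auto simp: A_def le_fun_def PiE_UNIV_domain)
    show "finite (\<Union>\<beta>\<in>S. PiE UNIV (\<lambda>i. {..\<beta> i}))" using fin by (auto intro!: finite_PiE)
  qed
  \<comment> \<open>A bound for the total degree of every \<alpha> in A, made positive by the added
    1. Dividing \<epsilon> by it below turns a product of up to d increments into a single power
    y^\<epsilon>.\<close>
  define d where "d = (\<Sum>\<alpha>\<in>A. \<Sum>i\<in>UNIV. \<alpha> i) + 1"
  have d: "(\<Sum>i\<in>UNIV. \<alpha> i) \<le> d" if "\<alpha> \<in> A" for \<alpha>
    using member_le_sum[OF that, of "\<lambda>\<alpha>. \<Sum>i\<in>UNIV. \<alpha> i"] finA by (simp add: d_def)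
  \<comment> \<open>At most card A terms, each at most C \<eta> P x, have to add up to at most P x /
    2.\<close>
  define \<eta> where "\<eta> = min 1 (1 / (2 * C * (card A + 1)))"
  have \<eta>: "0 < \<eta>" "\<eta> \<le> 1" "C * \<eta> * (card A + 1) \<le> 1 / 2"
  proof -
    show "0 < \<eta>" "\<eta> \<le> 1" using C by (auto simp: \<eta>_def)
    have "C * \<eta> * (card A + 1) \<le> C * (1 / (2 * C * (card A + 1))) * (card A + 1)"
      using C by (intro mult_right_mono mult_left_mono) (auto simp: \<eta>_def)
    also have "\<dots> = 1 / 2" using C by (simp add: divide_simps)
    finally show "C * \<eta> * (card A + 1) \<le> 1 / 2" .
  qed
  define e where "e = \<epsilon> / d"
  have e: "e > 0" "e * d = \<epsilon>" proof -
    have "d > 0" by (simp add: d_def)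
    then show "e > 0" "e * d = \<epsilon>" using \<epsilon> by (auto simp: e_def)
  qed
  show ?thesis
  proof (rule exI[of _ \<eta>], rule conjI[OF \<eta>(1)], rule exI[of _ e], rule conjI[OF e(1)],
      intro allI impI)
    fix x :: "(real, 'n) vec" and z :: "'n \<Rightarrow> complex"
    assume x: "x \<in> Jset" and z: "\<forall>i. norm (z i) \<le> \<eta> * (x $ i) powr e"
    have x1: "x $ i \<ge> 1" for i using x by (auto simp: Jset_def)
    have Px: "P x > 0" using HDF x by (auto simp: HDF_def)
    have summand: "norm (of_real (mpoly_taylor S c \<alpha> (\<lambda>i. x $ i)) * (\<Prod>i\<in>UNIV. z i ^ \<alpha> i)) \<le> C * \<eta> * P x"
      if \<alpha>: "\<alpha> \<in> A" "\<alpha> \<noteq> (\<lambda>_. 0)" for \<alpha>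
    proof -
      define T where "T = {i. \<alpha> i \<ge> 1}"
      have T: "T \<noteq> {}" "finite T" using \<alpha>(2) by (auto simp: T_def fun_eq_iff Suc_le_eq)
      then have "finite ((\<lambda>i. x $ i) ` T)" "(\<lambda>i. x $ i) ` T \<noteq> {}" by auto
      from Max_in[OF this] obtain n where n: "n \<in> T" "x $ n = Max ((\<lambda>i. x $ i) ` T)" by auto
      then have xmax: "x $ i \<le> x $ n" if "i \<in> T" for i using that T by simp
      define y where "y = x $ n"
      have y: "y \<ge> 1" using x1 by (simp add: y_def)
      have "norm (\<Prod>i\<in>UNIV. z i ^ \<alpha> i) = (\<Prod>i\<in>UNIV. norm (z i) ^ \<alpha> i)"
        by (simp add: prod_norm[symmetric] norm_power)
      also have "\<dots> \<le> (\<Prod>i\<in>UNIV. (\<eta> * y powr e) ^ \<alpha> i)"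
      proof (intro prod_mono conjI)
        fix i
        show "norm (z i) ^ \<alpha> i \<le> (\<eta> * y powr e) ^ \<alpha> i"
        proof (cases "i \<in> T")
          case True
          have "norm (z i) \<le> \<eta> * (x $ i) powr e" using z by blast
          also have "\<dots> \<le> \<eta> * y powr e"
            using xmax[OF True] x1[of i] e \<eta> by (intro mult_left_mono powr_mono2) (auto simp: y_def)
          finally show ?thesis by (intro power_mono) auto
        next
          case False
          then have "\<alpha> i = 0" by (simp add: T_def)
          then show ?thesis by simp
        qed
      qed auto
      also have "\<dots> = \<eta> ^ (\<Sum>i\<in>UNIV. \<alpha> i) * (y powr e) ^ (\<Sum>i\<in>UNIV. \<alpha> i)"
        by (simp add: power_sum power_mult_distrib prod.distrib)
      also have "\<dots> \<le> \<eta> * y powr \<epsilon>"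
      proof (intro mult_mono)
        have "1 \<le> (\<Sum>i\<in>UNIV. \<alpha> i)"
          using member_le_sum[of n UNIV \<alpha>] n(1) by (auto simp: T_def)
        then show "\<eta> ^ (\<Sum>i\<in>UNIV. \<alpha> i) \<le> \<eta>" using power_decreasing[of 1 _ \<eta>] \<eta> by auto
        have "(y powr e) ^ (\<Sum>i\<in>UNIV. \<alpha> i) \<le> (y powr e) ^ d"
          using d[OF \<alpha>(1)] y e by (intro power_increasing) (auto intro: ge_one_powr_ge_zero)
        also have "\<dots> = y powr \<epsilon>"
          using y e powr_realpow[of "y powr e" d] by (simp add: powr_powr)
        finally show "(y powr e) ^ (\<Sum>i\<in>UNIV. \<alpha> i) \<le> y powr \<epsilon>" .
      qed (use \<eta> in auto)
      finally have 1: "norm (\<Prod>i\<in>UNIV. z i ^ \<alpha> i) \<le> \<eta> * y powr \<epsilon>" .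
      have 2: "\<bar>mpoly_taylor S c \<alpha> (\<lambda>i. x $ i)\<bar> \<le> C * y powr (- \<epsilon>) * P x"
        unfolding y_def using \<alpha>(1) n(1) x by (intro bd) (auto simp: A_def T_def)
      have "norm (of_real (mpoly_taylor S c \<alpha> (\<lambda>i. x $ i)) * (\<Prod>i\<in>UNIV. z i ^ \<alpha> i)) \<le>
          (C * y powr (- \<epsilon>) * P x) * (\<eta> * y powr \<epsilon>)"
        unfolding norm_mult norm_of_real using 1 2 C Px by (intro mult_mono) auto
      also have "\<dots> = C * \<eta> * P x" using y by (simp add: powr_minus)
      finally show ?thesis .
    qed
    have zero: "mpoly_taylor S c (\<lambda>_. 0) (\<lambda>i. x $ i) = P x"
      by (simp add: mpoly_taylor_def Peq mpoly_eval_def)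
    show "norm (mpoly_eval S c (\<lambda>i. of_real (x $ i) + z i) - of_real (P x)) \<le> P x / 2"
    proof (cases "(\<lambda>_. 0) \<in> A")
      case True
      have "mpoly_eval S c (\<lambda>i. of_real (x $ i) + z i) - of_real (P x) =
          (\<Sum>\<alpha>\<in>A - {\<lambda>_. 0}. of_real (mpoly_taylor S c \<alpha> (\<lambda>i. x $ i)) * (\<Prod>i\<in>UNIV. z i ^ \<alpha> i))"
        unfolding mpoly_eval_taylor[OF fin] A_def[symmetric] sum.remove[OF finA True] zero by simp
      also have "norm \<dots> \<le> (\<Sum>\<alpha>\<in>A - {\<lambda>_. 0}. C * \<eta> * P x)"
        by (intro sum_norm_le summand) auto
      also have "\<dots> \<le> (C * \<eta> * (card A + 1)) * P x"
      proof -
        have "card (A - {\<lambda>_. 0}) \<le> card A + 1" using finA by (simp add: card_Diff_subset_Int)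
        then have "real (card (A - {\<lambda>_. 0})) * (C * \<eta> * P x) \<le> (real (card A) + 1) * (C * \<eta> * P x)"
          using C \<eta> Px by (intro mult_right_mono) auto
        then show ?thesis by (simp add: algebra_simps)
      qed
      also have "\<dots> \<le> 1 / 2 * P x" using \<eta> Px by (intro mult_right_mono) auto
      finally show ?thesis by simp
    next
      case False
      then have "S = {}" by (auto simp: A_def le_fun_def)
      then show ?thesis using Px by (simp add: Peq mpoly_eval_def)
    qed
  qed
qed

lemma mpoly_eval_bound:
  assumes "finite S"
  shows "\<exists>C>0. \<exists>d::nat. \<forall>w :: 'n::finite \<Rightarrow> complex. norm (mpoly_eval S c w) \<le> C * (\<Prod>i\<in>UNIV. (1 + norm (w i)) ^ d)"
proof -
  define d where "d = (\<Sum>\<beta>\<in>S. \<Sum>i\<in>UNIV. \<beta> i)"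
  define C where "C = (\<Sum>\<beta>\<in>S. \<bar>c \<beta>\<bar>) + 1"
  have C: "C > 0" unfolding C_def by (intro add_nonneg_pos sum_nonneg) auto
  have d: "\<beta> i \<le> d" if "\<beta> \<in> S" for \<beta> and i :: 'n
    using member_le_sum[OF that, of "\<lambda>\<beta>. \<Sum>i\<in>UNIV. \<beta> i"] member_le_sum[of i UNIV \<beta>] assms
    unfolding d_def by (auto intro: order_trans)
  have "norm (mpoly_eval S c w) \<le> C * (\<Prod>i\<in>UNIV. (1 + norm (w i)) ^ d)" for w :: "'n \<Rightarrow> complex"
  proof -
    have "norm (mpoly_eval S c w) \<le> (\<Sum>\<beta>\<in>S. \<bar>c \<beta>\<bar> * (\<Prod>i\<in>UNIV. (1 + norm (w i)) ^ d))"
      unfolding mpoly_eval_def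
    proof (rule sum_norm_le)
      fix \<beta> assume \<beta>: "\<beta> \<in> S"
      have "norm (w i) ^ \<beta> i \<le> (1 + norm (w i)) ^ d" for i
        using d[OF \<beta>, of i] power_mono[of "norm (w i)" "1 + norm (w i)" "\<beta> i"]
          power_increasing[of "\<beta> i" d "1 + norm (w i)"] by simp
      then show "norm (of_real (c \<beta>) * (\<Prod>i\<in>UNIV. w i ^ \<beta> i)) \<le> \<bar>c \<beta>\<bar> * (\<Prod>i\<in>UNIV. (1 + norm (w i)) ^ d)"
        by (auto simp: norm_mult prod_norm[symmetric] norm_power intro!: mult_left_mono prod_mono)
    qed
    also have "\<dots> = (\<Sum>\<beta>\<in>S. \<bar>c \<beta>\<bar>) * (\<Prod>i\<in>UNIV. (1 + norm (w i)) ^ d)" by (simp add: sum_distrib_right)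
    also have "\<dots> \<le> C * (\<Prod>i\<in>UNIV. (1 + norm (w i)) ^ d)"
      by (intro mult_right_mono prod_nonneg) (auto simp: C_def)
    finally show ?thesis .
  qed
  then show ?thesis using C by blast
qed

lemma holomorphic_mpoly_eval:
  assumes "\<And>i. (\<lambda>z. g z i) holomorphic_on X"
  shows "(\<lambda>z. mpoly_eval S c (g z)) holomorphic_on X"
  unfolding mpoly_eval_def using assms by (intro holomorphic_intros)

lemma mpoly_eval_of_real:
  "mpoly_eval S c (\<lambda>i. of_real (x i)) = (of_real (mpoly_eval S c x) :: complex)"
  by (simp add: mpoly_eval_def)

section \<open>The summand on a complex domain\<close>

text \<open>
  The only properties of complexified polynomials that the continuation uses.
\<close>

definition tame :: "(('n::finite \<Rightarrow> complex) \<Rightarrow> complex) \<Rightarrow> bool" where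
  "tame q \<longleftrightarrow> (\<forall>X g. (\<forall>i. (\<lambda>z. g z i) holomorphic_on X) \<longrightarrow> (\<lambda>z. q (g z)) holomorphic_on X) \<and>
     (\<exists>C>0. \<exists>d::nat. \<forall>w. norm (q w) \<le> C * (\<Prod>i\<in>UNIV. (1 + norm (w i)) ^ d))"

lemma tame_holomorphic:
  assumes "tame q" "\<And>i. (\<lambda>z. g z i) holomorphic_on X"
  shows "(\<lambda>z. q (g z)) holomorphic_on X"
  using assms by (auto simp: tame_def)

lemma tame_mpoly_eval: "finite S \<Longrightarrow> tame (mpoly_eval S c)"
  using mpoly_eval_bound[of S c] holomorphic_mpoly_eval[of _ _ S c] unfolding tame_def by blast

lemma tame_const: "tame (\<lambda>_. c)"
  unfolding tame_def
  by (intro conjI allI impI exI[of _ "norm c + 1"] exI[of _ 0]) (auto simp: add_nonneg_pos)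

lemma tame_mult:
  assumes f: "tame f" and g: "tame g"
  shows "tame (\<lambda>w. f w * g w)"
proof -
  obtain C d where C: "C > 0" "\<And>w. norm (f w) \<le> C * (\<Prod>i\<in>UNIV. (1 + norm (w i)) ^ d)"
    using f unfolding tame_def by blast
  obtain C' d' where C': "C' > 0" "\<And>w. norm (g w) \<le> C' * (\<Prod>i\<in>UNIV. (1 + norm (w i)) ^ d')"
    using g unfolding tame_def by blast
  have "norm (f w * g w) \<le> (C * C') * (\<Prod>i\<in>UNIV. (1 + norm (w i)) ^ (d + d'))" for w
  proof -
    have "norm (f w * g w) \<le> (C * (\<Prod>i\<in>UNIV. (1 + norm (w i)) ^ d)) * (C' * (\<Prod>i\<in>UNIV. (1 + norm (w i)) ^ d'))"
      unfolding norm_mult using C C' by (intro mult_mono) (auto intro!: mult_nonneg_nonneg prod_nonneg)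
    then show ?thesis by (simp add: power_add prod.distrib mult_ac)
  qed
  moreover have "(\<lambda>z. f (h z) * g (h z)) holomorphic_on X"
    if "\<forall>i. (\<lambda>z. h z i) holomorphic_on X" for X h
    using that tame_holomorphic[OF f] tame_holomorphic[OF g] by (intro holomorphic_on_mult) auto
  ultimately show ?thesis unfolding tame_def using mult_pos_pos[OF C(1) C'(1)] by blast
qed

lemma tame_power: "tame f \<Longrightarrow> tame (\<lambda>w. f w ^ n)"
  by (induction n) (auto intro: tame_const tame_mult)

lemma tame_prod: "(\<And>t. t \<in> T \<Longrightarrow> tame (f t)) \<Longrightarrow> tame (\<lambda>w. \<Prod>t\<in>T. f t w)"
  by (induction T rule: infinite_finite_induct) (auto intro: tame_const tame_mult)

text \<open>The complex counterpart of \<open>restr\<close>: coordinates in I are translated by a,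
  the others frozen at b. For a = 0 and I = UNIV it is the identity.\<close>

definition emb :: "('n \<Rightarrow> nat) \<Rightarrow> 'n set \<Rightarrow> ('n \<Rightarrow> nat) \<Rightarrow> ('n \<Rightarrow> complex) \<Rightarrow> 'n \<Rightarrow> complex" where
  "emb a I b w = (\<lambda>i. if i \<in> I then of_nat (a i) + w i else of_nat (b i))"

lemma tame_bound_emb:
  fixes q :: "('n::finite \<Rightarrow> complex) \<Rightarrow> complex"
  assumes "tame q"
  shows "\<exists>C\<ge>1. \<exists>d::nat. \<forall>w. norm (q (emb a I b w)) \<le> C * (\<Prod>i\<in>I. (1 + norm (w i)) powr d)"
proof -
  obtain C d where C: "C > 0" "\<And>w. norm (q w) \<le> C * (\<Prod>i\<in>UNIV. (1 + norm (w i)) ^ d)"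
    using assms unfolding tame_def by blast
  define E where "E = (\<Prod>i\<in>UNIV. (1 + real (a i) + real (b i)) ^ d)"
  have E: "E \<ge> 1" unfolding E_def by (intro prod_ge_1) auto
  have "norm (q (emb a I b w)) \<le> (C + 1) * E * (\<Prod>i\<in>I. (1 + norm (w i)) powr d)" for w
  proof -
    have "norm (q (emb a I b w)) \<le> C * (\<Prod>i\<in>UNIV. (1 + norm (emb a I b w i)) ^ d)" by (rule C)
    also have "(\<Prod>i\<in>UNIV. (1 + norm (emb a I b w i)) ^ d) \<le>
        (\<Prod>i\<in>UNIV. (1 + real (a i) + real (b i)) ^ d * (if i \<in> I then (1 + norm (w i)) ^ d else 1))"
    proof (intro prod_mono conjI)
      fix i
      have "1 + norm (emb a I b w i) \<le> (1 + real (a i) + real (b i)) * (if i \<in> I then 1 + norm (w i) else 1)"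
      proof (cases "i \<in> I")
        case True
        have "norm (of_nat (a i) + w i) \<le> real (a i) + norm (w i)"
          using norm_triangle_ineq[of "of_nat (a i)" "w i"] by simp
        moreover have "(1 + real (a i) + real (b i)) * (1 + norm (w i)) =
            1 + norm (w i) + real (a i) + real (b i) + (real (a i) + real (b i)) * norm (w i)"
          by (simp add: algebra_simps)
        moreover have "(real (a i) + real (b i)) * norm (w i) \<ge> 0" by simp
        ultimately show ?thesis
          unfolding emb_def using True of_nat_0_le_iff[of "b i", where 'a = real] by (simp only: if_True)
      qed (auto simp: emb_def)
      then have "(1 + norm (emb a I b w i)) ^ d \<le>
          ((1 + real (a i) + real (b i)) * (if i \<in> I then 1 + norm (w i) else 1)) ^ d"
        by (intro power_mono) auto
      then show "(1 + norm (emb a I b w i)) ^ d \<le>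
          (1 + real (a i) + real (b i)) ^ d * (if i \<in> I then (1 + norm (w i)) ^ d else 1)"
        by (auto simp: power_mult_distrib)
    qed auto
    also have "\<dots> = E * (\<Prod>i\<in>I. (1 + norm (w i)) ^ d)"
      by (simp add: prod.distrib E_def prod.If_cases)
    also have "(\<Prod>i\<in>I. (1 + norm (w i)) ^ d) = (\<Prod>i\<in>I. (1 + norm (w i)) powr d)"
      by (intro prod.cong refl) (simp add: powr_realpow add_pos_nonneg)
    finally have "norm (q (emb a I b w)) \<le> C * (E * (\<Prod>i\<in>I. (1 + norm (w i)) powr d))"
      using C(1) by simp
    also have "\<dots> \<le> (C + 1) * (E * (\<Prod>i\<in>I. (1 + norm (w i)) powr d))"
      using E by (intro mult_right_mono mult_nonneg_nonneg prod_nonneg) auto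
    finally show ?thesis by (simp add: mult.assoc)
  qed
  moreover have "(C + 1) * E \<ge> 1" using C(1) E mult_mono[of 1 "C + 1" 1 E] by simp
  ultimately show ?thesis by blast
qed

text \<open>The imaginary part of Ln P is at most pi in modulus and the real part lies between ln
  \<kappa> and ln U, so |s Ln P| \<le> R (ln U - ln \<kappa> + pi) whatever the sign of Re s. Thus
  P^(-s) grows polynomially, with an exponent proportional to R.\<close>

lemma norm_exp_Ln_le:
  assumes "norm s \<le> R" and P: "\<kappa> \<le> norm P" "norm P \<le> U" and "0 < \<kappa>" "\<kappa> \<le> 1" "1 \<le> U"
  shows "norm (exp (- s * Ln P)) \<le> exp (R * (pi - ln \<kappa>)) * U powr R"
proof -
  have P0: "P \<noteq> 0" using assms by auto
  have R0: "R \<ge> 0" using assms norm_ge_zero[of s] by linarith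
  have "ln \<kappa> \<le> ln (norm P)" "ln (norm P) \<le> ln U" using assms P0 by auto
  moreover have "ln \<kappa> \<le> 0" "0 \<le> ln U" using assms by auto
  ultimately have l: "\<bar>ln (norm P)\<bar> \<le> ln U - ln \<kappa>" by linarith
  have "norm (Ln P) \<le> \<bar>Re (Ln P)\<bar> + \<bar>Im (Ln P)\<bar>" by (rule cmod_le)
  also have "\<bar>Im (Ln P)\<bar> \<le> pi" using mpi_less_Im_Ln[OF P0] Im_Ln_le_pi[OF P0] by linarith
  also have "\<bar>Re (Ln P)\<bar> \<le> ln U - ln \<kappa>" using l P0 by simp
  finally have "norm (Ln P) \<le> ln U - ln \<kappa> + pi" by simp
  then have "norm s * norm (Ln P) \<le> R * (ln U - ln \<kappa> + pi)" using assms R0 by (intro mult_mono) auto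
  moreover have "Re (- s * Ln P) \<le> norm s * norm (Ln P)"
    using complex_Re_le_cmod[of "- s * Ln P"] by (simp add: norm_mult)
  ultimately have "exp (Re (- s * Ln P)) \<le> exp (R * (ln U - ln \<kappa> + pi))" by simp
  also have "\<dots> = exp (R * (pi - ln \<kappa>)) * U powr R"
    using assms by (simp add: powr_def exp_add[symmetric] algebra_simps)
  finally show ?thesis by (simp only: norm_exp_eq_Re)
qed

text \<open>The disc of radius R controls the argument of P, at the cost exp(R pi), and the excess
  of Re s over \<sigma> where |P| < 1, at the cost \<kappa>^(-R). The decay exponent \<sigma> is
  independent of R.\<close>

lemma norm_exp_Ln_decay:
  assumes s: "norm s \<le> R" "\<sigma> \<le> Re s" and P: "\<kappa> \<le> norm P" and \<kappa>: "0 < \<kappa>" "\<kappa> \<le> 1" and \<sigma>: "0 \<le> \<sigma>"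
  shows "norm (exp (- s * Ln P)) \<le> exp (R * (pi - ln \<kappa>)) * norm P powr (- \<sigma>)"
proof -
  have P0: "P \<noteq> 0" using assms by auto
  have Im: "\<bar>Im (Ln P)\<bar> \<le> pi" using mpi_less_Im_Ln[OF P0] Im_Ln_le_pi[OF P0] by linarith
  have "Re s \<le> R" using s complex_Re_le_cmod[of s] by linarith
  have R0: "R \<ge> 0" using s norm_ge_zero[of s] by linarith
  have "Im s * Im (Ln P) \<le> \<bar>Im s\<bar> * \<bar>Im (Ln P)\<bar>" by (metis abs_ge_self abs_mult)
  also have "\<dots> \<le> R * pi" using s abs_Im_le_cmod[of s] Im by (intro mult_mono) auto
  finally have 1: "Im s * Im (Ln P) \<le> R * pi" .
  have "ln \<kappa> \<le> ln (norm P)" "ln \<kappa> \<le> 0" using P \<kappa> P0 by auto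
  then have "(Re s - \<sigma>) * (- ln (norm P)) \<le> (Re s - \<sigma>) * (- ln \<kappa>)" using s by (intro mult_left_mono) auto
  also have "\<dots> \<le> R * (- ln \<kappa>)" using \<open>Re s \<le> R\<close> \<sigma> \<open>ln \<kappa> \<le> 0\<close> by (intro mult_right_mono) auto
  finally have 2: "(Re s - \<sigma>) * (- ln (norm P)) \<le> R * (- ln \<kappa>)" .
  have "Re (- s * Ln P) = (Re s - \<sigma>) * (- ln (norm P)) + (- \<sigma>) * ln (norm P) + Im s * Im (Ln P)"
    using P0 by (simp add: algebra_simps)
  also have "\<dots> \<le> R * (pi - ln \<kappa>) + (- \<sigma>) * ln (norm P)" using 1 2 by (simp add: algebra_simps)
  finally have "exp (Re (- s * Ln P)) \<le> exp (R * (pi - ln \<kappa>) + (- \<sigma>) * ln (norm P))" by simp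
  also have "\<dots> = exp (R * (pi - ln \<kappa>)) * norm P powr (- \<sigma>)"
    using P0 unfolding powr_def exp_add by simp
  finally show ?thesis by (simp only: norm_exp_eq_Re)
qed

text \<open>
  A parameter s is the family of the variables indexed by Inl, the summation variables are indexed
  by Inr. The value 1 of the latter is a dummy: it is overwritten by the summation.
\<close>

definition point :: "complex^'t \<Rightarrow> 't + 'n \<Rightarrow> complex" where
  "point s = case_sum (\<lambda>t. s $ t) (\<lambda>_. 1)"

definition weights :: "('n \<Rightarrow> complex) \<Rightarrow> 't + 'n \<Rightarrow> complex" where
  "weights \<mu> = case_sum (\<lambda>_. 0) \<mu>"

definition coords :: "'n::linorder set \<Rightarrow> ('t + 'n) list" where
  "coords I = map Inr (sorted_list_of_set I)"

lemma coords: "distinct (coords I)" "finite I \<Longrightarrow> set (coords I) = Inr ` I"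
  by (auto simp: coords_def distinct_map)

text \<open>The disc about x has radius at most x / 2, so its points stay in the right half-plane
  and are comparable with x.\<close>

lemma reg_domain_pos:
  assumes \<eta>: "0 < \<eta>" "\<eta> \<le> 1/2" and e: "0 < \<epsilon>" "\<epsilon> \<le> 1" and w: "w \<in> reg_domain \<eta> \<epsilon>"
  obtains x where "x \<ge> 1" "norm (w - of_real x) < \<eta> * x powr \<epsilon>" "Re w > 0" "1 + norm w \<le> 3 * x"
proof -
  obtain x where x: "x \<ge> 1" "w \<in> ball (of_real x) (\<eta> * x powr \<epsilon>)" using w by (auto simp: reg_domain_def)
  then have d: "norm (w - of_real x) < \<eta> * x powr \<epsilon>" by (simp add: dist_norm norm_minus_commute)
  also have "\<eta> * x powr \<epsilon> \<le> 1/2 * x"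
    using \<eta> e x powr_mono[of \<epsilon> 1 x] by (intro mult_mono) auto
  finally have d2: "norm (w - of_real x) < x / 2" by simp
  have "x - Re w \<le> norm (w - of_real x)"
    using abs_Re_le_cmod[of "w - of_real x"] by simp
  then have "Re w > 0" using d2 x by linarith
  moreover have "norm w \<le> x + norm (w - of_real x)"
    using norm_triangle_ineq[of "of_real x" "w - of_real x"] x by simp
  then have "1 + norm w \<le> 3 * x" using d2 x by linarith
  ultimately show thesis using that x d by blast
qed

text \<open>What the continuation needs of the complexified polynomials: positive real part keeps
  the principal logarithm holomorphic, the lower bound \<kappa> controls powers of small values, and
  growth of the product in each single variable yields convergence for large Re s.\<close>

locale zeta_extension =
  fixes \<eta> \<epsilon> \<kappa> \<delta> :: real and Pc :: "'t::finite \<Rightarrow> ('n::{finite,linorder} \<Rightarrow> complex) \<Rightarrow> complex"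
    and \<mu> :: "'n \<Rightarrow> complex"
  assumes \<eta>: "0 < \<eta>" "\<eta> \<le> 1/2" and \<epsilon>: "0 < \<epsilon>" "\<epsilon> \<le> 1" and \<kappa>: "0 < \<kappa>" "\<kappa> \<le> 1" and \<delta>: "0 < \<delta>"
    and \<mu>: "\<And>i. norm (\<mu> i) = 1" "\<And>i. \<mu> i \<noteq> 1"
    and tame_Pc: "\<And>t. tame (Pc t)"
    and Re_Pc: "\<And>t w. (\<And>i. w i \<in> reg_domain \<eta> \<epsilon>) \<Longrightarrow> 0 < Re (Pc t w)"
    and Pc_ge: "\<And>t w. (\<And>i. w i \<in> reg_domain \<eta> \<epsilon>) \<Longrightarrow> \<kappa> \<le> norm (Pc t w)"
    and prod_Pc_ge: "\<And>n w. (\<And>i. w i \<in> reg_domain \<eta> \<epsilon>) \<Longrightarrow>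
      \<kappa> * (1 + norm (w n)) powr \<delta> \<le> (\<Prod>t\<in>UNIV. norm (Pc t w))"
begin

text \<open>The summand Q P^(-s) as a function of parameters and summation variables together. With
  exp and Ln the holomorphy in both kinds of variables is visible; at lattice points it agrees with
  \<open>powr\<close>, as P does not vanish there.\<close>

definition symb :: "(('n \<Rightarrow> complex) \<Rightarrow> complex) \<Rightarrow> ('n \<Rightarrow> nat) \<Rightarrow> 'n set \<Rightarrow> ('n \<Rightarrow> nat) \<Rightarrow>
    ('t + 'n \<Rightarrow> complex) \<Rightarrow> complex" where
  "symb q a I b p = q (emb a I b (\<lambda>i. p (Inr i))) *
     (\<Prod>t\<in>UNIV. exp (- p (Inl t) * Ln (Pc t (emb a I b (\<lambda>i. p (Inr i))))))"

definition param_dom :: "complex set \<Rightarrow> 't + 'n \<Rightarrow> complex set" where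
  "param_dom V = case_sum (\<lambda>_. V) (\<lambda>_. reg_domain \<eta> \<epsilon>)"

lemma domain_setup: "open V \<Longrightarrow> reg_setup \<eta> \<epsilon> (param_dom V) (Inr ` I) (weights \<mu>)"
  using \<eta> \<epsilon> \<mu> open_reg_domain
  by unfold_locales (auto simp: param_dom_def weights_def split: sum.splits)

lemma of_nat_emb_in_domain: "n \<ge> 1 \<Longrightarrow> of_nat n \<in> reg_domain \<eta> \<epsilon>"
  using of_nat_in_reg_domain[OF \<eta>(1), of "n - 1"] by simp

text \<open>The width of the domain increases with x, so a translated disc fits into the disc about
  the translated centre.\<close>

lemma add_in_domain: "w \<in> reg_domain \<eta> \<epsilon> \<Longrightarrow> of_nat n + w \<in> reg_domain \<eta> \<epsilon>"
proof -
  assume "w \<in> reg_domain \<eta> \<epsilon>"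
  then obtain x where x: "x \<ge> 1" "dist (of_real x) w < \<eta> * x powr \<epsilon>" by (auto simp: reg_domain_def)
  have "dist (of_real (real n + x)) (of_nat n + w) = dist (of_real x) w"
    by (simp add: dist_norm)
  also have "\<dots> < \<eta> * x powr \<epsilon>" by (rule x)
  also have "\<dots> \<le> \<eta> * (real n + x) powr \<epsilon>" using x \<eta> \<epsilon> by (intro mult_left_mono powr_mono2) auto
  finally show ?thesis using x unfolding reg_domain_def by (intro UN_I[of "real n + x"]) auto
qed

lemma emb_in_domain:
  assumes "\<And>i. w i \<in> reg_domain \<eta> \<epsilon>" "\<And>i. i \<notin> I \<Longrightarrow> b i \<ge> 1"
  shows "emb a I b w i \<in> reg_domain \<eta> \<epsilon>"
  using assms of_nat_emb_in_domain add_in_domain by (auto simp: emb_def)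

lemma symb_holomorphic:
  assumes q: "tame q" and b: "\<And>i. i \<notin> I \<Longrightarrow> b i \<ge> 1" and p: "\<And>k. p k \<in> param_dom V k"
  shows "(\<lambda>z. symb q a I b (p(k := z))) holomorphic_on param_dom V k"
proof -
  define w where "w z i = (p(k := z)) (Inr i)" for z i
  have w: "w z i \<in> reg_domain \<eta> \<epsilon>" if "z \<in> param_dom V k" for z i
    using p[of "Inr i"] that by (auto simp: w_def param_dom_def)
  have hw: "(\<lambda>z. w z i) holomorphic_on param_dom V k" for i
    unfolding w_def by (cases "Inr i = k") (auto intro: holomorphic_intros)
  have he: "(\<lambda>z. emb a I b (w z) i) holomorphic_on param_dom V k" for i
    unfolding emb_def using hw by (cases "i \<in> I") (auto intro!: holomorphic_intros)
  have hp: "(\<lambda>z. (p(k := z)) (Inl t)) holomorphic_on param_dom V k" for t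
    by (cases "Inl t = k") (auto intro: holomorphic_intros)
  have nz: "Pc t (emb a I b (w z)) \<notin> \<real>\<^sub>\<le>\<^sub>0" if "z \<in> param_dom V k" for t z
  proof -
    have "emb a I b (w z) i \<in> reg_domain \<eta> \<epsilon>" for i
      using w[OF that] b by (intro emb_in_domain) auto
    then have "Re (Pc t (emb a I b (w z))) > 0" by (rule Re_Pc)
    then show ?thesis by (auto simp: complex_nonpos_Reals_iff)
  qed
  show ?thesis
    unfolding symb_def w_def[symmetric]
    using tame_holomorphic[OF q he] tame_holomorphic[OF tame_Pc he] hp nz
    by (intro holomorphic_intros) auto
qed

text \<open>For parameters of size at most R each factor P_t^(-s_t) contributes R times the degree
  bound of P_t. The exponent M therefore depends on R, and with it the order K.\<close>

lemma symb_class_ball: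
  assumes q: "tame q" and b: "\<And>i. i \<notin> I \<Longrightarrow> b i \<ge> 1"
  shows "\<exists>M B. symbol_class (param_dom (ball 0 R)) (Inr ` I) M B (symb q a I b)"
proof -
  obtain C d where C: "C \<ge> 1" "\<And>w. norm (q (emb a I b w)) \<le> C * (\<Prod>i\<in>I. (1 + norm (w i)) powr real d)"
    using tame_bound_emb[OF q] by blast
  have "\<forall>t. \<exists>C d. C \<ge> 1 \<and> (\<forall>w. norm (Pc t (emb a I b w)) \<le> C * (\<Prod>i\<in>I. (1 + norm (w i)) powr real d))"
    using tame_bound_emb[OF tame_Pc] by blast
  then obtain U e where U: "\<And>t. U t \<ge> 1"
    "\<And>t w. norm (Pc t (emb a I b w)) \<le> U t * (\<Prod>i\<in>I. (1 + norm (w i)) powr real (e t))" by metis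
  define M where "M = real d + (\<Sum>t\<in>UNIV. real (e t) * R)"
  define B where "B = C * (\<Prod>t\<in>UNIV. exp (R * (pi - ln \<kappa>)) * U t powr R)"
  show ?thesis
  proof (rule exI[of _ M], rule exI[of _ B], unfold symbol_class_def, intro allI impI conjI)
    fix p assume p: "\<forall>k. p k \<in> param_dom (ball 0 R) k"
    define w where "w i = p (Inr i)" for i
    have w: "w i \<in> reg_domain \<eta> \<epsilon>" for i using p[rule_format, of "Inr i"] by (simp add: w_def param_dom_def)
    have e1: "norm (exp (- p (Inl t) * Ln (Pc t (emb a I b w)))) \<le>
        exp (R * (pi - ln \<kappa>)) * U t powr R * (\<Prod>i\<in>I. (1 + norm (w i)) powr (e t * R))" for t
    proof -
      define X where "X = (\<Prod>i\<in>I. (1 + norm (w i)) powr real (e t))"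
      have X: "X \<ge> 1" unfolding X_def by (intro prod_ge_1) (auto intro: ge_one_powr_ge_zero)
      have "norm (exp (- p (Inl t) * Ln (Pc t (emb a I b w)))) \<le> exp (R * (pi - ln \<kappa>)) * (U t * X) powr R"
      proof (rule norm_exp_Ln_le)
        show "norm (p (Inl t)) \<le> R" using p[rule_format, of "Inl t"] by (simp add: param_dom_def)
        show "\<kappa> \<le> norm (Pc t (emb a I b w))" using emb_in_domain[OF w b] by (rule Pc_ge)
        show "norm (Pc t (emb a I b w)) \<le> U t * X" unfolding X_def by (rule U(2))
        show "1 \<le> U t * X" using U(1)[of t] X mult_mono[of 1 "U t" 1 X] by simp
      qed (use \<kappa> in auto)
      also have "(U t * X) powr R = U t powr R * X powr R"
        using U(1)[of t] X by (intro powr_mult)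
      also have "X powr R = (\<Prod>i\<in>I. (1 + norm (w i)) powr (e t * R))"
        unfolding X_def by (simp add: powr_powr prod_powr_distrib)
      finally show ?thesis by (simp only: mult.assoc)
    qed
    have "norm (symb q a I b p) = norm (q (emb a I b w)) *
        (\<Prod>t\<in>UNIV. norm (exp (- p (Inl t) * Ln (Pc t (emb a I b w)))))"
      unfolding symb_def w_def by (simp only: norm_mult prod_norm)
    also have "\<dots> \<le> (C * (\<Prod>i\<in>I. (1 + norm (w i)) powr real d)) *
        (\<Prod>t\<in>UNIV. exp (R * (pi - ln \<kappa>)) * U t powr R * (\<Prod>i\<in>I. (1 + norm (w i)) powr (e t * R)))"
      using C e1 by (intro mult_mono prod_mono conjI prod_nonneg mult_nonneg_nonneg) auto
    also have "\<dots> = B * ((\<Prod>i\<in>I. (1 + norm (w i)) powr real d) *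
        (\<Prod>i\<in>I. \<Prod>t\<in>UNIV. (1 + norm (w i)) powr (e t * R)))"
      unfolding B_def prod.distrib by (subst prod.swap) (simp only: mult_ac)
    also have "(\<Prod>i\<in>I. (1 + norm (w i)) powr real d) *
        (\<Prod>i\<in>I. \<Prod>t\<in>UNIV. (1 + norm (w i)) powr (e t * R)) = (\<Prod>i\<in>I. (1 + norm (w i)) powr M)"
      unfolding prod.distrib[symmetric]
    proof (intro prod.cong refl)
      fix i
      have "1 + norm (w i) \<noteq> 0" by (smt (verit) norm_ge_zero)
      then show "(1 + norm (w i)) powr real d * (\<Prod>t\<in>UNIV. (1 + norm (w i)) powr (e t * R)) =
          (1 + norm (w i)) powr M"
        by (simp add: M_def powr_add powr_sum)
    qed
    also have "\<dots> = (\<Prod>k\<in>Inr ` I. (1 + norm (p k)) powr M)"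
      by (simp add: prod.reindex w_def)
    finally show "norm (symb q a I b p) \<le> B * (\<Prod>k\<in>Inr ` I. (1 + norm (p k)) powr M)" .
  qed (use symb_holomorphic[OF q b] in auto)
qed

text \<open>Multiplying the growth bounds of all N variables bounds the N-th power of the product of
  the |P_t| below by a power of the product of the 1 + |v i|, so a large \<sigma> gives decay in all
  variables at once. The estimate is made at v = emb a I b w, again in the domain, so \<sigma> is
  independent of a, I, b; R enters only the constant.\<close>

lemma symb_class_halfplane:
  assumes q: "tame q"
  shows "\<exists>\<sigma>. \<forall>R a I b. (\<forall>i. i \<notin> I \<longrightarrow> b i \<ge> 1) \<longrightarrow>
    (\<exists>B. symbol_class (param_dom ({z. \<sigma> < Re z} \<inter> ball 0 R)) (Inr ` I) (-2) B (symb q a I b))"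
proof -
  obtain C d where C: "C > 0" "\<And>w. norm (q w) \<le> C * (\<Prod>i\<in>UNIV. (1 + norm (w i)) ^ d)"
    using q unfolding tame_def by blast
  define N where "N = real CARD('n)"
  have N: "N > 0" by (simp add: N_def)
  \<comment> \<open>Chosen so that \<sigma> \<delta> / N = d + 2: d offsets the growth of q, and 2
    leaves the summable exponent -2.\<close>
  define \<sigma> where "\<sigma> = (d + 2) * N / \<delta>"
  have \<sigma>: "\<sigma> \<ge> 0" "\<sigma> * \<delta> / N = d + 2" using \<delta> N by (auto simp: \<sigma>_def)
  show ?thesis
  proof (rule exI[of _ \<sigma>], intro allI impI)
    fix R a b and I :: "'n set"
    assume b: "\<forall>i. i \<notin> I \<longrightarrow> b i \<ge> (1::nat)"
    define B where "B = C * (exp (R * (pi - ln \<kappa>)) ^ CARD('t) * \<kappa> powr (- \<sigma>))"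
    show "\<exists>B. symbol_class (param_dom ({z. \<sigma> < Re z} \<inter> ball 0 R)) (Inr ` I) (-2) B (symb q a I b)"
    proof (intro exI[of _ B], unfold symbol_class_def, intro allI impI conjI)
      fix p :: "'t + 'n \<Rightarrow> complex" assume p: "\<forall>k. p k \<in> param_dom ({z. \<sigma> < Re z} \<inter> ball 0 R) k"
      define w where "w i = p (Inr i)" for i
      have w: "w i \<in> reg_domain \<eta> \<epsilon>" for i using p[rule_format, of "Inr i"] by (simp add: w_def param_dom_def)
      define v where "v = emb a I b w"
      have v: "v i \<in> reg_domain \<eta> \<epsilon>" for i unfolding v_def using w b by (intro emb_in_domain) auto
      define PP where "PP = (\<Prod>t\<in>UNIV. norm (Pc t v))"
      have Pk: "\<kappa> \<le> norm (Pc t v)" for t using v by (rule Pc_ge)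
      have PP0: "PP > 0" unfolding PP_def using Pk \<kappa> by (intro prod_pos) (metis less_le_trans)
      define Y where "Y = (\<Prod>i\<in>UNIV. 1 + norm (v i))"
      have v0: "1 + norm (v i) > 0" for i by (simp add: add_pos_nonneg)
      have Y0: "Y > 0" unfolding Y_def using v0 by (intro prod_pos) auto
      have "(\<Prod>i\<in>UNIV. \<kappa> * (1 + norm (v i)) powr \<delta>) \<le> (\<Prod>i\<in>(UNIV :: 'n set). PP)"
        unfolding PP_def using v \<kappa> by (intro prod_mono conjI prod_Pc_ge) auto
      then have "\<kappa> powr N * Y powr \<delta> \<le> PP powr N"
        using \<kappa> PP0 v0
        by (simp add: prod.distrib Y_def prod_powr_distrib[symmetric] N_def powr_realpow less_imp_le)
      then have "PP powr (- \<sigma>) \<le> \<kappa> powr (- \<sigma>) * Y powr (- (d + 2))"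
      proof -
        assume le: "\<kappa> powr N * Y powr \<delta> \<le> PP powr N"
        have "(PP powr N) powr (- \<sigma> / N) \<le> (\<kappa> powr N * Y powr \<delta>) powr (- \<sigma> / N)"
          using le \<sigma>(1) N \<kappa> Y0 by (intro powr_mono2') auto
        also have "\<dots> = (\<kappa> powr N) powr (- \<sigma> / N) * (Y powr \<delta>) powr (- \<sigma> / N)"
          by (rule powr_mult)
        also have "\<dots> = \<kappa> powr (- \<sigma>) * Y powr (- (\<sigma> * \<delta> / N))"
          using N by (simp add: powr_powr mult.commute)
        finally show ?thesis using N by (simp add: powr_powr \<sigma>(2))
      qed
      moreover have "norm (symb q a I b p) = norm (q v) * (\<Prod>t\<in>UNIV. norm (exp (- p (Inl t) * Ln (Pc t v))))"
        unfolding symb_def w_def v_def by (simp only: norm_mult prod_norm)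
      moreover have "norm (q v) \<le> C * Y powr d"
        using C(2)[of v] Y0 by (simp add: Y_def powr_realpow prod_power_distrib)
      moreover have "(\<Prod>t\<in>UNIV. norm (exp (- p (Inl t) * Ln (Pc t v)))) \<le>
          (\<Prod>t\<in>(UNIV :: 't set). exp (R * (pi - ln \<kappa>)) * norm (Pc t v) powr (- \<sigma>))"
      proof (intro prod_mono conjI norm_exp_Ln_decay Pk \<kappa> \<sigma>)
        show "norm (p (Inl t)) \<le> R" "\<sigma> \<le> Re (p (Inl t))" for t
          using p[rule_format, of "Inl t"] by (simp_all add: param_dom_def)
      qed auto
      moreover have "(\<Prod>t\<in>(UNIV :: 't set). exp (R * (pi - ln \<kappa>)) * norm (Pc t v) powr (- \<sigma>)) =
          exp (R * (pi - ln \<kappa>)) ^ CARD('t) * PP powr (- \<sigma>)"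
        by (simp add: prod.distrib PP_def prod_powr_distrib)
      ultimately have "norm (symb q a I b p) \<le> (C * Y powr d) *
          (exp (R * (pi - ln \<kappa>)) ^ CARD('t) * (\<kappa> powr (- \<sigma>) * Y powr (- (d + 2))))"
        using C(1)
        by (auto intro!: mult_mono prod_nonneg mult_nonneg_nonneg
            intro: order_trans[OF _ mult_left_mono])
      also have "\<dots> = B * Y powr (-2)"
        using Y0 by (simp add: B_def powr_add powr_minus powr_diff field_simps)
      also have "\<dots> \<le> B * (\<Prod>i\<in>I. (1 + norm (w i)) powr (-2))"
      proof (rule mult_left_mono)
        have "Y powr (-2) = (\<Prod>i\<in>UNIV. (1 + norm (v i)) powr (-2))"
          by (simp add: Y_def prod_powr_distrib)
        also have "\<dots> \<le> (\<Prod>i\<in>UNIV. if i \<in> I then (1 + norm (w i)) powr (-2) else 1)"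
        proof (intro prod_mono conjI)
          fix i
          show "(1 + norm (v i)) powr (-2) \<le> (if i \<in> I then (1 + norm (w i)) powr (-2) else 1)"
          proof (cases "i \<in> I")
            case True
            \<comment> \<open>As Re (w i) > 0, adding a i does not decrease the modulus, so decay in
              the translated point v gives decay in w.\<close>
            obtain "Re (w i) > 0" using reg_domain_pos[OF \<eta> \<epsilon> w[of i]] by metis
            then have "norm (w i) \<le> norm (v i)"
              using True by (simp add: v_def emb_def cmod_def power_mono)
            then show ?thesis using True v0[of i] by (simp add: powr_mono2' add_pos_nonneg)
          next
            case False
            have "(1 + norm (v i)) powr (-2) \<le> (1 + norm (v i)) powr 0" by (intro powr_mono) auto
            then show ?thesis using False v0[of i] by simp
          qed
        qed auto
        also have "\<dots> = (\<Prod>i\<in>I. (1 + norm (w i)) powr (-2))" by (simp add: prod.If_cases)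
        finally show "Y powr (-2) \<le> (\<Prod>i\<in>I. (1 + norm (w i)) powr (-2))" .
      qed (use C in \<open>auto simp: B_def\<close>)
      also have "\<dots> = B * (\<Prod>k\<in>Inr ` I. (1 + norm (p k)) powr (-2))"
        by (simp add: prod.reindex w_def)
      finally show "norm (symb q a I b p) \<le> B * (\<Prod>k\<in>Inr ` I. (1 + norm (p k)) powr (-2))" .
    qed (use symb_holomorphic[OF q] b in auto)
  qed
qed

end

section \<open>Continuation of the zeta series\<close>

lemma zeta_continuation_eq:
  fixes F :: "complex^'t::finite \<Rightarrow> complex"
  assumes F: "entire F"
    and sum: "\<exists>\<sigma>. \<forall>s. (\<forall>t. \<sigma> < Re (s $ t)) \<longrightarrow> (zeta_term I Q P \<mu> s has_sum F s) A"
  shows "zeta_continuation A I Q P \<mu> = F"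
  unfolding zeta_continuation_def
proof (rule the_equality)
  fix G assume G: "entire G \<and> (\<exists>\<sigma>. \<forall>s. (\<forall>t. \<sigma> < Re (s $ t)) \<longrightarrow> (zeta_term I Q P \<mu> s has_sum G s) A)"
  then obtain \<sigma> where \<sigma>: "\<And>s. (\<And>t. \<sigma> < Re (s $ t)) \<Longrightarrow> (zeta_term I Q P \<mu> s has_sum G s) A" by blast
  obtain \<tau> where \<tau>: "\<And>s. (\<And>t. \<tau> < Re (s $ t)) \<Longrightarrow> (zeta_term I Q P \<mu> s has_sum F s) A" using sum by blast
  show "G = F"
  proof (rule continuation_unique[where \<sigma> = "max \<sigma> \<tau>"])
    fix s :: "(complex, 't) vec" assume "\<And>t. max \<sigma> \<tau> < Re (s $ t)"
    then show "G s = F s" by (intro has_sum_unique[OF \<sigma> \<tau>]) auto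
  qed (use F G in auto)
qed (use assms in auto)

lemma norm_nth_add_axis_le: "norm ((s + axis t z) $ t') \<le> norm s + norm (z :: complex)"
proof (cases "t' = t")
  case True
  then show ?thesis
    using Finite_Cartesian_Product.norm_nth_le[of s t'] norm_triangle_ineq[of "s $ t'" z]
    by (simp add: axis_def)
next
  case False
  then show ?thesis
    using Finite_Cartesian_Product.norm_nth_le[of s t'] add_increasing2[OF norm_ge_zero[of z]]
    by (simp add: axis_def)
qed

context zeta_extension
begin

text \<open>The case a = 0, I = UNIV is the full series, a general a with I = UNIV the series
  translated by a, and a proper subset I a face of E(a).\<close>

definition zeta_cont :: "(('n \<Rightarrow> complex) \<Rightarrow> complex) \<Rightarrow> ('n \<Rightarrow> nat) \<Rightarrow> 'n set \<Rightarrow> ('n \<Rightarrow> nat) \<Rightarrow> complex^'t \<Rightarrow> complex" where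
  "zeta_cont q a I b s = reg_lim (weights \<mu>) (coords I) (symb q a I b) (point s)"

lemma point_in_dom: "(\<And>t. s $ t \<in> V) \<Longrightarrow> point s k \<in> param_dom V k"
  using of_nat_emb_in_domain[of 1] by (cases k) (auto simp: point_def param_dom_def)

lemma set_coords: "set (coords I :: ('t + 'n) list) = Inr ` I"
  by (simp add: coords(2))

text \<open>On bounded sets of parameters one symbol class and one order K suffice, so the limit is
  an iterated sum of fixed order, holomorphic in each parameter. Once all variables are summed out
  the product bound is empty, which gives the boundedness needed for joint holomorphy.\<close>

lemma entire_cont:
  assumes q: "tame q" and b: "\<And>i. i \<notin> I \<Longrightarrow> b i \<ge> 1"
  shows "entire (zeta_cont q a I b)"
proof (rule entire_if_separately_holomorphic)
  fix s :: "(complex, 't) vec" and t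
  show "(\<lambda>z. zeta_cont q a I b (s + axis t z)) holomorphic_on UNIV"
    unfolding holomorphic_on_def
  proof
    fix z0 :: complex
    \<comment> \<open>This disc contains all coordinates of s + axis t z for z within distance 1 of
      z0.\<close>
    define R where "R = norm s + norm z0 + 1"
    obtain M B where f: "symbol_class (param_dom (ball 0 R)) (Inr ` I) M B (symb q a I b)"
      using symb_class_ball[of q I b R a, OF q b] by blast
    interpret reg_setup \<eta> \<epsilon> "param_dom (ball 0 R)" "Inr ` I" "weights \<mu>" by (rule domain_setup) simp
    obtain K where K: "M - \<epsilon> * real K \<le> -2" using order_exists by blast
    define G where "G = reg_iter (weights \<mu>) K (coords I) (symb q a I b)"
    have G: "symbol_class (param_dom (ball 0 R)) (Inr ` I - set (coords I)) M
        ((\<Prod>i\<leftarrow>coords I. reg_const \<eta> \<epsilon> M K (weights \<mu> (i :: 't + 'n))) * B) G"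
      unfolding G_def using f by (intro symbol_class_reg_iter[OF K]) (auto simp: coords set_coords)
    have sR: "point s k \<in> param_dom (ball 0 R) k" for k
    proof (rule point_in_dom)
      show "s $ t \<in> ball 0 R" for t
        using Finite_Cartesian_Product.norm_nth_le[of s t] norm_ge_zero[of z0] unfolding mem_ball_0 R_def by linarith
    qed
    have "(\<lambda>u. G ((point s)(Inl t := u))) holomorphic_on ball 0 R"
      using symbol_classD(2)[OF G sR, of "Inl t"] by (simp add: param_dom_def)
    moreover have "(\<lambda>z. s $ t + z) ` ball z0 1 \<subseteq> ball 0 R"
    proof safe
      fix z assume "z \<in> ball z0 1"
      then have "norm z < norm z0 + 1" using norm_triangle_ineq2[of z z0] by (simp add: dist_norm norm_minus_commute)
      then show "s $ t + z \<in> ball 0 R"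
        using Finite_Cartesian_Product.norm_nth_le[of s t] norm_triangle_ineq[of "s $ t" z] by (simp add: R_def)
    qed
    ultimately have "(\<lambda>u. G ((point s)(Inl t := u))) \<circ> (\<lambda>z. s $ t + z) holomorphic_on ball z0 1"
      by (intro holomorphic_on_compose_gen[where t = "ball 0 R"] holomorphic_intros) auto
    then have h: "(\<lambda>z. zeta_cont q a I b (s + axis t z)) holomorphic_on ball z0 1"
    proof (rule holomorphic_transform)
      fix z assume "z \<in> ball z0 1"
      then have z: "norm z < norm z0 + 1" using norm_triangle_ineq2[of z z0] by (simp add: dist_norm norm_minus_commute)
      have "zeta_cont q a I b (s + axis t z) = G (point (s + axis t z))"
        unfolding zeta_cont_def G_def
      proof (rule reg_lim_eq[OF K _ _ f])
        show "point (s + axis t z) k \<in> param_dom (ball 0 R) k" for k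
        proof (rule point_in_dom)
          show "(s + axis t z) $ t' \<in> ball 0 R" for t'
            using norm_nth_add_axis_le[of s t z t'] z unfolding R_def mem_ball_0 by linarith
        qed
      qed (auto simp: coords set_coords)
      also have "point (s + axis t z) = (point s)(Inl t := s $ t + z)"
        by (auto simp: point_def fun_eq_iff axis_def split: sum.splits)
      finally show "((\<lambda>u. G ((point s)(Inl t := u))) \<circ> (\<lambda>z. s $ t + z)) z = zeta_cont q a I b (s + axis t z)"
        by (simp only: comp_apply)
    qed
    show "(\<lambda>z. zeta_cont q a I b (s + axis t z)) field_differentiable at z0 within UNIV"
      using holomorphic_on_imp_differentiable_at[OF h] by simp
  qed
next
  fix R :: real
  obtain M B where f: "symbol_class (param_dom (ball 0 (R + 1))) (Inr ` I) M B (symb q a I b)"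
    using symb_class_ball[of q I b "R + 1" a, OF q b] by blast
  interpret reg_setup \<eta> \<epsilon> "param_dom (ball 0 (R + 1))" "Inr ` I" "weights \<mu>" by (rule domain_setup) simp
  obtain K where K: "M - \<epsilon> * real K \<le> -2" using order_exists by blast
  define C where "C = (\<Prod>i\<leftarrow>coords I. reg_const \<eta> \<epsilon> M K (weights \<mu> (i :: 't + 'n))) * B"
  have G: "symbol_class (param_dom (ball 0 (R + 1))) (Inr ` I - set (coords I)) M C
      (reg_iter (weights \<mu>) K (coords I) (symb q a I b))"
    unfolding C_def using f by (intro symbol_class_reg_iter[OF K]) (auto simp: coords set_coords)
  show "\<exists>B. \<forall>s. norm s \<le> R \<longrightarrow> norm (zeta_cont q a I b s) \<le> B"
  proof (intro exI[of _ C] allI impI)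
    fix s :: "(complex, 't) vec" assume s: "norm s \<le> R"
    have p: "point s k \<in> param_dom (ball 0 (R + 1)) k" for k
    proof (rule point_in_dom)
      show "s $ t \<in> ball 0 (R + 1)" for t
        using Finite_Cartesian_Product.norm_nth_le[of s t] s by simp
    qed
    have "zeta_cont q a I b s = reg_iter (weights \<mu>) K (coords I) (symb q a I b) (point s)"
      unfolding zeta_cont_def by (rule reg_lim_eq[OF K _ _ f p]) (auto simp: coords set_coords)
    also have "norm \<dots> \<le> C * (\<Prod>i\<in>Inr ` I - set (coords I). (1 + norm (point s i)) powr M)"
      by (rule symbol_classD(1)[OF G p])
    finally show "norm (zeta_cont q a I b s) \<le> C" by (simp add: set_coords)
  qed
qed

text \<open>In the half-space the class has exponent -2, so the order 0 is admissible and the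
  regularised sum is the convergent series. A single \<sigma> for all a, I, b allows the series over
  different faces to be added at the same s.\<close>

lemma cont_has_sum:
  assumes q: "tame q"
  shows "\<exists>\<sigma>. \<forall>a I b s. (\<forall>i. i \<notin> I \<longrightarrow> b i \<ge> 1) \<longrightarrow> (\<forall>t. \<sigma> < Re (s $ t)) \<longrightarrow>
    (zeta_term I (restr a I b (\<lambda>m. q (\<lambda>i. of_nat (m i))))
      (\<lambda>t. restr a I b (\<lambda>m. Pc t (\<lambda>i. of_nat (m i)))) \<mu> s has_sum zeta_cont q a I b s) (I \<rightarrow>\<^sub>E {1..})"
proof -
  obtain \<sigma> where \<sigma>: "\<And>R a I b. (\<forall>i. i \<notin> I \<longrightarrow> b i \<ge> 1) \<Longrightarrow>
    (\<exists>B. symbol_class (param_dom ({z. \<sigma> < Re z} \<inter> ball 0 R)) (Inr ` I) (-2) B (symb q a I b))"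
    using symb_class_halfplane[OF q] by blast
  show ?thesis
  proof (rule exI[of _ \<sigma>], intro allI impI)
    fix a b :: "'n \<Rightarrow> nat" and I :: "'n set" and s :: "(complex, 't) vec"
    assume b: "\<forall>i. i \<notin> I \<longrightarrow> b i \<ge> 1" and s: "\<forall>t. \<sigma> < Re (s $ t)"
    define R where "R = norm s + 1"
    define V where "V = {z. \<sigma> < Re z} \<inter> ball 0 R"
    have V: "open V" unfolding V_def by (intro open_Int open_halfspace_Re_gt open_ball)
    obtain B where f: "symbol_class (param_dom V) (Inr ` I) (-2) B (symb q a I b)"
      using \<sigma>[OF b] unfolding V_def by blast
    interpret reg_setup \<eta> \<epsilon> "param_dom V" "Inr ` I" "weights \<mu>" by (rule domain_setup[OF V])
    have p: "point s k \<in> param_dom V k" for k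
    proof (rule point_in_dom)
      show "s $ t \<in> V" for t
        using Finite_Cartesian_Product.norm_nth_le[of s t] s by (simp add: V_def R_def)
    qed
    have "zeta_cont q a I b s = reg_iter (weights \<mu>) 0 (coords I) (symb q a I b) (point s)"
      unfolding zeta_cont_def by (rule reg_lim_eq[OF _ _ _ f p]) (auto simp: coords set_coords)
    moreover have "((\<lambda>m. (\<Prod>i\<in>set (coords I). weights \<mu> i ^ m i) *
        symb q a I b (\<lambda>i. if i \<in> set (coords I) then of_nat (m i) else point s i))
      has_sum reg_iter (weights \<mu>) 0 (coords I) (symb q a I b) (point s)) (set (coords I) \<rightarrow>\<^sub>E {1..})"
      by (rule has_sum_reg_iter_0[OF _ _ _ f p]) (auto simp: coords set_coords)
    ultimately have *: "((\<lambda>m. (\<Prod>i\<in>Inr ` I. weights \<mu> i ^ m i) *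
        symb q a I b (\<lambda>i. if i \<in> Inr ` I then of_nat (m i) else point s i))
      has_sum zeta_cont q a I b s) (Inr ` I \<rightarrow>\<^sub>E {1..})" by (simp add: set_coords)
    show "(zeta_term I (restr a I b (\<lambda>m. q (\<lambda>i. of_nat (m i))))
      (\<lambda>t. restr a I b (\<lambda>m. Pc t (\<lambda>i. of_nat (m i)))) \<mu> s has_sum zeta_cont q a I b s) (I \<rightarrow>\<^sub>E {1..})"
    \<comment> \<open>The sum has been formed over functions on the sum type; extension by
      \<open>undefined\<close> on the parameters matches them with extensional functions on
      I.\<close>
    proof (rule has_sum_reindex_bij_witness[THEN iffD1, OF _ _ _ _ _ _ *])
      fix g :: "'t + 'n \<Rightarrow> nat" assume g: "g \<in> Inr ` I \<rightarrow>\<^sub>E {1..}"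
      show "case_sum (\<lambda>_. undefined) (g \<circ> Inr) = g"
        using g by (auto simp: fun_eq_iff PiE_iff extensional_def image_iff split: sum.splits)
      show "g \<circ> Inr \<in> I \<rightarrow>\<^sub>E {1..}"
        using g by (auto simp: PiE_iff extensional_def image_iff)
      define m where "m = (\<lambda>i. if i \<in> I then a i + g (Inr i) else b i)"
      have restr_eq: "restr a I b f (g \<circ> Inr) = f m" for f
        by (simp add: restr_def m_def comp_def)
      have e: "emb a I b (\<lambda>i. if Inr i \<in> (Inr ` I :: ('t + 'n) set) then of_nat (g (Inr i)) else point s (Inr i :: 't + 'n)) =
          (\<lambda>i. of_nat (m i))"
        by (auto simp: emb_def m_def fun_eq_iff)
      have "of_nat (m i) \<in> reg_domain \<eta> \<epsilon>" for i
        using g b by (intro of_nat_emb_in_domain) (auto simp: m_def PiE_iff intro: trans_le_add2)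
      then have "Pc t (\<lambda>i. of_nat (m i)) \<noteq> 0" for t using Pc_ge[of "\<lambda>i. of_nat (m i)" t] \<kappa> by auto
      then show "zeta_term I (restr a I b (\<lambda>m. q (\<lambda>i. of_nat (m i))))
          (\<lambda>t. restr a I b (\<lambda>m. Pc t (\<lambda>i. of_nat (m i)))) \<mu> s (g \<circ> Inr) =
        (\<Prod>i\<in>Inr ` I. weights \<mu> i ^ g i) *
        symb q a I b (\<lambda>i. if i \<in> Inr ` I then of_nat (g i) else point s i)"
        unfolding zeta_term_def symb_def e restr_eq
        by (simp add: prod.reindex weights_def powr_def point_def image_iff)
    next
      fix m :: "'n \<Rightarrow> nat" assume m: "m \<in> I \<rightarrow>\<^sub>E {1..}"
      show "case_sum (\<lambda>_. undefined) m \<circ> Inr = m" by (auto simp: fun_eq_iff)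
      show "case_sum (\<lambda>_. undefined) m \<in> Inr ` I \<rightarrow>\<^sub>E {1..}"
        using m by (auto simp: PiE_iff extensional_def image_iff split: sum.splits)
    qed simp
  qed
qed

lemma Zeta_restr:
  assumes q: "tame q" and b: "\<And>i. i \<notin> I \<Longrightarrow> b i \<ge> 1"
  shows "Zeta I (restr a I b (\<lambda>m. q (\<lambda>i. of_nat (m i))))
    (\<lambda>t. restr a I b (\<lambda>m. Pc t (\<lambda>i. of_nat (m i)))) \<mu> = zeta_cont q a I b"
  unfolding Zeta_def
proof (rule zeta_continuation_eq)
  show "entire (zeta_cont q a I b)" using assms by (rule entire_cont)
  from cont_has_sum[OF q] obtain \<sigma> where \<sigma>: "\<forall>a I b s. (\<forall>i. i \<notin> I \<longrightarrow> b i \<ge> 1) \<longrightarrow> (\<forall>t. \<sigma> < Re (s $ t)) \<longrightarrow>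
    (zeta_term I (restr a I b (\<lambda>m. q (\<lambda>i. of_nat (m i))))
      (\<lambda>t. restr a I b (\<lambda>m. Pc t (\<lambda>i. of_nat (m i)))) \<mu> s has_sum zeta_cont q a I b s) (I \<rightarrow>\<^sub>E {1..})"
    by (elim exE) (rule that)
  show "\<exists>\<sigma>. \<forall>s. (\<forall>t. \<sigma> < Re (s $ t)) \<longrightarrow> (zeta_term I (restr a I b (\<lambda>m. q (\<lambda>i. of_nat (m i))))
      (\<lambda>t. restr a I b (\<lambda>m. Pc t (\<lambda>i. of_nat (m i)))) \<mu> s has_sum zeta_cont q a I b s) (I \<rightarrow>\<^sub>E {1..})"
    by (rule exI[of _ \<sigma>], intro allI impI, rule \<sigma>[rule_format]) (use b in auto)
qed

section \<open>The full series, and its values at negative integers as regularised sums of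
  polynomials\<close>

lemma restr_UNIV_zero: "restr (\<lambda>_. 0) UNIV b f = f"
  by (simp add: restr_def fun_eq_iff)

lemma Zeta_UNIV:
  assumes "tame q"
  shows "Zeta UNIV (\<lambda>m. q (\<lambda>i. of_nat (m i))) (\<lambda>t m. Pc t (\<lambda>i. of_nat (m i))) \<mu> =
    zeta_cont q (\<lambda>_. 0) UNIV (\<lambda>_. 0)"
  using Zeta_restr[OF assms, of UNIV "\<lambda>_. 0" "\<lambda>_. 0"] by (simp add: restr_UNIV_zero)

definition poly_reg :: "(('n \<Rightarrow> complex) \<Rightarrow> complex) \<Rightarrow> complex" where
  "poly_reg r = reg_lim (weights \<mu>) (coords UNIV) (\<lambda>p :: 't + 'n \<Rightarrow> complex. r (\<lambda>i. p (Inr i))) (point 0)"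

lemma reg_lim_cong:
  assumes "\<And>q q'. (\<And>i. i \<in> set is \<Longrightarrow> \<exists>d. q i = of_nat (Suc d) \<and> q' i = of_nat (Suc d)) \<Longrightarrow>
    (\<And>i. i \<notin> set is \<Longrightarrow> q i = p i \<and> q' i = p' i) \<Longrightarrow> f q = g q'"
  shows "reg_lim \<nu> is f p = reg_lim \<nu> is g p'"
  unfolding reg_lim_def using reg_iter_cong[of "is" p p' f g, OF assms] by simp

lemma lattice_point:
  fixes p p' :: "'t + 'n \<Rightarrow> complex"
  assumes "\<And>i. i \<in> set (coords UNIV) \<Longrightarrow> \<exists>d. p i = of_nat (Suc d) \<and> p' i = of_nat (Suc d)"
  shows "\<exists>m. (\<forall>i. m i \<ge> (1 :: nat)) \<and> (\<lambda>i. p (Inr i)) = (\<lambda>i. of_nat (m i)) \<and>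
    (\<lambda>i. p' (Inr i)) = (\<lambda>i. of_nat (m i))"
proof -
  have "\<forall>i. \<exists>d. p (Inr i) = of_nat (Suc d) \<and> p' (Inr i) = of_nat (Suc d)"
    using assms by (auto simp: set_coords)
  then obtain d where "\<And>i. p (Inr i) = of_nat (Suc (d i)) \<and> p' (Inr i) = of_nat (Suc (d i))" by metis
  then show ?thesis by (intro exI[of _ "\<lambda>i. Suc (d i)"]) auto
qed

text \<open>At s = -k the powers exp(k Ln P) are ordinary powers, since P does not vanish at lattice
  points. The function r has to match the translated summand only there, which leaves room to
  replace it by its expansion.\<close>

lemma cont_neg_point:
  assumes r: "\<And>m. (\<And>i. m i \<ge> 1) \<Longrightarrow> r (\<lambda>i. of_nat (m i)) =
    q (\<lambda>i. of_nat (a i + m i)) * (\<Prod>t\<in>UNIV. Pc t (\<lambda>i. of_nat (a i + m i)) ^ k t)"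
  shows "zeta_cont q a UNIV b (neg_point k) = poly_reg r"
  unfolding zeta_cont_def poly_reg_def
proof (rule reg_lim_cong)
  fix p p' :: "'t + 'n \<Rightarrow> complex"
  assume 1: "\<And>i. i \<in> set (coords UNIV) \<Longrightarrow> \<exists>d. p i = of_nat (Suc d) \<and> p' i = of_nat (Suc d)"
    and 2: "\<And>i. i \<notin> set (coords UNIV) \<Longrightarrow> p i = point (neg_point k) i \<and> p' i = point 0 i"
  from lattice_point[of p p', OF 1] obtain m where "\<forall>i. m i \<ge> (1 :: nat)" and m: "(\<lambda>i. p (Inr i)) = (\<lambda>i. of_nat (m i))"
    "(\<lambda>i. p' (Inr i)) = (\<lambda>i. of_nat (m i))" by blast
  then have m1: "m i \<ge> 1" for i by blast
  have e: "emb a UNIV b (\<lambda>i. p (Inr i)) = (\<lambda>i. of_nat (a i + m i))"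
    unfolding m(1) by (auto simp: emb_def)
  have "p (Inl t) = - of_nat (k t)" for t
    using 2[of "Inl t"] by (auto simp: set_coords point_def neg_point_def)
  moreover have "exp (of_nat (k t) * Ln (Pc t (\<lambda>i. of_nat (a i + m i)))) =
      Pc t (\<lambda>i. of_nat (a i + m i)) ^ k t" for t
  proof -
    have "of_nat (a i + m i) \<in> reg_domain \<eta> \<epsilon>" for i
      using m1 by (intro of_nat_emb_in_domain) (simp add: trans_le_add2)
    then have "Pc t (\<lambda>i. of_nat (a i + m i)) \<noteq> 0"
      using Pc_ge[of "\<lambda>i. of_nat (a i + m i)" t] \<kappa> by auto
    then show ?thesis by (simp add: exp_of_nat_mult)
  qed
  ultimately show "symb q a UNIV b p = r (\<lambda>i. p' (Inr i))"
    unfolding symb_def e m(2) r[OF m1] by simp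
qed

lemma tame_class:
  assumes r: "tame r"
  shows "\<exists>d::nat. \<forall>M\<ge>d. \<exists>B. symbol_class (param_dom UNIV) (Inr ` UNIV) M B (\<lambda>p. r (\<lambda>i. p (Inr i)))"
proof -
  obtain C d where C: "C > 0" "\<And>w. norm (r w) \<le> C * (\<Prod>i\<in>UNIV. (1 + norm (w i)) ^ d)"
    using r unfolding tame_def by blast
  show ?thesis
  proof (rule exI[of _ d], intro allI impI, rule exI[of _ C], unfold symbol_class_def, intro allI impI conjI)
    fix M and p :: "'t + 'n \<Rightarrow> complex"
    assume M: "real d \<le> M"
    have "norm (r (\<lambda>i. p (Inr i))) \<le> C * (\<Prod>i\<in>UNIV. (1 + norm (p (Inr i))) ^ d)" by (rule C(2))
    also have "\<dots> \<le> C * (\<Prod>i\<in>UNIV. (1 + norm (p (Inr i))) powr M)"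
    proof (intro mult_left_mono prod_mono conjI)
      fix i
      have "(1 + norm (p (Inr i))) ^ d = (1 + norm (p (Inr i))) powr d"
        by (simp add: powr_realpow add_pos_nonneg)
      also have "\<dots> \<le> (1 + norm (p (Inr i))) powr M" using M by (intro powr_mono) auto
      finally show "(1 + norm (p (Inr i))) ^ d \<le> (1 + norm (p (Inr i))) powr M" .
    qed (use C in auto)
    finally show "norm (r (\<lambda>i. p (Inr i))) \<le> C * (\<Prod>i\<in>Inr ` UNIV. (1 + norm (p i)) powr M)"
      by (simp add: prod.reindex)
    show "(\<lambda>z. r (\<lambda>i. (p(k := z)) (Inr i))) holomorphic_on param_dom UNIV k" for k
    proof (rule tame_holomorphic[OF r])
      show "(\<lambda>z. (p(k := z)) (Inr i)) holomorphic_on param_dom UNIV k" for i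
        by (cases "Inr i = k") (auto intro: holomorphic_intros)
    qed
  qed
qed

text \<open>r is first replaced by the linear combination, with which it agrees at lattice points;
  linearity is then used at every order L \<ge> K, where all the iterated sums are stable.\<close>

lemma poly_reg_lincomb:
  assumes J: "finite J" and f: "\<And>j. j \<in> J \<Longrightarrow> tame (f j)"
    and r: "\<And>m. (\<And>i. m i \<ge> 1) \<Longrightarrow> r (\<lambda>i. of_nat (m i)) = (\<Sum>j\<in>J. c j * f j (\<lambda>i. of_nat (m i)))"
  shows "poly_reg r = (\<Sum>j\<in>J. c j * poly_reg (f j))"
proof -
  define F where "F j = (\<lambda>p :: 't + 'n \<Rightarrow> complex. f j (\<lambda>i. p (Inr i)))" for j
  have "\<forall>j. \<exists>d::nat. j \<in> J \<longrightarrow> (\<forall>M\<ge>d. \<exists>B. symbol_class (param_dom UNIV) (Inr ` UNIV) M B (F j))"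
    using tame_class[OF f] unfolding F_def by blast
  then obtain d :: "_ \<Rightarrow> nat" where d: "\<And>j M. j \<in> J \<Longrightarrow> real (d j) \<le> M \<Longrightarrow> \<exists>B. symbol_class (param_dom UNIV) (Inr ` UNIV) M B (F j)"
    by metis
  \<comment> \<open>The sum of the finitely many degrees dominates each of them.\<close>
  define M where "M = real (\<Sum>j\<in>J. d j)"
  have "real (d j) \<le> M" if "j \<in> J" for j unfolding M_def of_nat_le_iff using member_le_sum[OF that, of d] J by simp
  then have "\<forall>j. \<exists>B. j \<in> J \<longrightarrow> symbol_class (param_dom UNIV) (Inr ` UNIV) M B (F j)" using d by blast
  then obtain B where F: "\<And>j. j \<in> J \<Longrightarrow> symbol_class (param_dom UNIV) (Inr ` UNIV) M (B j) (F j)" by metis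
  interpret reg_setup \<eta> \<epsilon> "param_dom UNIV" "Inr ` UNIV" "weights \<mu>" by (rule domain_setup) simp
  obtain K where K: "M - \<epsilon> * real K \<le> -2" using order_exists by blast
  have p0: "point 0 k \<in> param_dom UNIV k" for k by (rule point_in_dom) simp
  have "poly_reg r = reg_lim (weights \<mu>) (coords UNIV) (\<lambda>p. \<Sum>j\<in>J. c j * F j p) (point 0)"
    unfolding poly_reg_def
  proof (rule reg_lim_cong)
    fix p p' :: "'t + 'n \<Rightarrow> complex"
    assume 1: "\<And>i. i \<in> set (coords UNIV) \<Longrightarrow> \<exists>d. p i = of_nat (Suc d) \<and> p' i = of_nat (Suc d)"
    from lattice_point[of p p', OF 1] obtain m where "\<forall>i. m i \<ge> (1 :: nat)" and m: "(\<lambda>i. p (Inr i)) = (\<lambda>i. of_nat (m i))"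
      "(\<lambda>i. p' (Inr i)) = (\<lambda>i. of_nat (m i))" by blast
    then have m1: "m i \<ge> 1" for i by blast
    show "r (\<lambda>i. p (Inr i)) = (\<Sum>j\<in>J. c j * F j p')"
      unfolding F_def m by (rule r[OF m1])
  qed
  also have "\<dots> = (\<Sum>j\<in>J. c j * reg_iter (weights \<mu>) K (coords UNIV) (F j) (point 0))"
    unfolding reg_lim_def
  proof (rule limI, rule tendsto_eventually)
    show "\<forall>\<^sub>F L in sequentially. reg_iter (weights \<mu>) L (coords UNIV) (\<lambda>p. \<Sum>j\<in>J. c j * F j p) (point 0) =
        (\<Sum>j\<in>J. c j * reg_iter (weights \<mu>) K (coords UNIV) (F j) (point 0))"
      unfolding eventually_sequentially
    proof (rule exI[of _ K], intro allI impI)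
      fix L assume L: "K \<le> L"
      have KL: "M - \<epsilon> * real L \<le> -2"
      proof -
        have "\<epsilon> * K \<le> \<epsilon> * L" using L \<epsilon> by (intro mult_left_mono) auto
        then show ?thesis using K by linarith
      qed
      have "reg_iter (weights \<mu>) L (coords UNIV) (\<lambda>p. \<Sum>j\<in>J. c j * F j p) (point 0) =
          (\<Sum>j\<in>J. c j * reg_iter (weights \<mu>) L (coords UNIV) (F j) (point 0))"
        by (rule reg_iter_lincomb[OF KL _ _ F p0]) (auto simp: coords set_coords)
      also have "\<dots> = (\<Sum>j\<in>J. c j * reg_iter (weights \<mu>) K (coords UNIV) (F j) (point 0))"
        by (intro sum.cong refl arg_cong2[of _ _ _ _ "(*)"] reg_iter_le[OF K L _ _ F p0])
          (auto simp: coords set_coords)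
      finally show "reg_iter (weights \<mu>) L (coords UNIV) (\<lambda>p. \<Sum>j\<in>J. c j * F j p) (point 0) =
        (\<Sum>j\<in>J. c j * reg_iter (weights \<mu>) K (coords UNIV) (F j) (point 0))" .
    qed
  qed
  also have "\<dots> = (\<Sum>j\<in>J. c j * poly_reg (f j))"
    unfolding poly_reg_def F_def[symmetric]
    by (intro sum.cong refl arg_cong2[of _ _ _ _ "(*)"] reg_lim_eq[OF K _ _ F p0, symmetric])
      (auto simp: coords set_coords)
  finally show ?thesis .
qed

end

section \<open>The extension attached to the hypotheses\<close>

text \<open>If no P t contained the variable n, the product would stay constant while x n tends to
  infinity with the other coordinates equal to 1.\<close>

lemma prod_at_top_dependence:
  fixes P :: "'t::finite \<Rightarrow> (real, 'n::{finite,linorder}) vec \<Rightarrow> real"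
  assumes P: "\<And>t. mpoly_repr (P t) (S t) (c t)"
    and lim: "filterlim (\<lambda>x. \<Prod>t\<in>UNIV. P t x) at_top
                (inf (filtercomap (\<lambda>x. \<Sum>i\<in>UNIV. \<bar>x $ i\<bar>) at_top) (principal Jset))"
  shows "\<exists>t. \<exists>\<beta>\<in>S t. \<beta> n \<ge> 1"
proof (rule ccontr)
  assume "\<not> ?thesis"
  then have z: "\<beta> n = 0" if "\<beta> \<in> S t" for \<beta> t using that by (metis not_less_eq_eq One_nat_def le_zero_eq)
  define one :: "(real, 'n) vec" where "one = (\<chi> i. 1)"
  have "eventually (\<lambda>x. (\<Prod>t\<in>UNIV. P t one) + 1 \<le> (\<Prod>t\<in>UNIV. P t x))
      (inf (filtercomap (\<lambda>x. \<Sum>i\<in>UNIV. \<bar>x $ i\<bar>) at_top) (principal Jset))"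
    using lim unfolding filterlim_at_top by blast
  then obtain R where R: "\<And>x. R \<le> (\<Sum>i\<in>UNIV. \<bar>x $ i\<bar>) \<Longrightarrow> x \<in> Jset \<Longrightarrow>
      (\<Prod>t\<in>UNIV. P t one) + 1 \<le> (\<Prod>t\<in>UNIV. P t x)"
    unfolding eventually_inf_principal eventually_filtercomap_at_top_linorder by blast
  define x :: "(real, 'n) vec" where "x = (\<chi> i. if i = n then 1 + \<bar>R\<bar> else 1)"
  have "x \<in> Jset" by (auto simp: x_def Jset_def)
  moreover have "R \<le> (\<Sum>i\<in>UNIV. \<bar>x $ i\<bar>)"
    using member_le_sum[of n UNIV "\<lambda>i. \<bar>x $ i\<bar>"] by (simp add: x_def)
  moreover have "P t x = P t one" for t
  proof -
    have "(x $ i) ^ \<beta> i = (one $ i) ^ \<beta> i" if "\<beta> \<in> S t" for \<beta> i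
      using z[OF that] by (cases "i = n") (auto simp: x_def one_def)
    then have "mpoly_eval (S t) (c t) (\<lambda>i. x $ i) = mpoly_eval (S t) (c t) (\<lambda>i. one $ i)"
      unfolding mpoly_eval_def by (intro sum.cong refl arg_cong2[of _ _ _ _ "(*)"] prod.cong) blast
    then show ?thesis using P[of t] by (simp add: mpoly_repr_def)
  qed
  ultimately show False using R[of x] by simp
qed

text \<open>HDF provides widths and growth rates for each t separately; minima over the finitely
  many t give common ones. Growth of the product in the variable n comes from one factor that
  depends on it, the others being bounded below.\<close>

lemma zeta_extension_exists:
  fixes P :: "'t::finite \<Rightarrow> (real, 'n::{finite,linorder}) vec \<Rightarrow> real"
  assumes \<mu>: "\<And>i. cmod (\<mu> i) = 1 \<and> \<mu> i \<noteq> 1"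
    and P: "\<And>t. mpoly_repr (P t) (S t) (c t)"
    and HDF: "\<And>t. HDF (P t)"
    and lim: "filterlim (\<lambda>x. \<Prod>t\<in>UNIV. P t x) at_top
                (inf (filtercomap (\<lambda>x. \<Sum>i\<in>UNIV. \<bar>x $ i\<bar>) at_top) (principal Jset))"
  shows "\<exists>\<eta> \<epsilon> \<kappa> \<delta>. zeta_extension \<eta> \<epsilon> \<kappa> \<delta> (\<lambda>t. mpoly_eval (S t) (c t)) \<mu>"
proof -
  define nbhd where "nbhd t \<eta> \<epsilon> \<longleftrightarrow>
    (\<forall>x (z :: 'n \<Rightarrow> complex). x \<in> Jset \<longrightarrow> (\<forall>i. norm (z i) \<le> \<eta> * (x $ i) powr \<epsilon>) \<longrightarrow>
      norm (mpoly_eval (S t) (c t) (\<lambda>i. of_real (x $ i) + z i) - of_real (P t x)) \<le> P t x / 2)" for t \<eta> \<epsilon>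
  define growth where "growth t \<delta> \<kappa> \<longleftrightarrow> (\<forall>x\<in>Jset. \<kappa> \<le> P t x) \<and>
    (\<forall>n x. (\<exists>\<beta>\<in>S t. \<beta> n \<ge> 1) \<longrightarrow> x \<in> Jset \<longrightarrow> \<kappa> * (x $ n) powr \<delta> \<le> P t x)" for t \<delta> \<kappa>
  have "\<exists>\<eta>>0. \<exists>\<epsilon>>0. nbhd t \<eta> \<epsilon>" for t
    unfolding nbhd_def by (rule HDF_complex_nbhd[OF P HDF])
  then obtain \<eta>' \<epsilon>' where \<eta>': "\<And>t. \<eta>' t > 0" and \<epsilon>': "\<And>t. \<epsilon>' t > 0"
    and nbhd: "\<And>t. nbhd t (\<eta>' t) (\<epsilon>' t)" by metis
  have "\<exists>\<delta>>0. \<exists>\<kappa>>0. growth t \<delta> \<kappa>" for t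
    unfolding growth_def by (rule HDF_growth[OF P HDF])
  then obtain \<delta>' \<kappa>' where \<delta>': "\<And>t. \<delta>' t > 0" and \<kappa>': "\<And>t. \<kappa>' t > 0"
    and growth: "\<And>t. growth t (\<delta>' t) (\<kappa>' t)" by metis
  have P_ge: "\<kappa>' t \<le> P t x" if "x \<in> Jset" for t x
    using growth[of t] that by (simp add: growth_def)
  have P_growth: "\<kappa>' t * (x $ n) powr \<delta>' t \<le> P t x" if "\<exists>\<beta>\<in>S t. \<beta> n \<ge> 1" "x \<in> Jset" for t n x
    using growth[of t] that unfolding growth_def by blast
  define \<eta> where "\<eta> = min (1/2) (Min (range \<eta>'))"
  define \<epsilon> where "\<epsilon> = min 1 (Min (range \<epsilon>'))"
  define \<delta> where "\<delta> = Min (range \<delta>')"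
  \<comment> \<open>The half comes from |Pc t w| \<ge> P t x / 2; the cap at 1 makes powers of
    \<open>\<kappa>0\<close> at most \<open>\<kappa>0\<close>.\<close>
  define \<kappa>0 where "\<kappa>0 = min 1 (Min (range \<kappa>')) / 2"
  \<comment> \<open>One factor \<open>\<kappa>0\<close> for each t, and 3^(-\<delta>) because 1 + |w
    n| \<le> 3 x n.\<close>
  define \<kappa> where "\<kappa> = \<kappa>0 ^ CARD('t) * 3 powr (- \<delta>)"
  have \<eta>: "0 < \<eta>" "\<eta> \<le> 1/2" "\<eta> \<le> \<eta>' t" for t using \<eta>' by (auto simp: \<eta>_def min_le_iff_disj)
  have \<epsilon>: "0 < \<epsilon>" "\<epsilon> \<le> 1" "\<epsilon> \<le> \<epsilon>' t" for t using \<epsilon>' by (auto simp: \<epsilon>_def min_le_iff_disj)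
  have \<delta>: "0 < \<delta>" "\<delta> \<le> \<delta>' t" for t using \<delta>' by (auto simp: \<delta>_def)
  have \<kappa>0: "0 < \<kappa>0" "\<kappa>0 \<le> 1" "\<kappa>0 \<le> \<kappa>' t / 2" for t using \<kappa>' by (auto simp: \<kappa>0_def min_le_iff_disj)
  have three: "3 powr (- \<delta>) \<le> (1 :: real)"
    using \<delta>(1) powr_mono[of "- \<delta>" 0 3] by simp
  have "\<kappa>0 ^ CARD('t) \<le> \<kappa>0 ^ 1" using \<kappa>0 by (intro power_decreasing) (auto simp: Suc_le_eq)
  then have "\<kappa> \<le> \<kappa>0 * 1" unfolding \<kappa>_def using \<kappa>0 three by (intro mult_mono) auto
  then have \<kappa>: "0 < \<kappa>" "\<kappa> \<le> \<kappa>0" using \<kappa>0 by (auto simp: \<kappa>_def)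
  define Pc where "Pc = (\<lambda>t. mpoly_eval (S t) (c t) :: ('n \<Rightarrow> complex) \<Rightarrow> complex)"
  have main: "\<exists>x\<in>Jset. \<forall>i. 1 + norm (w i) \<le> 3 * x $ i \<and> (\<forall>t. norm (Pc t w - of_real (P t x)) \<le> P t x / 2)"
    if w: "\<And>i. w i \<in> reg_domain \<eta> \<epsilon>" for w
  proof -
    have "\<forall>i. \<exists>x\<ge>1. norm (w i - of_real x) < \<eta> * x powr \<epsilon> \<and> 1 + norm (w i) \<le> 3 * x"
      using reg_domain_pos[OF \<eta>(1,2) \<epsilon>(1,2) w] by metis
    then obtain y where y: "\<And>i. y i \<ge> 1" "\<And>i. norm (w i - of_real (y i)) < \<eta> * y i powr \<epsilon>"
      "\<And>i. 1 + norm (w i) \<le> 3 * y i" by metis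
    define x where "x = (\<chi> i. y i)"
    have x: "x \<in> Jset" using y(1) by (auto simp: x_def Jset_def)
    have "norm (Pc t w - of_real (P t x)) \<le> P t x / 2" for t
    proof -
      have "norm (w i - of_real (x $ i)) \<le> \<eta>' t * (x $ i) powr \<epsilon>' t" for i
      proof -
        have "norm (w i - of_real (x $ i)) \<le> \<eta> * y i powr \<epsilon>" using y(2)[of i] by (simp add: x_def)
        also have "\<dots> \<le> \<eta>' t * y i powr \<epsilon>' t"
          using \<eta>(1) \<eta>(3)[of t] \<epsilon>(3)[of t] y(1)[of i] by (intro mult_mono powr_mono) auto
        finally show ?thesis by (simp add: x_def)
      qed
      then show ?thesis
        using nbhd[of t, unfolded nbhd_def, rule_format, of x "\<lambda>i. w i - of_real (x $ i)"] x
        by (simp add: Pc_def)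
    qed
    then show ?thesis using x y(3) by (intro bexI[of _ x]) (auto simp: x_def)
  qed
  have half: "Re (Pc t w) > 0 \<and> P t x / 2 \<le> norm (Pc t w)"
    if "x \<in> Jset" "norm (Pc t w - of_real (P t x)) \<le> P t x / 2" for x t w
  proof -
    have "P t x > 0" using P_ge[OF that(1), of t] \<kappa>'[of t] by linarith
    moreover have "P t x - Re (Pc t w) \<le> norm (Pc t w - of_real (P t x))"
      using abs_Re_le_cmod[of "Pc t w - of_real (P t x)"] by simp
    moreover have "Re (Pc t w) \<le> norm (Pc t w)" by (rule complex_Re_le_cmod)
    ultimately show ?thesis using that(2) by linarith
  qed
  have "zeta_extension \<eta> \<epsilon> \<kappa> \<delta> Pc \<mu>"
  proof
    show "0 < \<eta>" "\<eta> \<le> 1/2" "0 < \<epsilon>" "\<epsilon> \<le> 1" "0 < \<kappa>" "0 < \<delta>" using \<eta> \<epsilon> \<kappa> \<delta> by auto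
    show "\<kappa> \<le> 1" using \<kappa> \<kappa>0 by linarith
    show "norm (\<mu> i) = 1" "\<mu> i \<noteq> 1" for i using \<mu> by auto
    show "tame (Pc t)" for t
      unfolding Pc_def using P[of t] by (intro tame_mpoly_eval) (simp add: mpoly_repr_def)
    show "0 < Re (Pc t w)" if "\<And>i. w i \<in> reg_domain \<eta> \<epsilon>" for t w
      using main[of w, OF that] half by blast
    show "\<kappa> \<le> norm (Pc t w)" if w: "\<And>i. w i \<in> reg_domain \<eta> \<epsilon>" for t w
    proof -
      obtain x where x: "x \<in> Jset" "norm (Pc t w - of_real (P t x)) \<le> P t x / 2" using main[of w, OF w] by blast
      then have "\<kappa>' t / 2 \<le> norm (Pc t w)" using half[OF x] P_ge[OF x(1), of t] by linarith
      then show ?thesis using \<kappa>(2) \<kappa>0(3)[of t] by linarith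
    qed
    show "\<kappa> * (1 + norm (w n)) powr \<delta> \<le> (\<Prod>t\<in>UNIV. norm (Pc t w))" if w: "\<And>i. w i \<in> reg_domain \<eta> \<epsilon>" for n w
    proof -
      obtain x where x: "x \<in> Jset" "\<And>i. 1 + norm (w i) \<le> 3 * x $ i" "\<And>t. norm (Pc t w - of_real (P t x)) \<le> P t x / 2"
        using main[of w, OF w] by blast
      have xn: "x $ n \<ge> 1" using x(1) by (auto simp: Jset_def)
      obtain t0 where t0: "\<exists>\<beta>\<in>S t0. \<beta> n \<ge> 1" using prod_at_top_dependence[OF P lim] by blast
      have "\<kappa>0 * (x $ n) powr \<delta> \<le> P t0 x / 2"
      proof -
        have "\<kappa>0 * (x $ n) powr \<delta> \<le> \<kappa>' t0 / 2 * (x $ n) powr \<delta>' t0"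
          using \<kappa>0(1) \<kappa>0(3)[of t0] \<delta>(2)[of t0] xn by (intro mult_mono powr_mono) auto
        then show ?thesis using P_growth[OF t0 x(1)] by simp
      qed
      then have g0: "\<kappa>0 * (x $ n) powr \<delta> \<le> norm (Pc t0 w)" using half[OF x(1,3)] by (meson order_trans)
      have g: "\<kappa>0 \<le> norm (Pc t w)" for t
        using half[OF x(1,3), of t] P_ge[OF x(1), of t] \<kappa>0(3)[of t] by linarith
      have "(\<Prod>t\<in>UNIV. \<kappa>0 * (if t = t0 then (x $ n) powr \<delta> else 1)) \<le> (\<Prod>t\<in>UNIV. norm (Pc t w))"
        using g0 g \<kappa>0(1) by (intro prod_mono) auto
      then have *: "\<kappa>0 ^ CARD('t) * (x $ n) powr \<delta> \<le> (\<Prod>t\<in>UNIV. norm (Pc t w))"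
        by (simp add: prod.distrib)
      have "(1 + norm (w n)) powr \<delta> \<le> (3 * x $ n) powr \<delta>"
        using x(2)[of n] \<delta>(1) by (intro powr_mono2) auto
      also have "\<dots> = 3 powr \<delta> * (x $ n) powr \<delta>" by (rule powr_mult)
      finally have "\<kappa> * (1 + norm (w n)) powr \<delta> \<le> \<kappa> * (3 powr \<delta> * (x $ n) powr \<delta>)"
        using \<kappa>(1) by (intro mult_left_mono) auto
      also have "\<dots> = \<kappa>0 ^ CARD('t) * (x $ n) powr \<delta>" by (simp add: \<kappa>_def powr_minus)
      finally show ?thesis using * by linarith
    qed
  qed
  then show ?thesis unfolding Pc_def by blast
qed

section \<open>Decomposition of E(a) into faces\<close>

lemma has_sum_finite_disjoint_UN:
  fixes f :: "'a \<Rightarrow> 'b::{topological_comm_monoid_add}"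
  assumes "finite X" "\<And>x. x \<in> X \<Longrightarrow> (f has_sum g x) (B x)"
    "\<And>x y. x \<in> X \<Longrightarrow> y \<in> X \<Longrightarrow> x \<noteq> y \<Longrightarrow> B x \<inter> B y = {}"
  shows "(f has_sum (\<Sum>x\<in>X. g x)) (\<Union>x\<in>X. B x)"
  using assms
proof (induction X)
  case (insert x X)
  have "(f has_sum (g x + (\<Sum>x\<in>X. g x))) (B x \<union> (\<Union>x\<in>X. B x))"
  proof (rule has_sum_Un_disjoint)
    show "(f has_sum (\<Sum>x\<in>X. g x)) (\<Union>x\<in>X. B x)" using insert.prems by (intro insert.IH) auto
    show "B x \<inter> (\<Union>x\<in>X. B x) = {}" using insert.prems(2)[of x] insert.hyps by fastforce
  qed (use insert.prems in auto)
  then show ?case using insert.hyps by simp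
qed simp

text \<open>
  A face is a proper subset I together with the values, at most a, of a point of E(a) off I.
\<close>

definition glue :: "('n \<Rightarrow> nat) \<Rightarrow> 'n set \<Rightarrow> ('n \<Rightarrow> nat) \<Rightarrow> ('n \<Rightarrow> nat) \<Rightarrow> 'n \<Rightarrow> nat" where
  "glue a I b d = (\<lambda>i. if i \<in> I then a i + d i else b i)"

text \<open>The empty I is included: it accounts for the points with every coordinate at most a. The
  values off I start at 1, as do all coordinates of the lattice.\<close>

definition faces :: "('n \<Rightarrow> nat) \<Rightarrow> ('n set \<times> ('n \<Rightarrow> nat)) set" where
  "faces a = Sigma {I. I \<noteq> UNIV} (\<lambda>I. \<Pi>\<^sub>E i\<in>-I. {1..a i})"

lemma finite_faces: "finite (faces (a :: 'n::finite \<Rightarrow> nat))"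
  unfolding faces_def by (intro finite_SigmaI finite_PiE) auto

lemma inj_on_glue: "inj_on (glue a I b) (I \<rightarrow>\<^sub>E {1..})"
proof (rule inj_onI)
  fix d d' assume d: "d \<in> I \<rightarrow>\<^sub>E {1..}" "d' \<in> I \<rightarrow>\<^sub>E {1..}" and eq: "glue a I b d = glue a I b d'"
  show "d = d'"
  proof (rule PiE_ext[OF d])
    fix i assume "i \<in> I"
    then show "d i = d' i" using fun_cong[OF eq, of i] by (simp add: glue_def)
  qed
qed

lemma Eset_eq_UN_glue: "Eset a = (\<Union>(I, b)\<in>faces a. glue a I b ` (I \<rightarrow>\<^sub>E {1..}))"
proof (intro equalityI subsetI)
  fix m assume m: "m \<in> Eset a"
  define I where "I = {i. a i < m i}"
  define b where "b = restrict m (- I)"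
  define d where "d = restrict (\<lambda>i. m i - a i) I"
  have "(I, b) \<in> faces a"
    using m by (auto simp: faces_def Eset_def I_def b_def set_eq_iff not_less)
  moreover have "d \<in> I \<rightarrow>\<^sub>E {1..}" by (auto simp: d_def I_def)
  moreover have "m = glue a I b d"
    by (auto simp: glue_def b_def d_def I_def fun_eq_iff)
  ultimately show "m \<in> (\<Union>(I, b)\<in>faces a. glue a I b ` (I \<rightarrow>\<^sub>E {1..}))" by blast
next
  fix m assume "m \<in> (\<Union>(I, b)\<in>faces a. glue a I b ` (I \<rightarrow>\<^sub>E {1..}))"
  then obtain I b d where f: "(I, b) \<in> faces a" and d: "d \<in> I \<rightarrow>\<^sub>E {1..}" and m: "m = glue a I b d" by blast
  obtain j where "j \<notin> I" using f by (auto simp: faces_def)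
  then have "m j \<le> a j" using f by (auto simp: m glue_def faces_def PiE_iff)
  moreover have "1 \<le> m i" for i
    using f d by (auto simp: m glue_def faces_def PiE_iff intro: trans_le_add2)
  ultimately show "m \<in> Eset a" by (auto simp: Eset_def)
qed

text \<open>I is recovered from a glued point as the set where it exceeds a, and b as its values
  elsewhere, so a point determines its face.\<close>

lemma glue_disjoint:
  assumes "x \<in> faces a" "y \<in> faces a" "x \<noteq> y"
  shows "(case x of (I, b) \<Rightarrow> glue a I b ` (I \<rightarrow>\<^sub>E {1..})) \<inter> (case y of (I, b) \<Rightarrow> glue a I b ` (I \<rightarrow>\<^sub>E {1..})) = {}"
proof (rule ccontr)
  obtain I b J c where xy: "x = (I, b)" "y = (J, c)" by (metis surj_pair)
  assume "\<not> ?thesis"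
  then obtain d e where d: "d \<in> I \<rightarrow>\<^sub>E {1..}" and e: "e \<in> J \<rightarrow>\<^sub>E {1..}" and eq: "glue a I b d = glue a J c e"
    by (auto simp: xy)
  have *: "i \<in> I \<longleftrightarrow> a i < glue a I b d i" if "(I, b) \<in> faces a" "d \<in> I \<rightarrow>\<^sub>E {1..}" for I b d and i
    using that by (auto simp: glue_def faces_def PiE_iff Suc_le_eq not_less)
  have IJ: "I = J"
    using *[OF assms(1)[unfolded xy] d] *[OF assms(2)[unfolded xy] e] eq by auto
  have "b = c"
  proof (rule PiE_ext[of _ "- I" "\<lambda>i. {1..a i}"])
    show "b \<in> (\<Pi>\<^sub>E i\<in>-I. {1..a i})" "c \<in> (\<Pi>\<^sub>E i\<in>-I. {1..a i})"
      using assms(1,2) by (auto simp: xy IJ faces_def)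
    show "b i = c i" if "i \<in> - I" for i
      using fun_cong[OF eq, of i] that by (auto simp: glue_def IJ)
  qed
  then show False using IJ assms(3) xy by simp
qed

lemma zeta_term_glue:
  fixes \<mu> :: "'n::finite \<Rightarrow> complex" and P :: "'t::finite \<Rightarrow> ('n \<Rightarrow> nat) \<Rightarrow> complex"
  shows "zeta_term UNIV Q P \<mu> s (glue a I b d) = (\<Prod>i\<in>I. \<mu> i ^ a i) * (\<Prod>i\<in>-I. \<mu> i ^ b i) *
    zeta_term I (restr a I b Q) (\<lambda>t. restr a I b (P t)) \<mu> s d"
proof -
  have "(\<Prod>i\<in>UNIV. \<mu> i ^ glue a I b d i) =
      (\<Prod>i\<in>UNIV. if i \<in> I then \<mu> i ^ a i * \<mu> i ^ d i else \<mu> i ^ b i)"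
    by (intro prod.cong) (auto simp: glue_def power_add)
  also have "\<dots> = (\<Prod>i\<in>I. \<mu> i ^ a i) * (\<Prod>i\<in>I. \<mu> i ^ d i) * (\<Prod>i\<in>-I. \<mu> i ^ b i)"
    by (simp add: prod.If_cases prod.distrib Compl_eq)
  finally show ?thesis by (simp add: zeta_term_def restr_def glue_def[symmetric] mult_ac)
qed

lemma sum_faces:
  fixes a :: "'n::finite \<Rightarrow> nat"
  shows "(\<Sum>(I, b)\<in>faces a. g I b) =
    (\<Sum>q = 0..CARD('n) - 1. \<Sum>I | card I = q. \<Sum>b\<in>(\<Pi>\<^sub>E i\<in>-I. {1..a i}). g I b)"
proof -
  have "(\<Sum>(I, b)\<in>faces a. g I b) = (\<Sum>I\<in>{I. I \<noteq> UNIV}. \<Sum>b\<in>(\<Pi>\<^sub>E i\<in>-I. {1..a i}). g I b)"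
    unfolding faces_def by (rule sum.Sigma[symmetric]) (auto intro: finite_PiE)
  also have "\<dots> = (\<Sum>q = 0..CARD('n) - 1. \<Sum>I\<in>{I \<in> {I. I \<noteq> UNIV}. card I = q}. \<Sum>b\<in>(\<Pi>\<^sub>E i\<in>-I. {1..a i}). g I b)"
  proof (rule sum.group[symmetric])
    show "card ` {I :: 'n set. I \<noteq> UNIV} \<subseteq> {0..CARD('n) - 1}"
    proof
      fix q assume "q \<in> card ` {I :: 'n set. I \<noteq> UNIV}"
      then obtain I :: "'n set" where "I \<noteq> UNIV" "q = card I" by blast
      then have "q < CARD('n)" by (simp add: psubset_card_mono top.not_eq_extremum)
      then show "q \<in> {0..CARD('n) - 1}" by simp
    qed
  qed auto
  also have "\<dots> = (\<Sum>q = 0..CARD('n) - 1. \<Sum>I | card I = q. \<Sum>b\<in>(\<Pi>\<^sub>E i\<in>-I. {1..a i}). g I b)"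
  proof (rule sum.cong[OF refl])
    fix q assume "q \<in> {0..CARD('n) - 1}"
    moreover have "0 < CARD('n)" by simp
    ultimately have "q < CARD('n)" unfolding atLeastAtMost_iff by linarith
    then have "{I \<in> {I :: 'n set. I \<noteq> UNIV}. card I = q} = {I. card I = q}" by auto
    then show "(\<Sum>I\<in>{I \<in> {I. I \<noteq> UNIV}. card I = q}. \<Sum>b\<in>(\<Pi>\<^sub>E i\<in>-I. {1..a i}). g I b) =
        (\<Sum>I | card I = q. \<Sum>b\<in>(\<Pi>\<^sub>E i\<in>-I. {1..a i}). g I b)" by simp
  qed
  finally show ?thesis .
qed

context zeta_extension
begin

abbreviation (input) "lattice q \<equiv> (\<lambda>m :: 'n \<Rightarrow> nat. q (\<lambda>i. complex_of_nat (m i)))"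

text \<open>In the half-space of convergence E(a) is the disjoint union of its faces, and the
  lattice that of E(a) and its own translate by a. Both sides are entire, so uniqueness of the
  continuation extends these identities to all s.\<close>

lemma
  assumes q: "tame q"
  shows Zeta_boundary_eq: "Zeta_boundary a (lattice q) (\<lambda>t. lattice (Pc t)) \<mu> =
      (\<lambda>s. \<Sum>(I, b)\<in>faces a. (\<Prod>i\<in>I. \<mu> i ^ a i) * (\<Prod>i\<in>-I. \<mu> i ^ b i) * zeta_cont q a I b s)" (is "?L = ?R")
    and cont_split: "zeta_cont q (\<lambda>_. 0) UNIV (\<lambda>_. 0) s =
      (\<Sum>(I, b)\<in>faces a. (\<Prod>i\<in>I. \<mu> i ^ a i) * (\<Prod>i\<in>-I. \<mu> i ^ b i) * zeta_cont q a I b s) +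
      (\<Prod>i\<in>UNIV. \<mu> i ^ a i) * zeta_cont q a UNIV (\<lambda>_. 0) s"
proof -
  obtain \<sigma> where \<sigma>: "\<forall>a I b s. (\<forall>i. i \<notin> I \<longrightarrow> b i \<ge> 1) \<longrightarrow> (\<forall>t. \<sigma> < Re (s $ t)) \<longrightarrow>
    (zeta_term I (restr a I b (lattice q)) (\<lambda>t. restr a I b (lattice (Pc t))) \<mu> s has_sum zeta_cont q a I b s)
      (I \<rightarrow>\<^sub>E {1..})"
    using cont_has_sum[OF q] by (elim exE) (rule that)
  have piece: "(zeta_term UNIV (lattice q) (\<lambda>t. lattice (Pc t)) \<mu> s has_sum
      (\<Prod>i\<in>I. \<mu> i ^ a i) * (\<Prod>i\<in>-I. \<mu> i ^ b i) * zeta_cont q a I b s) (glue a I b ` (I \<rightarrow>\<^sub>E {1..}))"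
    if "\<forall>i. i \<notin> I \<longrightarrow> b i \<ge> 1" "\<forall>t. \<sigma> < Re (s $ t)" for I b s
    unfolding has_sum_reindex[OF inj_on_glue] comp_def zeta_term_glue
    by (intro has_sum_cmult_right \<sigma>[rule_format]) (use that in auto)
  have face_ge: "b i \<ge> 1" if "(I, b) \<in> faces a" "i \<notin> I" for I b i
    using that by (auto simp: faces_def PiE_iff)
  have bd: "(zeta_term UNIV (lattice q) (\<lambda>t. lattice (Pc t)) \<mu> s has_sum ?R s) (Eset a)"
    if s: "\<forall>t. \<sigma> < Re (s $ t)" for s
    unfolding Eset_eq_UN_glue
  proof (rule has_sum_finite_disjoint_UN[OF finite_faces])
    fix x assume x: "x \<in> faces a"
    obtain I b where xI: "x = (I, b)" by fastforce
    show "(zeta_term UNIV (lattice q) (\<lambda>t. lattice (Pc t)) \<mu> s has_sum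
        (case x of (I, b) \<Rightarrow> (\<Prod>i\<in>I. \<mu> i ^ a i) * (\<Prod>i\<in>-I. \<mu> i ^ b i) * zeta_cont q a I b s))
      (case x of (I, b) \<Rightarrow> glue a I b ` (I \<rightarrow>\<^sub>E {1..}))"
      unfolding xI prod.case using x[unfolded xI] s face_ge by (intro piece) auto
  qed (rule glue_disjoint)
  have ent: "entire ?R"
    unfolding case_prod_beta
    using face_ge by (intro entire_sum entire_cmult entire_cont[OF q]) (metis prod.collapse)
  show "?L = ?R"
    unfolding Zeta_boundary_def
  proof (rule zeta_continuation_eq[OF ent])
    show "\<exists>\<sigma>. \<forall>s. (\<forall>t. \<sigma> < Re (s $ t)) \<longrightarrow>
        (zeta_term UNIV (lattice q) (\<lambda>t. lattice (Pc t)) \<mu> s has_sum ?R s) (Eset a)"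
      using bd by blast
  qed
  have "zeta_cont q (\<lambda>_. 0) UNIV (\<lambda>_. 0) = (\<lambda>s. ?R s + (\<Prod>i\<in>UNIV. \<mu> i ^ a i) * zeta_cont q a UNIV (\<lambda>_. 0) s)"
  proof (rule continuation_unique[where \<sigma> = \<sigma>])
    show "entire (zeta_cont q (\<lambda>_. 0) UNIV (\<lambda>_. 0))" by (rule entire_cont[OF q]) simp
    have "entire (zeta_cont q a UNIV (\<lambda>_. 0))" by (rule entire_cont[OF q]) simp
    then show "entire (\<lambda>s. ?R s + (\<Prod>i\<in>UNIV. \<mu> i ^ a i) * zeta_cont q a UNIV (\<lambda>_. 0) s)"
      by (intro entire_add ent entire_cmult)
    fix s :: "(complex, 't) vec" assume s: "\<And>t. \<sigma> < Re (s $ t)"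
    have full: "(zeta_term UNIV (lattice q) (\<lambda>t. lattice (Pc t)) \<mu> s has_sum
        zeta_cont q (\<lambda>_. 0) UNIV (\<lambda>_. 0) s) (UNIV \<rightarrow>\<^sub>E {1..})"
      using \<sigma>[rule_format, of UNIV "\<lambda>_. 0" s "\<lambda>_. 0"] s unfolding restr_UNIV_zero by simp
    have split: "(UNIV \<rightarrow>\<^sub>E {1..}) = Eset a \<union> glue a UNIV (\<lambda>_. 0) ` (UNIV \<rightarrow>\<^sub>E {1..})"
    proof (intro equalityI subsetI)
      fix m :: "'n \<Rightarrow> nat" assume m: "m \<in> UNIV \<rightarrow>\<^sub>E {1..}"
      show "m \<in> Eset a \<union> glue a UNIV (\<lambda>_. 0) ` (UNIV \<rightarrow>\<^sub>E {1..})"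
      proof (cases "m \<in> Eset a")
        case False
        have "1 \<le> m i" for i using m by (auto simp: PiE_iff)
        then have "\<not> m i \<le> a i" for i using False unfolding Eset_def by blast
        then have gt: "a i < m i" for i by (simp add: not_le)
        then have "m = glue a UNIV (\<lambda>_. 0) (\<lambda>i. m i - a i)"
          by (auto simp: glue_def fun_eq_iff less_imp_le)
        moreover have "(\<lambda>i. m i - a i) \<in> UNIV \<rightarrow>\<^sub>E {1..}" using gt by (auto simp: PiE_iff Suc_le_eq)
        ultimately show ?thesis by blast
      qed auto
    qed (auto simp: Eset_def PiE_iff glue_def intro: trans_le_add2)
    have disj: "Eset a \<inter> glue a UNIV (\<lambda>_. 0) ` (UNIV \<rightarrow>\<^sub>E {1..}) = {}"
    proof -
      have "glue a UNIV (\<lambda>_. 0) d \<notin> Eset a" if "d \<in> UNIV \<rightarrow>\<^sub>E {1..}" for d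
        using that by (auto simp: Eset_def glue_def PiE_iff not_le Suc_le_eq)
      then show ?thesis by blast
    qed
    have inner: "(zeta_term UNIV (lattice q) (\<lambda>t. lattice (Pc t)) \<mu> s has_sum
        (\<Prod>i\<in>UNIV. \<mu> i ^ a i) * zeta_cont q a UNIV (\<lambda>_. 0) s) (glue a UNIV (\<lambda>_. 0) ` (UNIV \<rightarrow>\<^sub>E {1..}))"
      using piece[of UNIV "\<lambda>_. 0" s] s by simp
    have full': "(zeta_term UNIV (lattice q) (\<lambda>t. lattice (Pc t)) \<mu> s has_sum
        zeta_cont q (\<lambda>_. 0) UNIV (\<lambda>_. 0) s) (Eset a \<union> glue a UNIV (\<lambda>_. 0) ` (UNIV \<rightarrow>\<^sub>E {1..}))"
      using full by (subst split[symmetric])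
    have "\<forall>t. \<sigma> < Re (s $ t)" using s by blast
    from has_sum_unique[OF full' has_sum_Un_disjoint[OF bd[OF this] inner disj]]
    show "zeta_cont q (\<lambda>_. 0) UNIV (\<lambda>_. 0) s = ?R s + (\<Prod>i\<in>UNIV. \<mu> i ^ a i) * zeta_cont q a UNIV (\<lambda>_. 0) s" .
  qed
  then show "zeta_cont q (\<lambda>_. 0) UNIV (\<lambda>_. 0) s = ?R s + (\<Prod>i\<in>UNIV. \<mu> i ^ a i) * zeta_cont q a UNIV (\<lambda>_. 0) s"
    by (rule fun_cong)
qed

end

section \<open>The relation at negative integers\<close>

lemma real_polynomial_function_shift:
  "real_polynomial_function f \<Longrightarrow> real_polynomial_function (\<lambda>x. f (x + v))"
  using real_polynomial_function_compose[of "\<lambda>x. x + v" f]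
  by (simp add: o_def polynomial_function_add)

lemma real_polynomial_function_Delta:
  "real_polynomial_function f \<Longrightarrow> real_polynomial_function (Delta a f)"
  unfolding Delta_def by (intro real_polynomial_function_diff real_polynomial_function_shift)

lemma on_nat_mpoly:
  "mpoly_repr f S c \<Longrightarrow> on_nat f m = mpoly_eval S c (\<lambda>i. of_nat (m i))"
  using mpoly_eval_of_real[of S c "\<lambda>i. real (m i)"] by (simp add: on_nat_def mpoly_repr_def nvec_def)

lemma prod_binomial_expansion:
  fixes x y :: "'t::finite \<Rightarrow> complex"
  shows "(\<Prod>t\<in>UNIV. (x t + y t) ^ k t) =
    (\<Sum>u | u \<le> k. of_nat (\<Prod>t\<in>UNIV. k t choose u t) * ((\<Prod>t\<in>UNIV. y t ^ (k t - u t)) * (\<Prod>t\<in>UNIV. x t ^ u t)))"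
proof -
  have le: "{u. u \<le> k} = PiE UNIV (\<lambda>t. {..k t})" by (auto simp: le_fun_def PiE_UNIV_domain)
  have "(\<Prod>t\<in>UNIV. (x t + y t) ^ k t) =
      (\<Prod>t\<in>UNIV. \<Sum>j\<le>k t. of_nat (k t choose j) * x t ^ j * y t ^ (k t - j))"
    by (simp add: binomial_ring)
  also have "\<dots> = (\<Sum>u | u \<le> k. \<Prod>t\<in>UNIV. of_nat (k t choose u t) * x t ^ u t * y t ^ (k t - u t))"
    unfolding le by (rule prod_sum_PiE) auto
  finally show ?thesis by (simp add: prod.distrib mult_ac)
qed

lemma sum_le_eq_less:
  fixes k :: "'t::finite \<Rightarrow> nat"
  shows "(\<Sum>u | u \<le> k. g u) = (\<Sum>u | u < k. g u) + (g k :: 'a::comm_monoid_add)"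
proof -
  have "{u. u \<le> k} = PiE UNIV (\<lambda>t. {..k t})" by (auto simp: le_fun_def PiE_UNIV_domain)
  then have "finite {u. u \<le> k}" by (simp add: finite_PiE)
  moreover have "{u. u \<le> k} = insert k {u. u < k}" by auto
  ultimately show ?thesis by (simp add: add.commute)
qed

theorem theorem2:
  fixes \<mu> :: "'n::{finite,linorder} \<Rightarrow> complex"
    and Q :: "(real, 'n) vec \<Rightarrow> real"
    and P :: "'t::finite \<Rightarrow> (real, 'n) vec \<Rightarrow> real"
    and a :: "'n \<Rightarrow> nat"
  assumes \<mu>: "\<And>i. cmod (\<mu> i) = 1 \<and> \<mu> i \<noteq> 1"
    and Q: "real_polynomial_function Q"
    and P: "\<And>t. real_polynomial_function (P t)"
    and HDF: "\<And>t. HDF (P t)"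
    and lim: "filterlim (\<lambda>x. \<Prod>t\<in>UNIV. P t x) at_top
                (inf (filtercomap (\<lambda>x. \<Sum>i\<in>UNIV. \<bar>x $ i\<bar>) at_top) (principal Jset))"
  shows "(\<forall>k :: 't \<Rightarrow> nat.
           (1 - (\<Prod>i\<in>UNIV. \<mu> i ^ a i)) * Zeta UNIV (on_nat Q) (\<lambda>t. on_nat (P t)) \<mu> (neg_point k) =
             (\<Prod>i\<in>UNIV. \<mu> i ^ a i) *
               (\<Sum>u | u < k. of_nat (\<Prod>t\<in>UNIV. k t choose u t) *
                  Zeta UNIV
                    (on_nat (\<lambda>x. Q (x + nvec a) * (\<Prod>t\<in>UNIV. Delta a (P t) x ^ (k t - u t))))
                    (\<lambda>t. on_nat (P t)) \<mu> (neg_point u))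
             + (\<Prod>i\<in>UNIV. \<mu> i ^ a i) *
                 Zeta UNIV (on_nat (Delta a Q)) (\<lambda>t. on_nat (P t)) \<mu> (neg_point k)
             + Zeta_boundary a (on_nat Q) (\<lambda>t. on_nat (P t)) \<mu> (neg_point k)) \<and>
         (\<forall>s :: complex^'t.
           Zeta_boundary a (on_nat Q) (\<lambda>t. on_nat (P t)) \<mu> s =
             (\<Sum>q = 0..CARD('n) - 1. \<Sum>I | card I = q. \<Sum>b\<in>(\<Pi>\<^sub>E i\<in>-I. {1..a i}).
                (\<Prod>i\<in>I. \<mu> i ^ a i) * (\<Prod>i\<in>-I. \<mu> i ^ b i) *
                Zeta I (restr a I b (on_nat Q)) (\<lambda>t. restr a I b (on_nat (P t))) \<mu> s))"
proof -
  have "\<forall>t. \<exists>S c. mpoly_repr (P t) S c" using real_polynomial_function_repr[OF P] by blast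
  then obtain S c where Pr: "\<And>t. mpoly_repr (P t) (S t) (c t)" by metis
  define Pc where "Pc = (\<lambda>t. mpoly_eval (S t) (c t) :: ('n \<Rightarrow> complex) \<Rightarrow> complex)"
  obtain \<eta> \<epsilon> \<kappa> \<delta> where "zeta_extension \<eta> \<epsilon> \<kappa> \<delta> Pc \<mu>"
    using zeta_extension_exists[where \<mu> = \<mu>, OF \<mu> Pr HDF lim] unfolding Pc_def by blast
  then interpret zeta_extension \<eta> \<epsilon> \<kappa> \<delta> Pc \<mu> .
  have Pn: "on_nat (P t) = (\<lambda>m. Pc t (\<lambda>i. of_nat (m i)))" for t
    unfolding Pc_def by (rule ext) (rule on_nat_mpoly[OF Pr])
  have ex: "\<exists>q. tame q \<and> on_nat f = (\<lambda>m. q (\<lambda>i. of_nat (m i)))" if f: "real_polynomial_function f" for f :: "(real, 'n) vec \<Rightarrow> real"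
  proof -
    obtain S c where r: "mpoly_repr f S c" using real_polynomial_function_repr[OF f] by blast
    show ?thesis
    proof (intro exI[of _ "mpoly_eval S c"] conjI)
      show "tame (mpoly_eval S c :: ('n \<Rightarrow> complex) \<Rightarrow> complex)"
        using r by (intro tame_mpoly_eval) (simp add: mpoly_repr_def)
      show "on_nat f = (\<lambda>m. mpoly_eval S c (\<lambda>i. of_nat (m i)))" by (rule ext) (rule on_nat_mpoly[OF r])
    qed
  qed
  \<comment> \<open>The numerators vary with u, so a complexification is chosen for every polynomial
    at once; only tameness and lattice values are used of it.\<close>
  define cx :: "((real, 'n) vec \<Rightarrow> real) \<Rightarrow> ('n \<Rightarrow> complex) \<Rightarrow> complex"
    where "cx f = (SOME q. tame q \<and> on_nat f = (\<lambda>m. q (\<lambda>i. of_nat (m i))))" for f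
  have cx: "tame (cx f)" "on_nat f = (\<lambda>m. cx f (\<lambda>i. of_nat (m i)))"
    if "real_polynomial_function f" for f :: "(real, 'n) vec \<Rightarrow> real"
    using someI_ex[OF ex[OF that], folded cx_def] by (rule conjunct1, rule conjunct2)
  \<comment> \<open>The summand at s = -u with genuine powers in place of logarithms, hence
    tame.\<close>
  define F where "F f u = (\<lambda>w. cx f w * (\<Prod>t\<in>UNIV. Pc t w ^ u t))" for f u
  have tame_F: "tame (F f u)" if "real_polynomial_function f" for f u
    unfolding F_def using cx(1)[OF that] by (intro tame_mult tame_prod tame_power tame_Pc)
  have F_nat: "F f u (\<lambda>i. of_nat (m i)) = on_nat f m * (\<Prod>t\<in>UNIV. on_nat (P t) m ^ u t)"
    if "real_polynomial_function f" for f u m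
    by (simp add: F_def cx(2)[OF that] Pn)
  have Z_cont: "Zeta UNIV (on_nat f) (\<lambda>t. on_nat (P t)) \<mu> = zeta_cont (cx f) (\<lambda>_. 0) UNIV (\<lambda>_. 0)"
    if "real_polynomial_function f" for f
    unfolding cx(2)[OF that] Pn by (rule Zeta_UNIV[OF cx(1)[OF that]])
  have Z_neg: "Zeta UNIV (on_nat f) (\<lambda>t. on_nat (P t)) \<mu> (neg_point u) = poly_reg (F f u)"
    if "real_polynomial_function f" for f u
    unfolding Z_cont[OF that] by (rule cont_neg_point) (simp add: F_def)
  define M where "M = (\<Prod>i\<in>UNIV. \<mu> i ^ a i)"
  have bd: "Zeta_boundary a (on_nat Q) (\<lambda>t. on_nat (P t)) \<mu> =
      (\<lambda>s. \<Sum>(I, b)\<in>faces a. (\<Prod>i\<in>I. \<mu> i ^ a i) * (\<Prod>i\<in>-I. \<mu> i ^ b i) * zeta_cont (cx Q) a I b s)"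
    unfolding cx(2)[OF Q] Pn by (rule Zeta_boundary_eq[OF cx(1)[OF Q]])
  have split: "Zeta UNIV (on_nat Q) (\<lambda>t. on_nat (P t)) \<mu> s =
      Zeta_boundary a (on_nat Q) (\<lambda>t. on_nat (P t)) \<mu> s + M * zeta_cont (cx Q) a UNIV (\<lambda>_. 0) s" for s
    unfolding bd Z_cont[OF Q] M_def by (rule cont_split[OF cx(1)[OF Q]])
  \<comment> \<open>z is the value at -k and c that of the series translated by a, whose expansion c
    = x + y + z contains z again; collecting z gives the factor 1 - M.\<close>
  have rearrange: "(1 - M) * z = M * x + M * y + b" if "z = b + M * c" "c = x + y + z" for b c x y z
    using that by algebra
  show ?thesis
  proof (intro conjI allI)
    fix k :: "'t \<Rightarrow> nat"
    define q where "q u = (\<lambda>x. Q (x + nvec a) * (\<Prod>t\<in>UNIV. Delta a (P t) x ^ (k t - u t)))" for u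
    have q: "real_polynomial_function (q u)" for u
      unfolding q_def
      by (intro real_polynomial_function.intros(4) real_polynomial_function_prod real_polynomial_function_power
          real_polynomial_function_shift real_polynomial_function_Delta Q P) auto
    have \<Delta>Q: "real_polynomial_function (Delta a Q)" using Q by (rule real_polynomial_function_Delta)
    \<comment> \<open>At lattice points this is Q(m + a) times the product of the P t (m + a)^(k t),
      expanded about m.\<close>
    define r where "r = (\<lambda>w. \<Sum>u | u \<le> k. of_nat (\<Prod>t\<in>UNIV. k t choose u t) * F (q u) u w)"
    have shift: "on_nat f (\<lambda>i. a i + m i) = on_nat f m + on_nat (Delta a f) m" for f m
    proof -
      have "nvec (\<lambda>i. a i + m i) = nvec m + nvec a" by (simp add: nvec_def vec_eq_iff)
      then show ?thesis by (simp add: on_nat_def Delta_def)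
    qed
    have q_nat: "on_nat (q u) m = on_nat Q (\<lambda>i. a i + m i) * (\<Prod>t\<in>UNIV. on_nat (Delta a (P t)) m ^ (k t - u t))" for u m
    proof -
      have "nvec (\<lambda>i. a i + m i) = nvec m + nvec a" by (simp add: nvec_def vec_eq_iff)
      then show ?thesis by (simp add: on_nat_def q_def)
    qed
    have "zeta_cont (cx Q) a UNIV (\<lambda>_. 0) (neg_point k) = poly_reg r"
    proof (rule cont_neg_point)
      fix m :: "'n \<Rightarrow> nat"
      have "cx Q (\<lambda>i. of_nat (a i + m i)) * (\<Prod>t\<in>UNIV. Pc t (\<lambda>i. of_nat (a i + m i)) ^ k t) =
          on_nat Q (\<lambda>i. a i + m i) * (\<Prod>t\<in>UNIV. (on_nat (P t) m + on_nat (Delta a (P t)) m) ^ k t)"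
        unfolding shift[symmetric] by (simp add: cx(2)[OF Q] Pn)
      also have "\<dots> = r (\<lambda>i. of_nat (m i))"
        unfolding prod_binomial_expansion r_def F_nat[OF q] q_nat
        by (simp add: sum_distrib_left mult_ac)
      finally show "r (\<lambda>i. of_nat (m i)) =
          cx Q (\<lambda>i. of_nat (a i + m i)) * (\<Prod>t\<in>UNIV. Pc t (\<lambda>i. of_nat (a i + m i)) ^ k t)" by simp
    qed
    also have "\<dots> = (\<Sum>u | u \<le> k. of_nat (\<Prod>t\<in>UNIV. k t choose u t) * poly_reg (F (q u) u))"
    proof (rule poly_reg_lincomb)
      have "{u. u \<le> k} = PiE UNIV (\<lambda>t. {..k t})" by (auto simp: le_fun_def PiE_UNIV_domain)
      then show "finite {u. u \<le> k}" by (simp add: finite_PiE)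
    qed (auto simp: r_def intro: tame_F q)
    also have "\<dots> = (\<Sum>u | u < k. of_nat (\<Prod>t\<in>UNIV. k t choose u t) * poly_reg (F (q u) u)) + poly_reg (F (q k) k)"
      by (simp add: sum_le_eq_less)
    \<comment> \<open>The term u = k carries Q(X + a) alone, which is \<Delta>Q + Q; the booleans
      index this two-term combination so that linearity applies.\<close>
    also have "poly_reg (F (q k) k) = (\<Sum>j\<in>{True, False}. 1 * poly_reg (F (if j then Delta a Q else Q) k))"
    proof (rule poly_reg_lincomb)
      show "tame (F (if j then Delta a Q else Q) k)" for j using Q \<Delta>Q by (auto intro: tame_F)
      show "F (q k) k (\<lambda>i. of_nat (m i)) =
          (\<Sum>j\<in>{True, False}. 1 * F (if j then Delta a Q else Q) k (\<lambda>i. of_nat (m i)))" for m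
        by (simp add: F_nat[OF q] F_nat[OF Q] F_nat[OF \<Delta>Q] q_nat shift algebra_simps)
    qed simp
    also have "\<dots> = poly_reg (F (Delta a Q) k) + poly_reg (F Q k)" by simp
    finally have "zeta_cont (cx Q) a UNIV (\<lambda>_. 0) (neg_point k) =
        (\<Sum>u | u < k. of_nat (\<Prod>t\<in>UNIV. k t choose u t) * Zeta UNIV (on_nat (q u)) (\<lambda>t. on_nat (P t)) \<mu> (neg_point u))
        + Zeta UNIV (on_nat (Delta a Q)) (\<lambda>t. on_nat (P t)) \<mu> (neg_point k)
        + Zeta UNIV (on_nat Q) (\<lambda>t. on_nat (P t)) \<mu> (neg_point k)"
      unfolding Z_neg[OF q] Z_neg[OF Q] Z_neg[OF \<Delta>Q] by (simp only: add.assoc)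
    from rearrange[OF split[of "neg_point k"] this]
    show "(1 - (\<Prod>i\<in>UNIV. \<mu> i ^ a i)) * Zeta UNIV (on_nat Q) (\<lambda>t. on_nat (P t)) \<mu> (neg_point k) =
             (\<Prod>i\<in>UNIV. \<mu> i ^ a i) *
               (\<Sum>u | u < k. of_nat (\<Prod>t\<in>UNIV. k t choose u t) *
                  Zeta UNIV
                    (on_nat (\<lambda>x. Q (x + nvec a) * (\<Prod>t\<in>UNIV. Delta a (P t) x ^ (k t - u t))))
                    (\<lambda>t. on_nat (P t)) \<mu> (neg_point u))
             + (\<Prod>i\<in>UNIV. \<mu> i ^ a i) *
                 Zeta UNIV (on_nat (Delta a Q)) (\<lambda>t. on_nat (P t)) \<mu> (neg_point k)
             + Zeta_boundary a (on_nat Q) (\<lambda>t. on_nat (P t)) \<mu> (neg_point k)"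
      unfolding q_def M_def .
  next
    fix s :: "complex^'t"
    have "Zeta I (restr a I b (on_nat Q)) (\<lambda>t. restr a I b (on_nat (P t))) \<mu> = zeta_cont (cx Q) a I b"
      if "(I, b) \<in> faces a" for I b
      unfolding cx(2)[OF Q] Pn
      by (rule Zeta_restr[OF cx(1)[OF Q]]) (use that in \<open>auto simp: faces_def PiE_iff\<close>)
    then show "Zeta_boundary a (on_nat Q) (\<lambda>t. on_nat (P t)) \<mu> s =
             (\<Sum>q = 0..CARD('n) - 1. \<Sum>I | card I = q. \<Sum>b\<in>(\<Pi>\<^sub>E i\<in>-I. {1..a i}).
                (\<Prod>i\<in>I. \<mu> i ^ a i) * (\<Prod>i\<in>-I. \<mu> i ^ b i) *
                Zeta I (restr a I b (on_nat Q)) (\<lambda>t. restr a I b (on_nat (P t))) \<mu> s)"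
      unfolding sum_faces[symmetric] bd by (intro sum.cong) auto
  qed
qed

end
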